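(* The compact 2-step nilmanifolds $N^j$ and $N^{j'}$ are isospectral for the Laplace-Beltrami operator, i.e. their Laplace-Beltrami operators acting on functions have the same eigenvalues counted with multiplicities.
   Context: General construction: given inner product spaces $\mathfrak v,\mathfrak z$, the orthogonal direct sum $\mathfrak n=\mathfrak v\oplus\mathfrak z$ with inner product $g$, and a linear map $j:\mathfrak z\to\mathfrak{so}(\mathfrak v)$, let $\mathfrak n(j)$ be $\mathfrak n$ with the Lie bracket determined by $[\mathfrak n,\mathfrak z]=0$, $[\mathfrak v,\mathfrak v]\subseteq\mathfrak z$, $g([V,W],Z)=g(j_ZV,W)$ for $V,W\in\mathfrak v$, $Z\in\mathfrak z$; let $N(j)$ be the simply connected Lie group with Lie algebra $\mathfrak n(j)$, with the left-invariant metric induced by $g$, and $\exp^j:\mathfrak n(j)\to N(j)$ its exponential map (a diffeomorphism). Specific data: let $\mathbb H^*=\mathrm{Span}\{\mathbf i,\mathbf j,\mathbf k\}$ be the pure quaternions. Take $\mathfrak v=\mathbb H^*\oplus\mathbb H^*\cong\mathbb R^6$ with orthonormal basis $\{X_{\mathbf i},X_{\mathbf j},X_{\mathbf k},Y_{\mathbf i},Y_{\mathbf j},Y_{\mathbf k}\}$ (standard bases of first and second summand) and $\mathfrak z=\mathbb H^*\cong\mathbb R^3$ with orthonormal basis $\{Z_{\mathbf i},Z_{\mathbf j},Z_{\mathbf k}\}$. For $C\in\mathfrak z$ and $(L,R)\in\mathfrak v$ set $$j_C(L,R)=(\mathrm{Im}(C\cdot L),\mathrm{Im}(C\cdot R)),\qquad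 j'_C(L,R)=(\mathrm{Im}(R\cdot C),\mathrm{Im}(L\cdot C)),$$ with quaternion multiplication and $\mathrm{Im}$ the imaginary part. Let $\mathcal M=\mathrm{Span}_{\mathbb Z}\{X_{\mathbf i},X_{\mathbf j},X_{\mathbf k},Y_{\mathbf i},Y_{\mathbf j},Y_{\mathbf k}\}$, $\mathcal L=\mathrm{Span}_{\mathbb Z}\{\tfrac12Z_{\mathbf i},\tfrac12Z_{\mathbf j},\tfrac12Z_{\mathbf k}\}$, $\mathcal R=\mathcal M+\mathcal L$. Let $\Gamma(j)=\exp^j(\mathcal R)$, a cocompact discrete subgroup of $N(j)$, and let $N^j$ be the compact quotient $\Gamma(j)\backslash N(j)$ with the metric induced by the left-invariant metric of $N(j)$, so that the projection is a Riemannian covering. Define $N^{j'}$ in the same way from $j'$, with the same lattice $\mathcal R$. *)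

theory Defs
  imports
    "HOL-Analysis.Analysis"
    "HOL-Library.Function_Algebras"
    "HOL-Library.Extended_Nat"
begin

section \<open>Orthogonal direct sums\<close>

text \<open>
  The sum index type makes \<open>real ^ ('a + 'b)\<close> the orthogonal direct sum of \<open>real ^ 'a\<close> and
  \<open>real ^ 'b\<close>, with the vectors \<open>axis i 1\<close> as orthonormal basis.
\<close>

definition dsum :: "real ^ 'a \<Rightarrow> real ^ 'b \<Rightarrow> real ^ ('a::finite + 'b::finite)" where
  "dsum v z = (\<chi> i. case i of Inl a \<Rightarrow> v $ a | Inr b \<Rightarrow> z $ b)"

definition lpart :: "real ^ ('a::finite + 'b::finite) \<Rightarrow> real ^ 'a" where
  "lpart x = (\<chi> a. x $ Inl a)"

definition rpart :: "real ^ ('a::finite + 'b::finite) \<Rightarrow> real ^ 'b" where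
  "rpart x = (\<chi> b. x $ Inr b)"

lemma dsum_nth [simp]: "dsum v z $ Inl a = v $ a" "dsum v z $ Inr b = z $ b"
  by (simp_all add: dsum_def)

lemma part_nth [simp]: "lpart x $ a = x $ Inl a" "rpart x $ b = x $ Inr b"
  by (simp_all add: lpart_def rpart_def)

lemma dsum_eqI:
  fixes x y :: "real ^ ('a::finite + 'b::finite)"
  assumes "lpart x = lpart y" "rpart x = rpart y"
  shows "x = y"
  unfolding vec_eq_iff using assms by (metis part_nth sum.exhaust)

lemma part_dsum [simp]: "lpart (dsum v z) = v" "rpart (dsum v z) = z"
  by (simp_all add: vec_eq_iff)

lemma linear_lpart: "linear lpart" and linear_rpart: "linear rpart"
  by (auto intro!: linearI simp: vec_eq_iff)

lemmas part_simps [simp] =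
  linear_add[OF linear_lpart] linear_add[OF linear_rpart]
  linear_cmul[OF linear_lpart] linear_cmul[OF linear_rpart]
  linear_0[OF linear_lpart] linear_0[OF linear_rpart]
  linear_neg[OF linear_lpart] linear_neg[OF linear_rpart]
  linear_diff[OF linear_lpart] linear_diff[OF linear_rpart]

lemma inner_parts: "x \<bullet> y = lpart x \<bullet> lpart y + rpart x \<bullet> rpart y"
proof -
  have "x \<bullet> y = (\<Sum>i\<in>UNIV <+> UNIV. x $ i * y $ i)"
    by (simp add: inner_vec_def)
  also have "\<dots> = lpart x \<bullet> lpart y + rpart x \<bullet> rpart y"
    by (subst sum.Plus) (simp_all add: inner_vec_def)
  finally show ?thesis .
qed

section \<open>The two-step nilpotent Lie algebra \<open>\<nn>(j)\<close> and its simply connected group \<open>N(j)\<close>\<close>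

text \<open>\<open>j\<close> is a linear map from \<open>\<zz> = real ^ 'k\<close> into \<open>\<ss>\<oo>(\<vv>)\<close>, \<open>\<vv> = real ^ 'm\<close>.\<close>

definition so_map :: "(real ^ 'k \<Rightarrow> real ^ 'm \<Rightarrow> real ^ 'm) \<Rightarrow> bool" where
  "so_map j \<longleftrightarrow> bilinear j \<and> (\<forall>Z V W. j Z V \<bullet> W = - (V \<bullet> j Z W))"

definition nil_bracket ::
  "(real ^ 'k \<Rightarrow> real ^ 'm \<Rightarrow> real ^ 'm) \<Rightarrow>
    real ^ ('m::finite + 'k::finite) \<Rightarrow> real ^ ('m + 'k) \<Rightarrow> real ^ ('m + 'k)" where
  "nil_bracket j x y = dsum 0 (\<chi> k. j (axis k 1) (lpart x) \<bullet> lpart y)"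

text \<open>
  By the Baker-Campbell-Hausdorff formula, which for a two-step nilpotent algebra stops after the
  first bracket, the vector space \<open>\<nn>(j)\<close> with the product below is the simply connected Lie group
  with Lie algebra \<open>\<nn>(j)\<close>. It has neutral element \<open>0\<close>, inverse \<open>- x\<close>, and \<open>\<nn>(j)\<close> is its tangent
  space at \<open>0\<close>. The lemmas below establish the group laws, the Lie algebra of left-invariant
  fields, and the exponential map.
\<close>

definition nil_mult ::
  "(real ^ 'k \<Rightarrow> real ^ 'm \<Rightarrow> real ^ 'm) \<Rightarrow>
    real ^ ('m::finite + 'k::finite) \<Rightarrow> real ^ ('m + 'k) \<Rightarrow> real ^ ('m + 'k)" where
  "nil_mult j x y = x + y + (1/2) *\<^sub>R nil_bracket j x y"

definition left_field ::
  "(real ^ 'k \<Rightarrow> real ^ 'm \<Rightarrow> real ^ 'm) \<Rightarrow>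
    real ^ ('m::finite + 'k::finite) \<Rightarrow> real ^ ('m + 'k) \<Rightarrow> real ^ ('m + 'k)" where
  "left_field j X p = frechet_derivative (nil_mult j p) (at 0) X"

text \<open>The value at time 1 of the one-parameter subgroup with initial velocity \<open>X\<close>.\<close>

definition nil_exp ::
  "(real ^ 'k \<Rightarrow> real ^ 'm \<Rightarrow> real ^ 'm) \<Rightarrow>
    real ^ ('m::finite + 'k::finite) \<Rightarrow> real ^ ('m + 'k)" where
  "nil_exp j X = (THE y. \<exists>\<gamma>. (\<forall>s t. \<gamma> (s + t) = nil_mult j (\<gamma> s) (\<gamma> t)) \<and>
      (\<gamma> has_vector_derivative X) (at 0) \<and> y = \<gamma> (1::real))"

lemma nil_bracket_parts [simp]:
  "lpart (nil_bracket j x y) = 0"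
  "rpart (nil_bracket j x y) = (\<chi> k. j (axis k 1) (lpart x) \<bullet> lpart y)"
  by (simp_all add: nil_bracket_def)

context
  fixes j :: "real ^ 'k::finite \<Rightarrow> real ^ 'm::finite \<Rightarrow> real ^ 'm"
  assumes j: "so_map j"
begin

private lemma bil: "bilinear j"
  using j by (simp add: so_map_def)

lemma bilinear_nil_bracket: "bilinear (nil_bracket j)"
  unfolding bilinear_def
  by (auto intro!: linearI dsum_eqI simp: vec_eq_iff bilinear_radd[OF bil] bilinear_rmul[OF bil]
      inner_add_left inner_add_right)

lemma nil_bracket_skew: "nil_bracket j y x = - nil_bracket j x y"
proof (rule dsum_eqI)
  show "rpart (nil_bracket j y x) = rpart (- nil_bracket j x y)"
    using j unfolding so_map_def by (simp add: vec_eq_iff) (metis inner_commute)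
qed simp

lemma nil_bracket_center:
  "nil_bracket j x (dsum 0 z) = 0" "nil_bracket j x (nil_bracket j y w) = 0"
  "nil_bracket j (nil_bracket j y w) x = 0"
proof -
  show *: "nil_bracket j x (nil_bracket j y w) = 0"
    by (rule dsum_eqI) (simp_all add: vec_eq_iff)
  show "nil_bracket j x (dsum 0 z) = 0"
    by (rule dsum_eqI) (simp_all add: vec_eq_iff)
  show "nil_bracket j (nil_bracket j y w) x = 0"
    using nil_bracket_skew[of x "nil_bracket j y w"] * by simp
qed

lemma nil_bracket_inner:
  "nil_bracket j (dsum V 0) (dsum W 0) \<bullet> dsum 0 Z = j Z V \<bullet> W"
proof -
  have lin: "linear (\<lambda>z. j z V)"
    using bil by (simp add: bilinear_def)
  have "j Z V \<bullet> W = j (\<Sum>k\<in>UNIV. Z $ k *\<^sub>R axis k 1) V \<bullet> W"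
    by (simp add: basis_expansion flip: scalar_mult_eq_scaleR)
  also have "\<dots> = (\<Sum>k\<in>UNIV. Z $ k * (j (axis k 1) V \<bullet> W))"
    by (simp add: linear_sum[OF lin] inner_sum_left linear_cmul[OF lin])
  finally show ?thesis
    by (simp add: nil_bracket_def inner_parts) (simp add: inner_vec_def mult.commute)
qed

private lemmas bil_simps =
  bilinear_ladd[OF bilinear_nil_bracket] bilinear_radd[OF bilinear_nil_bracket]
  bilinear_lmul[OF bilinear_nil_bracket] bilinear_rmul[OF bilinear_nil_bracket]
  bilinear_lneg[OF bilinear_nil_bracket] bilinear_rneg[OF bilinear_nil_bracket]
  bilinear_lzero[OF bilinear_nil_bracket] bilinear_rzero[OF bilinear_nil_bracket]

lemma nil_bracket_self: "nil_bracket j x x = 0"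
  using nil_bracket_skew[of x x] by (simp add: equation_minus_iff vec_eq_iff)

lemma nil_mult_group:
  "nil_mult j (nil_mult j x y) w = nil_mult j x (nil_mult j y w)"
  "nil_mult j 0 x = x" "nil_mult j x 0 = x"
  "nil_mult j (- x) x = 0" "nil_mult j x (- x) = 0"
  by (simp_all add: nil_mult_def bil_simps nil_bracket_center nil_bracket_self scaleR_right_distrib)

private lemma bbil: "bounded_bilinear (nil_bracket j)"
  using bilinear_nil_bracket bilinear_conv_bounded_bilinear by blast

lemma has_derivative_nil_mult:
  "(nil_mult j p has_derivative (\<lambda>u. u + (1/2) *\<^sub>R nil_bracket j p u)) (at q)"
  unfolding nil_mult_def
  by (auto intro!: derivative_eq_intros bounded_bilinear.FDERIV[OF bbil] simp: bil_simps)

lemma left_field_eq: "left_field j X p = X + (1/2) *\<^sub>R nil_bracket j p X"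
  unfolding left_field_def
  by (simp flip: frechet_derivative_at[OF has_derivative_nil_mult])

lemma left_field_bracket:
  "frechet_derivative (left_field j Y) (at p) (left_field j X p)
     - frechet_derivative (left_field j X) (at p) (left_field j Y p)
   = left_field j (nil_bracket j X Y) p"
proof -
  have "(left_field j W has_derivative (\<lambda>u. (1/2) *\<^sub>R nil_bracket j u W)) (at p)" for W
    unfolding left_field_eq
    by (auto intro!: derivative_eq_intros bounded_bilinear.FDERIV[OF bbil] simp: bil_simps)
  then have *: "frechet_derivative (left_field j W) (at p) = (\<lambda>u. (1/2) *\<^sub>R nil_bracket j u W)" for W
    by (rule frechet_derivative_at[symmetric])
  show ?thesis
    unfolding * left_field_eq
    by (simp add: bil_simps nil_bracket_center nil_bracket_skew[of Y X] flip: scaleR_add_left)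
qed

lemma one_parameter_subgroup:
  assumes hom: "\<And>s t. \<gamma> (s + t) = nil_mult j (\<gamma> s) (\<gamma> t)"
    and der: "(\<gamma> has_vector_derivative X) (at (0::real))"
  shows "\<gamma> t = t *\<^sub>R X"
proof -
  have comm: "nil_bracket j (\<gamma> s) (\<gamma> t) = 0" for s t
  proof -
    have "nil_mult j (\<gamma> s) (\<gamma> t) = nil_mult j (\<gamma> t) (\<gamma> s)"
      by (metis hom add.commute)
    then have "(1/2) *\<^sub>R nil_bracket j (\<gamma> s) (\<gamma> t) = (1/2) *\<^sub>R nil_bracket j (\<gamma> t) (\<gamma> s)"
      by (simp add: nil_mult_def)
    then show ?thesis
      using nil_bracket_skew[of "\<gamma> s" "\<gamma> t"] by (simp add: equation_minus_iff vec_eq_iff)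
  qed
  have add: "\<gamma> (s + t) = \<gamma> s + \<gamma> t" for s t
    by (simp add: hom[of s t] nil_mult_def comm)
  have zero: "\<gamma> 0 = 0"
    using add[of 0 0] by simp
  have "(\<gamma> has_vector_derivative X) (at s)" for s
  proof -
    have sh: "\<gamma> = (\<lambda>x. \<gamma> s + (\<gamma> \<circ> (\<lambda>x. x - s)) x)"
      using add[of s] by (auto simp: fun_eq_iff) (metis add diff_add_cancel add.commute)
    have "(\<gamma> \<circ> (\<lambda>x. x - s) has_vector_derivative 1 *\<^sub>R X) (at s)"
      by (rule vector_diff_chain_at) (auto intro!: derivative_eq_intros simp: der)
    then have "((\<lambda>x. \<gamma> s + (\<gamma> \<circ> (\<lambda>x. x - s)) x) has_vector_derivative 0 + 1 *\<^sub>R X) (at s)"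
      by (intro has_vector_derivative_add has_vector_derivative_const)
    then show ?thesis
      using sh by simp
  qed
  then have "((\<lambda>s. \<gamma> s - s *\<^sub>R X) has_vector_derivative 0) (at s)" for s
    by (auto intro!: derivative_eq_intros)
  then have "((\<lambda>s. \<gamma> s - s *\<^sub>R X) has_derivative (\<lambda>h. 0)) (at s)" for s
    by (simp add: has_vector_derivative_def)
  then obtain c where "\<And>s. \<gamma> s - s *\<^sub>R X = c"
    using has_derivative_zero_constant[of UNIV "\<lambda>s. \<gamma> s - s *\<^sub>R X"] by auto
  then show ?thesis
    by (metis eq_iff_diff_eq_0 scaleR_zero_left zero)
qed

lemma nil_exp_eq: "nil_exp j X = X"
  unfolding nil_exp_def
proof (rule the_equality)
  have "nil_mult j (s *\<^sub>R X) (t *\<^sub>R X) = (s + t) *\<^sub>R X" for s t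
    by (simp add: nil_mult_def bil_simps nil_bracket_self scaleR_add_left)
  moreover have "((\<lambda>t. t *\<^sub>R X) has_vector_derivative X) (at 0)"
    by (auto intro!: derivative_eq_intros)
  ultimately show "\<exists>\<gamma>. (\<forall>s t. \<gamma> (s + t) = nil_mult j (\<gamma> s) (\<gamma> t)) \<and>
      (\<gamma> has_vector_derivative X) (at 0) \<and> X = \<gamma> (1::real)"
    by (intro exI[of _ "\<lambda>t. t *\<^sub>R X"]) auto
next
  fix y
  assume "\<exists>\<gamma>. (\<forall>s t. \<gamma> (s + t) = nil_mult j (\<gamma> s) (\<gamma> t)) \<and>
      (\<gamma> has_vector_derivative X) (at 0) \<and> y = \<gamma> (1::real)"
  then show "y = X"
    using one_parameter_subgroup by (metis scaleR_one)
qed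

end

section \<open>Smooth functions and the Laplace-Beltrami operator in a global chart\<close>

fun Ck :: "nat \<Rightarrow> (real ^ 'n::finite \<Rightarrow> 'b::real_normed_vector) \<Rightarrow> bool" where
  "Ck 0 f \<longleftrightarrow> continuous_on UNIV f"
| "Ck (Suc k) f \<longleftrightarrow>
     (\<forall>x. f differentiable (at x)) \<and> (\<forall>v. Ck k (\<lambda>x. frechet_derivative f (at x) v))"

definition smooth :: "(real ^ 'n::finite \<Rightarrow> 'b::real_normed_vector) \<Rightarrow> bool" where
  "smooth f \<longleftrightarrow> (\<forall>k. Ck k f)"

definition pderiv_at :: "'n \<Rightarrow> (real ^ 'n::finite \<Rightarrow> 'b::real_normed_vector) \<Rightarrow> real ^ 'n \<Rightarrow> 'b" where
  "pderiv_at i f x = frechet_derivative f (at x) (axis i 1)"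

text \<open>
  \<open>\<Delta> f = - div grad f = - (det g)\<^sup>-\<^sup>1\<^sup>/\<^sup>2 \<Sum>\<^sub>i \<partial>\<^sub>i (\<Sum>\<^sub>j (det g)\<^sup>1\<^sup>/\<^sup>2 g\<^sup>i\<^sup>j \<partial>\<^sub>j f)\<close>, where \<open>G p\<close> is the matrix
  of the metric at \<open>p\<close> in the coordinate basis.
\<close>

definition laplace_beltrami ::
  "(real ^ 'n \<Rightarrow> real ^ 'n ^ 'n) \<Rightarrow> (real ^ 'n::finite \<Rightarrow> 'b::real_normed_vector) \<Rightarrow> real ^ 'n \<Rightarrow> 'b" where
  "laplace_beltrami G f p =
     - ((1 / sqrt (det (G p))) *\<^sub>R
        (\<Sum>i\<in>UNIV. pderiv_at i
           (\<lambda>q. \<Sum>j\<in>UNIV. (sqrt (det (G q)) * matrix_inv (G q) $ i $ j) *\<^sub>R pderiv_at j f q) p))"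

text \<open>
  The left-invariant metric: tangent vectors at \<open>p\<close> are moved to the neutral element by the
  differential of left translation with \<open>p\<^sup>-\<^sup>1 = - p\<close>.
\<close>

definition left_metric ::
  "(real ^ 'k \<Rightarrow> real ^ 'm \<Rightarrow> real ^ 'm) \<Rightarrow>
    real ^ ('m::finite + 'k::finite) \<Rightarrow> real ^ ('m + 'k) \<Rightarrow> real ^ ('m + 'k) \<Rightarrow> real" where
  "left_metric j p u w =
     frechet_derivative (nil_mult j (- p)) (at p) u \<bullet> frechet_derivative (nil_mult j (- p)) (at p) w"

definition metric_matrix ::
  "(real ^ 'k \<Rightarrow> real ^ 'm \<Rightarrow> real ^ 'm) \<Rightarrow>
    real ^ ('m::finite + 'k::finite) \<Rightarrow> real ^ ('m + 'k) ^ ('m + 'k)" where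
  "metric_matrix j p = (\<chi> a b. left_metric j p (axis a 1) (axis b 1))"

section \<open>The quotient \<open>\<Gamma>\<setminus>N(j)\<close> and its Laplace spectrum\<close>

definition nil_proj ::
  "(real ^ 'k \<Rightarrow> real ^ 'm \<Rightarrow> real ^ 'm) \<Rightarrow> (real ^ ('m + 'k)) set \<Rightarrow>
    real ^ ('m::finite + 'k::finite) \<Rightarrow> (real ^ ('m + 'k)) set" where
  "nil_proj j \<Gamma> p = (\<lambda>\<gamma>. nil_mult j \<gamma> p) ` \<Gamma>"

definition nil_quotient ::
  "(real ^ 'k \<Rightarrow> real ^ 'm \<Rightarrow> real ^ 'm) \<Rightarrow> (real ^ ('m + 'k)) set \<Rightarrow>
    (real ^ ('m::finite + 'k::finite)) set set" where
  "nil_quotient j \<Gamma> = range (nil_proj j \<Gamma>)"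

text \<open>
  The projection is a smooth covering and a local isometry, so a function \<open>u\<close> on the quotient is
  smooth iff its lift is, and \<open>(\<Delta>u) \<circ> \<pi> = \<Delta>(u \<circ> \<pi>)\<close>. Functions on the quotient are represented as
  functions on all sets of points that vanish off the quotient.
\<close>

definition laplace_eigenspace ::
  "(real ^ 'k \<Rightarrow> real ^ 'm \<Rightarrow> real ^ 'm) \<Rightarrow> (real ^ ('m::finite + 'k::finite)) set \<Rightarrow>
    complex \<Rightarrow> ((real ^ ('m + 'k)) set \<Rightarrow> complex) set" where
  "laplace_eigenspace j \<Gamma> \<mu> =
     {u. (\<forall>c. c \<notin> nil_quotient j \<Gamma> \<longrightarrow> u c = 0) \<and>
         smooth (u \<circ> nil_proj j \<Gamma>) \<and>
         (\<forall>p. laplace_beltrami (metric_matrix j) (u \<circ> nil_proj j \<Gamma>) p = \<mu> * u (nil_proj j \<Gamma> p))}"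

global_interpretation cfun: vector_space "\<lambda>(c::complex) (f::'a \<Rightarrow> complex) x. c * f x"
  by unfold_locales (auto simp: fun_eq_iff algebra_simps)

text \<open>The multiplicity is \<open>0\<close> iff \<open>\<mu>\<close> is not an eigenvalue.\<close>

definition laplace_multiplicity ::
  "(real ^ 'k \<Rightarrow> real ^ 'm \<Rightarrow> real ^ 'm) \<Rightarrow> (real ^ ('m::finite + 'k::finite)) set \<Rightarrow>
    complex \<Rightarrow> enat" where
  "laplace_multiplicity j \<Gamma> \<mu> =
     (if \<exists>B. finite B \<and> laplace_eigenspace j \<Gamma> \<mu> \<subseteq> cfun.span B
      then enat (cfun.dim (laplace_eigenspace j \<Gamma> \<mu>)) else \<infinity>)"

text \<open>Same eigenvalues with the same multiplicities, for \<open>\<Gamma>\<setminus>N(j)\<close> and \<open>\<Gamma>'\<setminus>N(j')\<close>.\<close>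

definition isospectral_nilmanifolds ::
  "(real ^ 'k \<Rightarrow> real ^ 'm \<Rightarrow> real ^ 'm) \<Rightarrow> (real ^ ('m::finite + 'k::finite)) set \<Rightarrow>
   (real ^ 'k \<Rightarrow> real ^ 'm \<Rightarrow> real ^ 'm) \<Rightarrow> (real ^ ('m + 'k)) set \<Rightarrow> bool" where
  "isospectral_nilmanifolds j \<Gamma> j' \<Gamma>' \<longleftrightarrow>
     (\<forall>\<mu>. laplace_multiplicity j \<Gamma> \<mu> = laplace_multiplicity j' \<Gamma>' \<mu>)"

section \<open>The quaternionic data\<close>

datatype quat = Quat (re_part: real) (i_part: real) (j_part: real) (k_part: real)

fun qmult :: "quat \<Rightarrow> quat \<Rightarrow> quat" where
  "qmult (Quat a b c d) (Quat a' b' c' d') =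
     Quat (a * a' - b * b' - c * c' - d * d')
          (a * b' + b * a' + c * d' - d * c')
          (a * c' - b * d' + c * a' + d * b')
          (a * d' + b * c' - c * b' + d * a')"

text \<open>Pure quaternions are \<open>real ^ 3\<close>, with \<open>\<i>, \<j>, \<k>\<close> the standard basis.\<close>

definition pure_quat :: "real ^ 3 \<Rightarrow> quat" where
  "pure_quat v = Quat 0 (v $ 1) (v $ 2) (v $ 3)"

definition quat_Im :: "quat \<Rightarrow> real ^ 3" where
  "quat_Im q = vector [i_part q, j_part q, k_part q]"

definition j_one :: "real ^ 3 \<Rightarrow> real ^ (3 + 3) \<Rightarrow> real ^ (3 + 3)" where
  "j_one C X = dsum (quat_Im (qmult (pure_quat C) (pure_quat (lpart X))))
                    (quat_Im (qmult (pure_quat C) (pure_quat (rpart X))))"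

definition j_two :: "real ^ 3 \<Rightarrow> real ^ (3 + 3) \<Rightarrow> real ^ (3 + 3)" where
  "j_two C X = dsum (quat_Im (qmult (pure_quat (rpart X)) (pure_quat C)))
                    (quat_Im (qmult (pure_quat (lpart X)) (pure_quat C)))"

lemma so_map_j: "so_map j_one" "so_map j_two"
proof -
  have lin: "linear (j_one C)" "linear (\<lambda>C. j_one C X)" "linear (j_two C)" "linear (\<lambda>C. j_two C X)" for C X
    by (rule linearI; rule dsum_eqI;
        simp add: j_one_def j_two_def quat_Im_def pure_quat_def vec_eq_iff forall_3 algebra_simps)+
  have "j_one C V \<bullet> W = - (V \<bullet> j_one C W)" "j_two C V \<bullet> W = - (V \<bullet> j_two C W)" for C V W
    by (simp_all add: inner_parts j_one_def j_two_def quat_Im_def pure_quat_def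
        inner_vec_def sum_3 algebra_simps)
  with lin show "so_map j_one" "so_map j_two"
    by (simp_all add: so_map_def bilinear_def)
qed

text \<open>The integral span, for a finite \<open>S\<close>.\<close>

definition int_span :: "'a::real_vector set \<Rightarrow> 'a set" where
  "int_span S = {\<Sum>s\<in>S. of_int (c s) *\<^sub>R s | c :: 'a \<Rightarrow> int. True}"

definition lattice_M :: "(real ^ ((3 + 3) + 3)) set" where
  "lattice_M = int_span (range (\<lambda>a. axis (Inl a) 1))"

definition lattice_L :: "(real ^ ((3 + 3) + 3)) set" where
  "lattice_L = int_span (range (\<lambda>b. (1/2) *\<^sub>R axis (Inr b) 1))"

definition lattice_R :: "(real ^ ((3 + 3) + 3)) set" where
  "lattice_R = {m + l | m l. m \<in> lattice_M \<and> l \<in> lattice_L}"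

definition lattice_group :: "(real ^ 3 \<Rightarrow> real ^ (3 + 3) \<Rightarrow> real ^ (3 + 3)) 
    \<Rightarrow> (real ^ ((3 + 3) + 3)) set" where
  "lattice_group j = nil_exp j ` lattice_R"

end

theory Submission
  imports Defs "HOL-Complex_Analysis.Complex_Analysis"
begin

text \<open>
  A Fourier decomposition in the centre splits an eigenspace into parts with a fixed central
  character \<open>2c\<close>. The part with \<open>c = 0\<close> consists of functions on a flat torus and is the same for both
  groups. For \<open>c \<noteq> 0\<close>, in the coordinates \<open>(s, d) = (L + R, L - R)\<close> of \<open>\<vv>\<close> the two brackets become
  \<open>(\<plusminus> s \<times> s' + d \<times> d') / 2\<close>, and the Laplacian becomes a sum of two magnetic Laplacians on
  \<open>real ^ 3\<close>, of fields \<open>\<plusminus>c\<close> and \<open>c\<close>. So the groups differ by the sign of the field in the variable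
  \<open>s\<close>, which complex conjugation in \<open>s\<close> alone would correct. This is made sense of on tensor products:
  the lattice translations by \<open>(e, 0)\<close> act as commuting involutions, so one may fix their signs (which
  are real, hence preserved by conjugation) and then the eigenvalue of the Laplacian in \<open>s\<close>. The
  corresponding space of functions of \<open>s\<close> has a finite basis, and expanding in it and conjugating its
  elements gives a linear isomorphism.

  No elliptic theory is needed. Positivity of the Laplacian follows from the maximum principle; with
  the ladder operators of the Landau levels it shows that every eigenfunction is a finite sum of
  eigenfunctions in \<open>s\<close>. Lowest Landau levels are spaces of entire functions of controlled growth, and
  an entire function that vanishes to high order at \<open>0\<close> is too small, which bounds their dimension.
  Infinite Fourier series never have to be summed: if only finitely many modes are nonzero, an
  eigenfunction equals the sum of its modes, and otherwise both multiplicities are infinite.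
\<close>

section \<open>Dimensions of spaces of complex functions\<close>

text \<open>In the coordinates \<open>(s, d)\<close> the lattice vectors \<open>X\<close> and
  \<open>Y\<close> become \<open>(e, e)\<close> and \<open>(e, - e)\<close>. So
  \<open>(e, 0)\<close> is not a lattice vector but its double is, and this is why translation by
  \<open>(e, 0)\<close> is an involution on invariant functions: its eigenvalues are signs, not
  general phases, which conjugation would invert. These involutions commute because \<open>c\<close>
  is integral.

  A nonzero field \<open>b\<close> on \<open>real ^ 3\<close> has a null direction, that of
  \<open>b\<close> itself. The argument with entire functions controls a function only in the plane
  orthogonal to \<open>b\<close>; fixing a Fourier mode along \<open>b\<close> settles the remaining
  direction, and the signs force the period \<open>2 b\<close> for it. Conjugation turns mode
  \<open>n\<close> along \<open>b\<close> into mode \<open>n\<close> along \<open>- b\<close>, so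
  this extra condition has its exact counterpart for the reversed field.

  The comparison of the fields \<open>(b, c)\<close> and \<open>(- b, c)\<close> is made as an
  inequality of dimensions for arbitrary nonzero \<open>b\<close>; exchanging \<open>b\<close> and
  \<open>- b\<close> gives the reverse inequality.\<close>

definition mdim :: "('a \<Rightarrow> complex) set \<Rightarrow> enat" where
  "mdim E = (if \<exists>B. finite B \<and> E \<subseteq> cfun.span B then enat (cfun.dim E) else \<infinity>)"

text \<open>Linearity is asked for on \<open>E\<close> only: the operators are built from
  \<open>frechet_derivative\<close>, whose additivity holds for differentiable functions.\<close>

definition linear_on :: "('a \<Rightarrow> complex) set \<Rightarrow> (('a \<Rightarrow> complex) \<Rightarrow> 'b \<Rightarrow> complex) \<Rightarrow> bool" where
  "linear_on E \<Theta> \<longleftrightarrow> (\<forall>f\<in>E. \<forall>g\<in>E. \<Theta> (f + g) = \<Theta> f + \<Theta> g) \<and>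
     (\<forall>c. \<forall>f\<in>E. \<Theta> (\<lambda>x. c * f x) = (\<lambda>x. c * \<Theta> f x))"

lemma linear_onD:
  assumes "linear_on E \<Theta>" "f \<in> E"
  shows "g \<in> E \<Longrightarrow> \<Theta> (f + g) = \<Theta> f + \<Theta> g" "\<Theta> (\<lambda>x. c * f x) = (\<lambda>x. c * \<Theta> f x)"
  using assms by (auto simp: linear_on_def)

lemma linear_on_zero:
  assumes "linear_on E \<Theta>" "cfun.subspace E"
  shows "\<Theta> 0 = 0"
  using linear_onD(2)[OF assms(1) cfun.subspace_0[OF assms(2)], of 0] by (simp add: zero_fun_def)

lemma sum_fun_apply: "(\<Sum>i\<in>F. y i) x = (\<Sum>i\<in>F. y i x)"
  for y :: "'i \<Rightarrow> 'a \<Rightarrow> 'b::comm_monoid_add"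
  by (induction F rule: infinite_finite_induct) auto

lemma linear_on_sum:
  assumes "linear_on E \<Theta>" "cfun.subspace E" "finite S" "\<And>i. i \<in> S \<Longrightarrow> y i \<in> E"
  shows "\<Theta> (\<Sum>i\<in>S. y i) = (\<Sum>i\<in>S. \<Theta> (y i))"
  using assms(3,4)
proof (induction S rule: finite_induct)
  case empty
  show ?case by (simp only: sum.empty linear_on_zero[OF assms(1,2)])
next
  case (insert a S)
  then have "\<Theta> (y a + (\<Sum>i\<in>S. y i)) = \<Theta> (y a) + \<Theta> (\<Sum>i\<in>S. y i)"
    by (intro linear_onD(1)[OF assms(1)]) (auto intro!: cfun.subspace_sum assms(2))
  then show ?case using insert by (simp only: sum.insert insert_iff simp_thms)
qed

lemma linear_on_mono: "linear_on E \<Theta> \<Longrightarrow> D \<subseteq> E \<Longrightarrow> linear_on D \<Theta>"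
  unfolding linear_on_def by blast

text \<open>An injective linear map carries a basis of \<open>E\<close> to an independent subset of
  \<open>E'\<close>, and a finite basis of \<open>E'\<close> bounds its size. Finiteness of
  \<open>E\<close> comes out on the way.\<close>

lemma mdim_le_inj:
  assumes sub: "cfun.subspace E" and lin: "linear_on E \<Theta>"
    and inj: "\<And>f. f \<in> E \<Longrightarrow> \<Theta> f = 0 \<Longrightarrow> f = 0" and into: "\<And>f. f \<in> E \<Longrightarrow> \<Theta> f \<in> E'"
  shows "mdim E \<le> mdim E'"
proof (cases "\<exists>B. finite B \<and> E' \<subseteq> cfun.span B")
  case False
  then have "mdim E' = \<infinity>" unfolding mdim_def by (rule if_not_P)
  then show ?thesis by simp
next
  case True
  then obtain B where B: "finite B" "E' \<subseteq> cfun.span B" by blast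
  obtain B' where B': "B' \<subseteq> E'" "cfun.independent B'" "E' \<subseteq> cfun.span B'" "card B' = cfun.dim E'"
    using cfun.basis_exists by blast
  have finB': "finite B'"
    using cfun.independent_span_bound[OF B(1) B'(2)] B(2) B'(1) by blast
  obtain S where S: "S \<subseteq> E" "cfun.independent S" "E \<subseteq> cfun.span S" "card S = cfun.dim E"
    using cfun.basis_exists by blast
  have comb: "\<Theta> (\<Sum>v\<in>T. (\<lambda>x. u v * v x)) = (\<Sum>v\<in>T. (\<lambda>x. u v * \<Theta> v x))" if "finite T" "T \<subseteq> S" for T u
  proof -
    have "\<Theta> (\<Sum>v\<in>T. (\<lambda>x. u v * v x)) = (\<Sum>v\<in>T. \<Theta> (\<lambda>x. u v * v x))"
      using that S(1) by (intro linear_on_sum[OF lin sub]) (auto intro!: cfun.subspace_scale[OF sub])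
    also have "\<dots> = (\<Sum>v\<in>T. (\<lambda>x. u v * \<Theta> v x))"
      using that S(1) by (intro sum.cong refl linear_onD(2)[OF lin]) auto
    finally show ?thesis .
  qed
  have injS: "inj_on \<Theta> S"
  proof (rule inj_onI)
    fix f g assume fg: "f \<in> S" "g \<in> S" "\<Theta> f = \<Theta> g"
    have fgE: "f \<in> E" "g \<in> E" using fg S(1) by auto
    have "\<Theta> (f + (\<lambda>x. (-1) * g x)) = \<Theta> f + (\<lambda>x. (-1) * \<Theta> g x)"
      by (simp only: linear_onD(1)[OF lin fgE(1) cfun.subspace_scale[OF sub fgE(2)]]
          linear_onD(2)[OF lin fgE(2)])
    also have "\<dots> = 0" using fg by (auto simp: fun_eq_iff)
    finally have "f + (\<lambda>x. (-1) * g x) = 0"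
      using fg S(1) cfun.subspace_add[OF sub] cfun.subspace_scale[OF sub, of g "-1"] by (intro inj) auto
    then show "f = g" by (auto simp: fun_eq_iff)
  qed
  have "cfun.independent (\<Theta> ` S)"
    unfolding cfun.independent_explicit_finite_subsets
  proof (intro allI impI)
    fix T u assume T: "T \<subseteq> \<Theta> ` S" "finite T" "(\<Sum>v\<in>T. (\<lambda>x. u v * v x)) = 0"
    then obtain T' where T': "T' \<subseteq> S" "T = \<Theta> ` T'" by (meson subset_imageE)
    have inj': "inj_on \<Theta> T'" using injS T'(1) inj_on_subset by blast
    have finT': "finite T'" using T(2) T'(2) inj' finite_imageD by blast
    have "(\<Sum>v\<in>T'. (\<lambda>x. u (\<Theta> v) * \<Theta> v x)) = 0"
      using T(3) by (simp add: T'(2) sum.reindex[OF inj'])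
    then have "\<Theta> (\<Sum>v\<in>T'. (\<lambda>x. u (\<Theta> v) * v x)) = 0"
      using comb[OF finT' T'(1), of "u \<circ> \<Theta>"] by simp
    then have "(\<Sum>v\<in>T'. (\<lambda>x. u (\<Theta> v) * v x)) = 0"
      by (rule inj[rotated]) (use S(1) T'(1) in \<open>auto intro!: cfun.subspace_sum[OF sub]
          cfun.subspace_scale[OF sub]\<close>)
    then have "\<forall>v\<in>T'. u (\<Theta> v) = 0"
      using S(2)[unfolded cfun.independent_explicit_finite_subsets, rule_format, of T' "u \<circ> \<Theta>"]
          T'(1) finT'
      by auto
    then show "\<forall>v\<in>T. u v = 0" by (simp add: T'(2))
  qed
  moreover have "\<Theta> ` S \<subseteq> cfun.span B'" using S(1) into B'(3) by blast
  ultimately have *: "finite (\<Theta> ` S)" "card (\<Theta> ` S) \<le> card B'"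
    using cfun.independent_span_bound[OF finB'] by blast+
  have "finite S" using *(1) injS finite_imageD by blast
  moreover have "cfun.dim E \<le> cfun.dim E'"
    using *(2) S(4) B'(4) by (simp add: card_image[OF injS])
  ultimately show ?thesis
    using S(3) True by (auto simp: mdim_def)
qed

text \<open>The index \<open>t\<close> lets one notion serve both a one-parameter group of
  translations, whose joint eigenspaces are Fourier modes, and a single operator, with
  \<open>t\<close> of type \<open>unit\<close>.\<close>

definition joint_eigenspace ::
  "('t \<Rightarrow> ('a \<Rightarrow> complex) \<Rightarrow> 'a \<Rightarrow> complex) \<Rightarrow> ('a \<Rightarrow> complex) set \<Rightarrow> ('t \<Rightarrow> complex) \<Rightarrow> ('a \<Rightarrow> complex) set"
      where
  "joint_eigenspace Q E \<theta> = {f \<in> E. \<forall>t. Q t f = (\<lambda>x. \<theta> t * f x)}"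

lemma subspace_joint_eigenspace:
  assumes sub: "cfun.subspace E" and lin: "\<And>t. linear_on E (Q t)"
  shows "cfun.subspace (joint_eigenspace Q E \<theta>)"
proof (rule cfun.subspaceI)
  have "Q t 0 = (\<lambda>x. \<theta> t * 0 x)" for t
    unfolding linear_on_zero[OF lin sub] by (rule ext) simp
  then show "0 \<in> joint_eigenspace Q E \<theta>"
    using cfun.subspace_0[OF sub] unfolding joint_eigenspace_def by blast
next
  fix f g assume fg: "f \<in> joint_eigenspace Q E \<theta>" "g \<in> joint_eigenspace Q E \<theta>"
  then have a: "f \<in> E" "g \<in> E" "\<And>t. Q t f = (\<lambda>x. \<theta> t * f x)" "\<And>t. Q t g = (\<lambda>x. \<theta> t * g x)"
    by (simp_all add: joint_eigenspace_def)
  have "Q t (f + g) = (\<lambda>x. \<theta> t * (f + g) x)" for t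
    unfolding linear_onD(1)[OF lin a(1,2)] by (rule ext) (simp add: a(3,4) distrib_left)
  then show "f + g \<in> joint_eigenspace Q E \<theta>"
    using cfun.subspace_add[OF sub a(1,2)] unfolding joint_eigenspace_def by blast
next
  fix c f assume "f \<in> joint_eigenspace Q E \<theta>"
  then have a: "f \<in> E" "\<And>t. Q t f = (\<lambda>x. \<theta> t * f x)"
    by (simp_all add: joint_eigenspace_def)
  have "Q t (\<lambda>x. c * f x) = (\<lambda>x. \<theta> t * (c * f x))" for t
    unfolding linear_onD(2)[OF lin a(1)] by (rule ext) (simp add: a(2))
  then show "(\<lambda>x. c * f x) \<in> joint_eigenspace Q E \<theta>"
    using cfun.subspace_scale[OF sub a(1)] unfolding joint_eigenspace_def by blast
qed

text \<open>Induction on the number of terms: applying \<open>Q t\<close> to a relation and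
  subtracting \<open>\<theta> a t\<close> times it removes the term \<open>a\<close> and multiplies
  each other term by \<open>\<theta> i t - \<theta> a t\<close>. For each \<open>i\<close>
  separation provides a \<open>t\<close> with nonzero factor.\<close>

lemma joint_eigenspaces_independent:
  assumes sub: "cfun.subspace E" and lin: "\<And>t. linear_on E (Q t)"
    and sep: "\<And>i j. i \<in> I \<Longrightarrow> j \<in> I \<Longrightarrow> i \<noteq> j \<Longrightarrow> \<exists>t. \<theta> i t \<noteq> \<theta> j t"
    and "finite F" "F \<subseteq> I" "\<And>i. i \<in> F \<Longrightarrow> y i \<in> joint_eigenspace Q E (\<theta> i)" "(\<Sum>i\<in>F. y i) = 0"
  shows "\<forall>i\<in>F. y i = 0"
  using assms(4-)
proof (induction F arbitrary: y rule: finite_induct)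
  case (insert a F)
  have yE: "y i \<in> E" "Q t (y i) = (\<lambda>x. \<theta> i t * y i x)" if "i \<in> insert a F" for i t
    using insert.prems(2) that by (auto simp: joint_eigenspace_def)
  have sum0: "y a x + (\<Sum>i\<in>F. y i x) = 0" for x
    using fun_cong[OF insert.prems(3), of x] insert.hyps by (simp add: sum_fun_apply)
  have "y i = 0" if "i \<in> F" for i
  proof -
    have "a \<in> I" "i \<in> I" "a \<noteq> i" using insert.prems(1) insert.hyps that by auto
    from sep[OF this] obtain t where t: "\<theta> a t \<noteq> \<theta> i t" by blast
    have "Q t (\<Sum>i\<in>insert a F. y i) = (\<Sum>i\<in>insert a F. Q t (y i))"
      using yE insert.hyps by (intro linear_on_sum[OF lin sub]) auto
    then have "(\<Sum>i\<in>insert a F. Q t (y i)) = 0"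
      by (simp only: insert.prems(3) linear_on_zero[OF lin sub])
    then have e: "\<theta> a t * y a x + (\<Sum>i\<in>F. \<theta> i t * y i x) = 0" for x
      using yE(2) insert.hyps by (simp add: fun_eq_iff sum_fun_apply)
    have "(\<Sum>i\<in>F. (\<lambda>x. (\<theta> i t - \<theta> a t) * y i x)) = 0"
    proof
      fix x
      have "(\<Sum>i\<in>F. (\<theta> i t - \<theta> a t) * y i x) = (\<Sum>i\<in>F. \<theta> i t * y i x) - \<theta> a t * (\<Sum>i\<in>F. y i x)"
        by (simp add: sum_subtractf sum_distrib_left left_diff_distrib)
      also have "\<dots> = 0" using e[of x] sum0[of x]
        by (metis add_diff_cancel_left' add_eq_0_iff eq_neg_iff_add_eq_0 mult_minus_right
            right_minus_eq)
      finally show "(\<Sum>i\<in>F. (\<lambda>x. (\<theta> i t - \<theta> a t) * y i x)) x = 0 x"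
        by (simp add: sum_fun_apply)
    qed
    moreover have "(\<lambda>x. (\<theta> i t - \<theta> a t) * y i x) \<in> joint_eigenspace Q E (\<theta> i)" if "i \<in> F" for i
      using insert.prems(2)[of i] that
          by (intro cfun.subspace_scale subspace_joint_eigenspace sub lin) auto
    ultimately have "\<forall>i\<in>F. (\<lambda>x. (\<theta> i t - \<theta> a t) * y i x) = 0"
      using insert.prems(1) by (intro insert.IH) auto
    then show ?thesis using that t by (auto simp: fun_eq_iff)
  qed
  moreover from this have "y a x = 0" for x using sum0[of x] by simp
  ultimately show ?case by (auto simp: fun_eq_iff)
qed simp

text \<open>
  The spanning hypothesis is stated only for eigenspaces that vanish off a finite set, so that it
  also holds for infinite (Fourier) decompositions.
\<close>

lemma mdim_le_decomposition:
  fixes E :: "('a \<Rightarrow> complex) set" and E' :: "('b \<Rightarrow> complex) set" and I :: "'i set"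
  assumes sub: "cfun.subspace E'" and lin: "\<And>t. linear_on E' (Q' t)"
    and sep: "\<And>i j. i \<in> I \<Longrightarrow> j \<in> I \<Longrightarrow> i \<noteq> j \<Longrightarrow> \<exists>t. \<theta> i t \<noteq> \<theta> j t"
    and full: "\<And>F. finite F \<Longrightarrow> F \<subseteq> I \<Longrightarrow> (\<And>i. i \<in> I - F \<Longrightarrow> joint_eigenspace Q E (\<theta> i) \<subseteq> {0})
      \<Longrightarrow> E \<subseteq> cfun.span (\<Union>i\<in>F. joint_eigenspace Q E (\<theta> i))"
    and le: "\<And>i. i \<in> I \<Longrightarrow> mdim (joint_eigenspace Q E (\<theta> i)) \<le> mdim (joint_eigenspace Q' E' (\<theta> i))"
  shows "mdim E \<le> mdim E'"
proof (cases "\<exists>B. finite B \<and> E' \<subseteq> cfun.span B")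
  case False
  then have "mdim E' = \<infinity>" unfolding mdim_def by (rule if_not_P)
  then show ?thesis by simp
next
  case True
  then obtain B where B: "finite B" "E' \<subseteq> cfun.span B" by blast
  define D where "D i = joint_eigenspace Q E (\<theta> i)" for i
  define D' where "D' i = joint_eigenspace Q' E' (\<theta> i)" for i
  have D'E: "D' i \<subseteq> E'" for i by (auto simp: D'_def joint_eigenspace_def)
  have sD': "cfun.subspace (D' i)" for i
    unfolding D'_def by (intro subspace_joint_eigenspace sub lin)
  have indep: "\<forall>i\<in>F. y i = 0"
    if "finite F" "F \<subseteq> I" "\<And>i. i \<in> F \<Longrightarrow> y i \<in> D' i" "(\<Sum>i\<in>F. y i) = 0" for F y
    by (rule joint_eigenspaces_independent[where I = I
        and \<theta> = \<theta>, OF sub lin sep that(1,2) that(3)[unfolded D'_def] that(4)])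
  have "\<forall>i. \<exists>b. b \<subseteq> D' i \<and> cfun.independent b \<and> D' i \<subseteq> cfun.span b \<and> card b = cfun.dim (D' i)"
    by (intro allI, rule cfun.basis_exists) blast
  from choice[OF this] obtain b where b: "\<And>i. b i \<subseteq> D' i" "\<And>i. cfun.independent (b i)"
    "\<And>i. D' i \<subseteq> cfun.span (b i)" "\<And>i. card (b i) = cfun.dim (D' i)" by blast
  have finb: "finite (b i)" for i
    using cfun.independent_span_bound[OF B(1) b(2)] b(1) D'E B(2) by blast
  have disj: "b i \<inter> b j = {}" if ij: "i \<in> I" "j \<in> I" "i \<noteq> j" for i j
  proof (rule ccontr)
    assume "b i \<inter> b j \<noteq> {}"
    then obtain f where f: "f \<in> b i" "f \<in> b j" by blast
    then have "f \<in> D' i" "f \<in> D' j" using b(1) by blast+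
    then obtain t where "\<theta> i t \<noteq> \<theta> j t" "(\<lambda>x. \<theta> i t * f x) = (\<lambda>x. \<theta> j t * f x)"
      using sep[OF ij] by (force simp: D'_def joint_eigenspace_def)
    then have "f = 0" by (auto simp: fun_eq_iff)
    then show False using f(1) b(2) cfun.dependent_zero by blast
  qed
  have "cfun.independent (\<Union>i\<in>I. b i)"
    unfolding cfun.independent_explicit_finite_subsets
  proof (intro allI impI)
    fix T u assume T: "T \<subseteq> (\<Union>i\<in>I. b i)" "finite T" "(\<Sum>v\<in>T. (\<lambda>x. u v * v x)) = 0"
    \<comment> \<open>Only finitely many eigenspaces meet \<open>T\<close>. Grouping the relation by
      eigenspace gives a finite sum to which \<open>indep\<close> applies; inside each group the
      independence of \<open>b i\<close> finishes.\<close>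
    define F where "F = {i \<in> I. T \<inter> b i \<noteq> {}}"
    have "\<exists>i\<in>I. v \<in> b i" if "v \<in> T" for v using T(1) that by blast
    then obtain k where k: "\<And>v. v \<in> T \<Longrightarrow> k v \<in> I \<and> v \<in> b (k v)" by metis
    have "F \<subseteq> k ` T"
    proof
      fix i assume "i \<in> F"
      then obtain v where v: "v \<in> T" "v \<in> b i" "i \<in> I" by (auto simp: F_def)
      then have "k v = i" using disj[of "k v" i] k[OF v(1)] by auto
      then show "i \<in> k ` T" using v by blast
    qed
    then have finF: "finite F" using T(2) finite_surj by blast
    have TU: "T = (\<Union>i\<in>F. T \<inter> b i)" using k by (auto simp: F_def)
    have "(\<Sum>v\<in>(\<Union>i\<in>F. T \<inter> b i). (\<lambda>x. u v * v x)) = (\<Sum>i\<in>F. \<Sum>v\<in>T \<inter> b i. (\<lambda>x. u v * v x))"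
      using disj T(2) by (intro sum.UNION_disjoint finF) (auto simp: F_def)
    then have "(\<Sum>i\<in>F. \<Sum>v\<in>T \<inter> b i. (\<lambda>x. u v * v x)) = 0"
      using T(3) TU by simp
    moreover have "(\<Sum>v\<in>T \<inter> b i. (\<lambda>x. u v * v x)) \<in> D' i" for i
      using b(1) by (intro cfun.subspace_sum cfun.subspace_scale sD') blast
    ultimately have z: "\<forall>i\<in>F. (\<Sum>v\<in>T \<inter> b i. (\<lambda>x. u v * v x)) = 0"
      using finF by (intro indep) (auto simp: F_def)
    show "\<forall>v\<in>T. u v = 0"
    proof
      fix v assume "v \<in> T"
      then obtain i where i: "i \<in> F" "v \<in> T \<inter> b i" using TU by blast
      then show "u v = 0"
        using b(2)[of i, unfolded cfun.independent_explicit_finite_subsets, rule_format, of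
            "T \<inter> b i" u v]
          z T(2) by auto
    qed
  qed
  note indb = this
  have bE: "(\<Union>i\<in>I. b i) \<subseteq> E'" using b(1) D'E by blast
  obtain B' where B': "B' \<subseteq> E'" "cfun.independent B'" "E' \<subseteq> cfun.span B'" "card B' = cfun.dim E'"
    using cfun.basis_exists by blast
  have "finite B'"
    using cfun.independent_span_bound[OF B(1) B'(2)] B(2) B'(1) by blast
  from cfun.independent_span_bound[OF this indb order_trans[OF bE B'(3)]]
  have bU: "finite (\<Union>i\<in>I. b i)" "card (\<Union>i\<in>I. b i) \<le> cfun.dim E'"
    unfolding B'(4) by blast+
  \<comment> \<open>The indices with a nonzero target eigenspace. One basis vector from each embeds
    \<open>J\<close> in a finite set, so \<open>J\<close> is finite; by \<open>le\<close> the source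
    eigenspaces off \<open>J\<close> vanish, which is what \<open>full\<close> asks for.\<close>
  define J where "J = {i \<in> I. b i \<noteq> {}}"
  define v where "v i = (SOME f. f \<in> b i)" for i
  have v: "v i \<in> b i" if "i \<in> J" for i
    unfolding v_def using that by (intro someI_ex[of "\<lambda>f. f \<in> b i"]) (auto simp: J_def)
  have "inj_on v J"
  proof (rule inj_onI, rule ccontr)
    fix i j assume "i \<in> J" "j \<in> J" "v i = v j" "i \<noteq> j"
    then show False using disj[of i j] v[of i] v[of j] by (auto simp: J_def)
  qed
  moreover have "v ` J \<subseteq> (\<Union>i\<in>I. b i)" using v by (auto simp: J_def)
  ultimately have finJ: "finite J" using bU(1) finite_imageD finite_subset by blast
  have leD: "mdim (D i) \<le> enat (card (b i))" if "i \<in> I" for i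
    using le[OF that] b(3)[of i] b(4)[of i] finb[of i] unfolding D_def[symmetric] D'_def[symmetric]
    by (auto simp: mdim_def split: if_splits)
  have "\<forall>i. \<exists>a. i \<in> I \<longrightarrow> finite a \<and> D i \<subseteq> cfun.span a \<and> card a \<le> card (b i)"
  proof
    fix i
    show "\<exists>a. i \<in> I \<longrightarrow> finite a \<and> D i \<subseteq> cfun.span a \<and> card a \<le> card (b i)"
    proof (cases "i \<in> I")
      case True
      obtain a where a: "a \<subseteq> D i" "cfun.independent a" "D i \<subseteq> cfun.span a" "card a = cfun.dim (D i)"
        using cfun.basis_exists by blast
      obtain A where A: "finite A" "D i \<subseteq> cfun.span A"
        using leD[OF True] by (auto simp: mdim_def split: if_splits)
      then have "finite a" using cfun.independent_span_bound[OF A(1) a(2)] a(1) by blast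
      then show ?thesis using a leD[OF True] A by (auto simp: mdim_def split: if_splits)
    qed simp
  qed
  from choice[OF this] obtain a where a: "\<And>i. i \<in> I \<Longrightarrow> finite (a i)"
    "\<And>i. i \<in> I \<Longrightarrow> D i \<subseteq> cfun.span (a i)" "\<And>i. i \<in> I \<Longrightarrow> card (a i) \<le> card (b i)" by blast
  have JI: "J \<subseteq> I" by (auto simp: J_def)
  have "E \<subseteq> cfun.span (\<Union>i\<in>J. joint_eigenspace Q E (\<theta> i))"
  proof (rule full[OF finJ JI])
    fix i assume "i \<in> I - J"
    then have "b i = {}" "i \<in> I" by (auto simp: J_def)
    then have "card (a i) = 0" using a(3)[of i] by simp
    then have "a i = {}" using a(1) \<open>i \<in> I\<close> by auto
    then show "joint_eigenspace Q E (\<theta> i) \<subseteq> {0}"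
      using a(2)[OF \<open>i \<in> I\<close>] by (simp add: D_def)
  qed
  also have "\<dots> \<subseteq> cfun.span (\<Union>i\<in>J. a i)"
  proof (rule cfun.span_minimal[OF _ cfun.subspace_span], rule UN_least)
    fix i assume "i \<in> J"
    then show "joint_eigenspace Q E (\<theta> i) \<subseteq> cfun.span (\<Union>i\<in>J. a i)"
      using a(2)[of i] JI cfun.span_mono[of "a i" "\<Union>i\<in>J. a i"] unfolding D_def by blast
  qed
  finally have E: "E \<subseteq> cfun.span (\<Union>i\<in>J. a i)" .
  have fina: "finite (\<Union>i\<in>J. a i)" using finJ a(1) JI by blast
  have "cfun.dim E \<le> card (\<Union>i\<in>J. a i)" by (rule cfun.dim_le_card[OF E fina])
  also have "\<dots> \<le> (\<Sum>i\<in>J. card (a i))" by (rule card_UN_le[OF finJ])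
  also have "\<dots> \<le> (\<Sum>i\<in>J. card (b i))" using a(3) JI by (intro sum_mono) auto
  also have "\<dots> = card (\<Union>i\<in>J. b i)"
    using disj JI finb finJ by (intro card_UN_disjoint[symmetric]) blast+
  also have "\<dots> \<le> card (\<Union>i\<in>I. b i)" using JI bU(1) by (intro card_mono) auto
  also have "\<dots> \<le> cfun.dim E'" by (rule bU(2))
  finally show ?thesis using E fina True by (auto simp: mdim_def)
qed

section \<open>Smooth functions and directional derivatives\<close>

definition dir_deriv :: "'a::real_normed_vector \<Rightarrow> ('a \<Rightarrow> 'b::real_normed_vector) \<Rightarrow> 'a \<Rightarrow> 'b" where
  "dir_deriv v f = (\<lambda>x. frechet_derivative f (at x) v)"

text \<open>The recursion of \<open>Ck\<close>, freed from \<open>real ^ 'n\<close>: functions on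
  \<open>(real ^ 3) \<times> (real ^ 3)\<close> and on the real line need the same notion.\<close>

fun Ck_fun :: "nat \<Rightarrow> ('a::real_normed_vector \<Rightarrow> 'b::real_normed_vector) \<Rightarrow> bool" where
  "Ck_fun 0 f \<longleftrightarrow> continuous_on UNIV f"
| "Ck_fun (Suc k) f \<longleftrightarrow> (\<forall>x. f differentiable (at x)) \<and> (\<forall>v. Ck_fun k (dir_deriv v f))"

definition smooth_fun :: "('a::real_normed_vector \<Rightarrow> 'b::real_normed_vector) \<Rightarrow> bool" where
  "smooth_fun f \<longleftrightarrow> (\<forall>k. Ck_fun k f)"

lemma smooth_iff_smooth_fun: "smooth f \<longleftrightarrow> smooth_fun f"
proof -
  have "Ck k f = Ck_fun k f" for k
    by (induction k arbitrary: f) (simp_all add: dir_deriv_def)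
  then show ?thesis by (simp add: smooth_def smooth_fun_def)
qed

lemma pderiv_at_eq_dir_deriv: "pderiv_at i f = dir_deriv (axis i 1) f"
  by (simp add: fun_eq_iff pderiv_at_def dir_deriv_def)

lemma dir_deriv_eqI: "(f has_derivative D) (at x) \<Longrightarrow> dir_deriv v f x = D v"
  unfolding dir_deriv_def by (simp flip: frechet_derivative_at)

lemma has_derivative_dir_deriv:
    "f differentiable (at x) \<Longrightarrow> (f has_derivative (\<lambda>v. dir_deriv v f x)) (at x)"
  unfolding dir_deriv_def using frechet_derivative_works by blast

lemma Ck_fun_Suc_imp: "Ck_fun (Suc k) f \<Longrightarrow> Ck_fun k f"
proof (induction k arbitrary: f)
  case 0
  then show ?case
    by (auto simp: continuous_on_eq_continuous_at intro!: differentiable_imp_continuous_within)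
next
  case (Suc k)
  then show ?case by (metis Ck_fun.simps(2))
qed

lemma smooth_fun_differentiable: "smooth_fun f \<Longrightarrow> f differentiable (at x)"
  unfolding smooth_fun_def by (metis Ck_fun.simps(2))

lemma smooth_fun_has_derivative: "smooth_fun f \<Longrightarrow> (f has_derivative (\<lambda>v. dir_deriv v f x)) (at x)"
  by (intro has_derivative_dir_deriv smooth_fun_differentiable)

lemma smooth_fun_dir_deriv: "smooth_fun f \<Longrightarrow> smooth_fun (dir_deriv v f)"
  unfolding smooth_fun_def by (metis Ck_fun.simps(2))

lemma smooth_fun_continuous: "smooth_fun f \<Longrightarrow> continuous_on S f"
  unfolding smooth_fun_def by (metis Ck_fun.simps(1) continuous_on_subset subset_UNIV)

lemma smooth_fun_continuous_compose:
  "smooth_fun f \<Longrightarrow> continuous_on S g \<Longrightarrow> continuous_on S (\<lambda>x. f (g x))"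
  by (rule continuous_on_compose2[OF smooth_fun_continuous]) auto

text \<open>Every derivative that \<open>Ck_fun\<close> asks for stays in the class
  \<open>P\<close>, and continuity at stage \<open>0\<close> comes from differentiability. Made for
  classes such as the Fourier projections, whose derivatives have the same shape.\<close>

lemma smooth_fun_coinduct:
  assumes "P f" and step: "\<And>f. P f \<Longrightarrow> (\<forall>x. f differentiable (at x)) \<and> (\<forall>v. P (dir_deriv v f))"
  shows "smooth_fun f"
proof -
  have "Ck_fun k f" if "P f" for k f
    using that
  proof (induction k arbitrary: f)
    case 0
    then show ?case using step Ck_fun_Suc_imp[of 0 f]
      by (auto simp: continuous_on_eq_continuous_at intro!: differentiable_imp_continuous_within)
  next
    case (Suc k)
    then show ?case using step by simp
  qed
  then show ?thesis using assms(1) by (simp add: smooth_fun_def)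
qed

lemma dir_deriv_add_vec:
  assumes "f differentiable (at x)"
  shows "dir_deriv (u + v) f x = dir_deriv u f x + dir_deriv v f x"
  by (rule linear_add[OF has_derivative_linear[OF has_derivative_dir_deriv[OF assms]]])

lemma dir_deriv_scale_vec:
  assumes "f differentiable (at x)"
  shows "dir_deriv (c *\<^sub>R v) f x = c *\<^sub>R dir_deriv v f x"
  by (rule linear_cmul[OF has_derivative_linear[OF has_derivative_dir_deriv[OF assms]]])

lemma dir_deriv_const: "dir_deriv v (\<lambda>x. c) = (\<lambda>x. 0)"
  by (rule ext, rule dir_deriv_eqI) simp

lemma smooth_fun_const: "smooth_fun (\<lambda>x. c)"
  by (rule smooth_fun_coinduct[where P = "\<lambda>f. \<exists>c. f = (\<lambda>x. c)"]) (use dir_deriv_const in auto)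

lemma dir_deriv_add:
  assumes "f differentiable (at x)" "g differentiable (at x)"
  shows "dir_deriv v (\<lambda>x. f x + g x) x = dir_deriv v f x + dir_deriv v g x"
  by (rule dir_deriv_eqI) (intro has_derivative_add has_derivative_dir_deriv assms)

lemma Ck_fun_add: "Ck_fun k f \<Longrightarrow> Ck_fun k g \<Longrightarrow> Ck_fun k (\<lambda>x. f x + g x)"
proof (induction k arbitrary: f g)
  case (Suc k)
  then have "dir_deriv v (\<lambda>x. f x + g x) = (\<lambda>x. dir_deriv v f x + dir_deriv v g x)" for v
    by (intro ext dir_deriv_add) auto
  then show ?case using Suc by auto
qed (auto intro: continuous_intros)

lemma dir_deriv_bilinear:
  assumes "bounded_bilinear p" "f differentiable (at x)" "g differentiable (at x)"
  shows "dir_deriv v (\<lambda>x. p (f x) (g x)) x = p (f x) (dir_deriv v g x) + p (dir_deriv v f x) (g x)"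
  by (rule dir_deriv_eqI) (intro bounded_bilinear.FDERIV has_derivative_dir_deriv assms)

lemma differentiable_bilinear:
  assumes "bounded_bilinear p" "f differentiable (at x)" "g differentiable (at x)"
  shows "(\<lambda>x. p (f x) (g x)) differentiable (at x)"
  using bounded_bilinear.FDERIV[OF assms(1) has_derivative_dir_deriv[OF assms(2)]
      has_derivative_dir_deriv[OF assms(3)]]
  unfolding differentiable_def by blast

lemma Ck_fun_bilinear:
  assumes p: "bounded_bilinear p"
  shows "Ck_fun k f \<Longrightarrow> Ck_fun k g \<Longrightarrow> Ck_fun k (\<lambda>x. p (f x) (g x))"
proof (induction k arbitrary: f g)
  case 0
  then show ?case by (auto intro: bounded_bilinear.continuous_on[OF p])
next
  case (Suc k)
  then have "dir_deriv v (\<lambda>x. p (f x) (g x))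
      = (\<lambda>x. p (f x) (dir_deriv v g x) + p (dir_deriv v f x) (g x))" for v
    by (intro ext dir_deriv_bilinear[OF p]) auto
  then show ?case
    using Suc Ck_fun_Suc_imp[OF Suc.prems(1)] Ck_fun_Suc_imp[OF Suc.prems(2)]
    by (auto intro!: Ck_fun_add differentiable_bilinear[OF p])
qed

lemma dir_deriv_linear:
  assumes "bounded_linear L" "f differentiable (at x)"
  shows "dir_deriv v (\<lambda>x. L (f x)) x = L (dir_deriv v f x)"
  by (rule dir_deriv_eqI) (intro bounded_linear.has_derivative[OF assms(1)] has_derivative_dir_deriv
      assms)

lemma Ck_fun_linear:
  assumes L: "bounded_linear L"
  shows "Ck_fun k f \<Longrightarrow> Ck_fun k (\<lambda>x. L (f x))"
proof (induction k arbitrary: f)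
  case 0
  then show ?case by (auto intro: bounded_linear.continuous_on[OF L])
next
  case (Suc k)
  then have "dir_deriv v (\<lambda>x. L (f x)) = (\<lambda>x. L (dir_deriv v f x))" for v
    by (intro ext dir_deriv_linear[OF L]) auto
  moreover have "(\<lambda>x. L (f x)) differentiable (at x)" for x
    by (rule differentiableI, rule bounded_linear.has_derivative[OF L has_derivative_dir_deriv])
        (use Suc.prems in simp)
  ultimately show ?case using Suc by auto
qed

lemma has_derivative_affine_compose:
  assumes A: "bounded_linear A" "f differentiable (at (A x + c))"
  shows "((\<lambda>x. f (A x + c)) has_derivative (\<lambda>v. dir_deriv (A v) f (A x + c))) (at x)"
proof -
  have "((\<lambda>x. A x + c) has_derivative A) (at x)"
    using bounded_linear_imp_has_derivative[OF A(1)] by (auto intro!: derivative_eq_intros)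
  from diff_chain_at[OF this has_derivative_dir_deriv[OF A(2)]] show ?thesis by (simp add: o_def)
qed

lemma dir_deriv_affine:
  assumes A: "bounded_linear A" "f differentiable (at (A x + c))"
  shows "dir_deriv v (\<lambda>x. f (A x + c)) x = dir_deriv (A v) f (A x + c)"
  by (rule dir_deriv_eqI[OF has_derivative_affine_compose[OF assms]])

lemma Ck_fun_affine:
  assumes A: "bounded_linear A"
  shows "Ck_fun k f \<Longrightarrow> Ck_fun k (\<lambda>x. f (A x + c))"
proof (induction k arbitrary: f)
  case 0
  have "continuous_on UNIV (\<lambda>x. A x + c)"
    by (intro continuous_on_add continuous_on_const linear_continuous_on A)
  then show ?case using 0 continuous_on_compose2[of UNIV f UNIV "\<lambda>x. A x + c"] by simp
next
  case (Suc k)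
  then have "dir_deriv v (\<lambda>x. f (A x + c)) = (\<lambda>x. dir_deriv (A v) f (A x + c))" for v
    by (intro ext dir_deriv_affine[OF A]) auto
  moreover have "(\<lambda>x. f (A x + c)) differentiable (at x)" for x
    by (rule differentiableI, rule has_derivative_affine_compose[OF A]) (use Suc.prems in simp)
  ultimately show ?case using Suc by auto
qed

lemma smooth_fun_add: "smooth_fun f \<Longrightarrow> smooth_fun g \<Longrightarrow> smooth_fun (\<lambda>x. f x + g x)"
  by (simp add: smooth_fun_def Ck_fun_add)

lemma smooth_fun_bilinear:
    "bounded_bilinear p \<Longrightarrow> smooth_fun f \<Longrightarrow> smooth_fun g \<Longrightarrow> smooth_fun (\<lambda>x. p (f x) (g x))"
  by (simp add: smooth_fun_def Ck_fun_bilinear)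

lemma smooth_fun_linear: "bounded_linear L \<Longrightarrow> smooth_fun f \<Longrightarrow> smooth_fun (\<lambda>x. L (f x))"
  by (simp add: smooth_fun_def Ck_fun_linear)

lemma smooth_fun_affine: "bounded_linear A \<Longrightarrow> smooth_fun f \<Longrightarrow> smooth_fun (\<lambda>x. f (A x + c))"
  by (simp add: smooth_fun_def Ck_fun_affine)

lemma smooth_fun_mult: "smooth_fun f \<Longrightarrow> smooth_fun g \<Longrightarrow> smooth_fun (\<lambda>x. f x * g x :: complex)"
  by (rule smooth_fun_bilinear[OF bounded_bilinear_mult])

lemma dir_deriv_mult:
  assumes "smooth_fun f" "smooth_fun g"
  shows "dir_deriv v (\<lambda>x. f x * g x :: complex) x = f x * dir_deriv v g x + dir_deriv v f x * g x"
  by (intro dir_deriv_bilinear bounded_bilinear_mult smooth_fun_differentiable assms)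

lemma dir_deriv_cmult:
  assumes "smooth_fun f"
  shows "dir_deriv v (\<lambda>x. c * f x :: complex) x = c * dir_deriv v f x"
  by (intro dir_deriv_linear bounded_linear_mult_right smooth_fun_differentiable assms)

lemma smooth_fun_cnj: "smooth_fun f \<Longrightarrow> smooth_fun (\<lambda>x. cnj (f x))"
  by (rule smooth_fun_linear[OF bounded_linear_cnj])

lemma dir_deriv_cnj: "smooth_fun f \<Longrightarrow> dir_deriv v (\<lambda>x. cnj (f x)) x = cnj (dir_deriv v f x)"
  by (intro dir_deriv_linear bounded_linear_cnj smooth_fun_differentiable)

lemma smooth_fun_sum: "(\<And>i. i \<in> S \<Longrightarrow> smooth_fun (f i)) \<Longrightarrow> smooth_fun (\<lambda>x. \<Sum>i\<in>S. f i x)"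
  by (induction S rule: infinite_finite_induct) (auto intro!: smooth_fun_add smooth_fun_const)

lemma dir_deriv_sum:
  assumes "\<And>i. i \<in> S \<Longrightarrow> smooth_fun (f i)"
  shows "dir_deriv v (\<lambda>x. \<Sum>i\<in>S. f i x) x = (\<Sum>i\<in>S. dir_deriv v (f i) x)"
  using assms
proof (induction S rule: infinite_finite_induct)
  case (insert a S)
  then show ?case
    by (simp, subst dir_deriv_add) (auto intro!: smooth_fun_differentiable smooth_fun_sum)
qed (simp_all add: dir_deriv_const)

lemma smooth_fun_bounded_linear:
  assumes "bounded_linear L"
  shows "smooth_fun L" "dir_deriv v L = (\<lambda>x. L v)"
proof -
  show *: "dir_deriv v L = (\<lambda>x. L v)" for v
    by (rule ext, rule dir_deriv_eqI) (rule bounded_linear_imp_has_derivative[OF assms])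
  have "Ck_fun k L" for k
  proof (cases k)
    case 0
    then show ?thesis using assms by (simp add: linear_continuous_on)
  next
    case (Suc m)
    then show ?thesis
      using smooth_fun_const assms
          by (auto simp: * smooth_fun_def intro: bounded_linear_imp_differentiable)
  qed
  then show "smooth_fun L" by (simp add: smooth_fun_def)
qed

lemma smooth_fun_of_real: "bounded_linear l \<Longrightarrow> smooth_fun (\<lambda>x. complex_of_real (l x))"
  using smooth_fun_linear[OF bounded_linear_of_real smooth_fun_bounded_linear(1)] by blast

lemma
  assumes l: "bounded_linear l"
  shows smooth_fun_cis: "smooth_fun (\<lambda>x. cis (l x))"
    and dir_deriv_cis: "dir_deriv v (\<lambda>x. cis (l x)) x = (\<i> * of_real (l v)) * cis (l x)"
proof -
  have der: "((\<lambda>x. cis (l x)) has_derivative (\<lambda>v. (\<i> * of_real (l v)) * cis (l x))) (at x)" for x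
  proof -
    have "((\<lambda>x. exp (\<i> * of_real (l x))) has_derivative
        (\<lambda>v. (\<i> * of_real (l v)) * exp (\<i> * of_real (l x)))) (at x)"
    proof -
      have "((\<lambda>x. \<i> * complex_of_real (l x)) has_derivative (\<lambda>v. \<i> * of_real (l v))) (at x)"
        by (intro bounded_linear_imp_has_derivative bounded_linear_compose[OF bounded_linear_mult_right]
            bounded_linear_compose[OF bounded_linear_of_real l])
      from has_derivative_compose[OF this DERIV_exp[unfolded has_field_derivative_def]]
      show ?thesis by (simp add: mult.commute)
    qed
    then show ?thesis by (simp add: cis_conv_exp)
  qed
  show dir_deriv: "dir_deriv v (\<lambda>x. cis (l x)) x = (\<i> * of_real (l v)) * cis (l x)" for v x
    by (rule dir_deriv_eqI[OF der])
  have "Ck_fun k (\<lambda>x. cis (l x))" for k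
  proof (induction k)
    case 0
    show ?case using der by (auto simp: continuous_on_eq_continuous_at intro!:
        has_derivative_continuous)
  next
    case (Suc k)
    have "dir_deriv v (\<lambda>x. cis (l x)) = (\<lambda>x. (\<i> * of_real (l v)) * cis (l x))" for v
      by (rule ext, rule dir_deriv)
    then show ?case
      using Suc der by (auto simp: differentiable_def intro!:
          Ck_fun_linear[OF bounded_linear_mult_right])
  qed
  then show "smooth_fun (\<lambda>x. cis (l x))" by (simp add: smooth_fun_def)
qed

section \<open>Fourier modes along a line\<close>

lemma leibniz_smooth_fun:
  fixes f :: "'a::euclidean_space \<Rightarrow> complex"
  assumes f: "smooth_fun f" and g: "continuous_on {a..b} g"
  shows "((\<lambda>x. integral {a..b} (\<lambda>t. g t * f (x + t *\<^sub>R w))) has_derivative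
          (\<lambda>v. integral {a..b} (\<lambda>t. g t * dir_deriv v f (x + t *\<^sub>R w)))) (at x)"
proof -
  \<comment> \<open>Differentiation under the integral takes the derivative as a continuous family
    of bounded linear maps, hence the packaging as \<open>blinfun\<close>; its continuity is checked
    componentwise.\<close>
  define K where "K x t = Blinfun (\<lambda>v. g t * dir_deriv v f (x + t *\<^sub>R w))" for x t
  have bl: "bounded_linear (\<lambda>v. g t * dir_deriv v f (x + t *\<^sub>R w))" for x t
    using has_derivative_bounded_linear[OF smooth_fun_has_derivative[OF f, of "x + t *\<^sub>R w"]]
    by (rule bounded_linear_compose[OF bounded_linear_mult_right])
  have K: "blinfun_apply (K x t) v = g t * dir_deriv v f (x + t *\<^sub>R w)" for x t v
    unfolding K_def by (simp add: bounded_linear_Blinfun_apply[OF bl])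
  have gc: "continuous_on (UNIV \<times> {a..b}) (\<lambda>p. g (snd p))"
    by (rule continuous_on_compose2[OF g]) (auto intro: continuous_intros)
  have contK: "continuous_on (UNIV \<times> {a..b}) (\<lambda>(x, t). K x t)"
    unfolding case_prod_beta
    by (rule continuous_on_blinfun_componentwise) (auto simp: K intro!: continuous_intros gc
        smooth_fun_continuous_compose[OF smooth_fun_dir_deriv[OF f]])
  have "((\<lambda>x. integral (cbox a b) (\<lambda>t. g t * f (x + t *\<^sub>R w))) has_derivative integral (cbox a b)
      (K x)) (at x within UNIV)"
  proof (rule leibniz_rule)
    show "((\<lambda>x. g t * f (x + t *\<^sub>R w)) has_derivative blinfun_apply (K x t)) (at x within UNIV)" for x t
      using has_derivative_mult_right[OF has_derivative_affine_compose[OF bounded_linear_ident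
          smooth_fun_differentiable[OF f]], of "g t" "t *\<^sub>R w" x]
      by (simp add: K[abs_def])
    show "(\<lambda>t. g t * f (x + t *\<^sub>R w)) integrable_on cbox a b" for x
      using g by (simp, intro integrable_continuous_real continuous_intros
          smooth_fun_continuous_compose[OF f])
  qed (use contK in auto)
  moreover have "blinfun_apply (integral (cbox a b) (K x))
      = (\<lambda>v. integral (cbox a b) (\<lambda>t. g t * dir_deriv v f (x + t *\<^sub>R w)))"
  proof
    fix v
    have "continuous_on (cbox a b) (\<lambda>t. (\<lambda>(x, t). K x t) (x, t))"
      by (rule continuous_on_compose2[OF contK]) (auto intro: continuous_intros)
    then have "K x integrable_on cbox a b"
      by (intro integrable_continuous) simp
    from blinfun_apply_integral[OF this, of v]
    show "blinfun_apply (integral (cbox a b) (K x)) v = integral (cbox a b)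
        (\<lambda>t. g t * dir_deriv v f (x + t *\<^sub>R w))"
      by (simp add: K)
  qed
  ultimately show ?thesis by simp
qed

text \<open>The increment of \<open>f\<close> along \<open>v\<close> is the integral of
  \<open>dir_deriv v f\<close>. Differentiating it under the integral sign in direction
  \<open>u\<close> gives an integral formula for \<open>dir_deriv u f\<close> along the line; its
  one-sided derivative at \<open>0\<close> is compared with the direct one.\<close>

lemma dir_deriv_commute:
  fixes f :: "'a::euclidean_space \<Rightarrow> complex"
  assumes f: "smooth_fun f"
  shows "dir_deriv u (dir_deriv v f) = dir_deriv v (dir_deriv u f)"
proof
  fix x
  have ftc: "integral {0..t} (\<lambda>r. dir_deriv v f (y + r *\<^sub>R v)) = f (y + t *\<^sub>R v) - f y" if "0 \<le> t"
      for t y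
  proof -
    have "((\<lambda>r. dir_deriv v f (y + r *\<^sub>R v)) has_integral (f (y + t *\<^sub>R v) - f (y + 0 *\<^sub>R v))) {0..t}"
    proof (rule fundamental_theorem_of_calculus[OF that])
      fix r
      have "((\<lambda>r. y + r *\<^sub>R v) has_derivative (\<lambda>r. r *\<^sub>R v)) (at r)"
        by (auto intro!: derivative_eq_intros)
      from diff_chain_at[OF this smooth_fun_has_derivative[OF f]]
      have "((\<lambda>r. f (y + r *\<^sub>R v)) has_vector_derivative dir_deriv v f (y + r *\<^sub>R v)) (at r)"
        by (simp add: has_vector_derivative_def o_def dir_deriv_scale_vec
            smooth_fun_differentiable[OF f])
      then show "((\<lambda>r. f (y + r *\<^sub>R v)) has_vector_derivative dir_deriv v f (y + r *\<^sub>R v))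
          (at r within {0..t})"
        by (rule has_vector_derivative_at_within)
    qed
    then show ?thesis by (simp add: integral_unique)
  qed
  have *: "dir_deriv u f (x + t *\<^sub>R v) = dir_deriv u f x
      + integral {0..t} (\<lambda>r. dir_deriv u (dir_deriv v f) (x + r *\<^sub>R v))" if "0 \<le> t" for t
  proof -
    have "((\<lambda>y. integral {0..t} (\<lambda>r. 1 * dir_deriv v f (y + r *\<^sub>R v))) has_derivative
          (\<lambda>u. integral {0..t} (\<lambda>r. 1 * dir_deriv u (dir_deriv v f) (x + r *\<^sub>R v)))) (at x)"
      by (rule leibniz_smooth_fun[OF smooth_fun_dir_deriv[OF f]]) auto
    from this[unfolded mult_1] have 1: "((\<lambda>y. f (y + t *\<^sub>R v) - f y) has_derivative
          (\<lambda>u. integral {0..t} (\<lambda>r. dir_deriv u (dir_deriv v f) (x + r *\<^sub>R v)))) (at x)"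
      by (simp only: ftc[OF that])
    have 2: "((\<lambda>y. f (y + t *\<^sub>R v) - f y) has_derivative (\<lambda>u. dir_deriv u f (x + t *\<^sub>R v)
        - dir_deriv u f x)) (at x)"
      by (intro has_derivative_diff smooth_fun_has_derivative f
          has_derivative_affine_compose[OF bounded_linear_ident smooth_fun_differentiable[OF f]])
    show ?thesis
      using fun_cong[OF has_derivative_unique[OF 1 2], of u] by (simp add: algebra_simps)
  qed
  have cont: "continuous_on {0..1} (\<lambda>r. dir_deriv u (dir_deriv v f) (x + r *\<^sub>R v))"
    by (intro continuous_intros
        smooth_fun_continuous_compose[OF smooth_fun_dir_deriv[OF smooth_fun_dir_deriv[OF f]]])
  have "((\<lambda>t. dir_deriv u f x + integral {0..t} (\<lambda>r. dir_deriv u (dir_deriv v f) (x + r *\<^sub>R v)))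
      has_vector_derivative
      0 + dir_deriv u (dir_deriv v f) (x + 0 *\<^sub>R v)) (at 0 within {0..1})"
    by (intro has_vector_derivative_add has_vector_derivative_const
        integral_has_vector_derivative[OF cont]) simp
  then have "((\<lambda>t. dir_deriv u f x
      + integral {0..t} (\<lambda>r. dir_deriv u (dir_deriv v f) (x + r *\<^sub>R v))) has_vector_derivative
      dir_deriv u (dir_deriv v f) x) (at 0 within {0..1})" by simp
  then have 1: "((\<lambda>t. dir_deriv u f (x + t *\<^sub>R v)) has_vector_derivative dir_deriv u (dir_deriv v f)
      x) (at 0 within {0..1})"
    by (rule has_vector_derivative_transform[rotated 2]) (use * in auto)
  have "((\<lambda>r. x + r *\<^sub>R v) has_derivative (\<lambda>r. r *\<^sub>R v)) (at 0)"
    by (auto intro!: derivative_eq_intros)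
  from diff_chain_at[OF this smooth_fun_has_derivative[OF smooth_fun_dir_deriv[OF f]], of u]
  have "((\<lambda>r. dir_deriv u f (x + r *\<^sub>R v)) has_vector_derivative dir_deriv v (dir_deriv u f) x) (at 0)"
    by (simp add: has_vector_derivative_def o_def dir_deriv_scale_vec
        smooth_fun_differentiable[OF smooth_fun_dir_deriv[OF f]])
  then have 2: "((\<lambda>r. dir_deriv u f (x + r *\<^sub>R v)) has_vector_derivative dir_deriv v (dir_deriv u f)
      x) (at 0 within {0..1})"
    by (rule has_vector_derivative_at_within)
  show "dir_deriv u (dir_deriv v f) x = dir_deriv v (dir_deriv u f) x"
    using vector_derivative_unique_within_closed_interval[of 0 1 0] 1 2 by auto
qed

text \<open>The \<open>n\<close>-th Fourier coefficient of \<open>f\<close> along the line through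
  \<open>x\<close>, kept as a function of \<open>x\<close>. If \<open>f\<close> has period
  \<open>w\<close>, this is the projection to the functions on which translation by
  \<open>t *\<^sub>R w\<close> acts as \<open>cis (2 * pi * n * t)\<close>.\<close>

definition fourier_proj :: "'a::euclidean_space \<Rightarrow> int \<Rightarrow> ('a \<Rightarrow> complex) \<Rightarrow> 'a \<Rightarrow> complex" where
  "fourier_proj w n f x = integral {0..1} (\<lambda>t. cis (- (2 * pi * of_int n * t)) * f (x + t *\<^sub>R w))"

lemma continuous_cis_mode: "continuous_on S (\<lambda>t. cis (- (2 * pi * of_int n * t)))"
  by (intro continuous_intros)

lemma fourier_proj_has_derivative:
  assumes "smooth_fun f"
  shows "(fourier_proj w n f has_derivative (\<lambda>v. fourier_proj w n (dir_deriv v f) x)) (at x)"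
  unfolding fourier_proj_def[abs_def] by (rule leibniz_smooth_fun[OF assms continuous_cis_mode])

lemma dir_deriv_fourier_proj:
    "smooth_fun f \<Longrightarrow> dir_deriv v (fourier_proj w n f) = fourier_proj w n (dir_deriv v f)"
  by (rule ext, rule dir_deriv_eqI) (rule fourier_proj_has_derivative)

lemma smooth_fun_fourier_proj: "smooth_fun f \<Longrightarrow> smooth_fun (fourier_proj w n f)"
proof (rule smooth_fun_coinduct[where P = "\<lambda>h. \<exists>f. smooth_fun f \<and> h = fourier_proj w n f"])
  fix h assume "\<exists>f. smooth_fun f \<and> h = fourier_proj w n f"
  then obtain f where f: "smooth_fun f" "h = fourier_proj w n f" by blast
  show "(\<forall>x. h differentiable at x) \<and> (\<forall>v. \<exists>f. smooth_fun f \<and> dir_deriv v h = fourier_proj w n f)"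
    using f dir_deriv_fourier_proj fourier_proj_has_derivative smooth_fun_dir_deriv
        unfolding differentiable_def by blast
qed auto

lemma fourier_proj_integrable:
  fixes f :: "'a::euclidean_space \<Rightarrow> complex"
  assumes "continuous_on UNIV f"
  shows "(\<lambda>t. cis (- (2 * pi * of_int n * t)) * f (x + t *\<^sub>R w)) integrable_on {a..b::real}"
  by (intro integrable_continuous_real continuous_intros continuous_on_compose2[OF assms])
      (auto intro!: continuous_intros)

lemma fourier_proj_add:
  assumes "continuous_on UNIV f" "continuous_on UNIV g"
  shows "fourier_proj w n (\<lambda>x. f x + g x) x = fourier_proj w n f x + fourier_proj w n g x"
  unfolding fourier_proj_def distrib_left
  by (intro integral_add fourier_proj_integrable assms)

lemma fourier_proj_sum:
  assumes "finite F" "\<And>i. i \<in> F \<Longrightarrow> continuous_on UNIV (f i)"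
  shows "fourier_proj w n (\<lambda>x. \<Sum>i\<in>F. f i x) x = (\<Sum>i\<in>F. fourier_proj w n (f i) x)"
  unfolding fourier_proj_def sum_distrib_left
  by (intro integral_sum fourier_proj_integrable assms)

lemma fourier_proj_cmult: "fourier_proj w n (\<lambda>x. c * f x) x = c * fourier_proj w n f x"
  unfolding fourier_proj_def by (simp add: mult.left_commute[of _ c])

lemma fourier_proj_translate:
  "(\<And>t. f (y + t *\<^sub>R w) = c * f (x + t *\<^sub>R w)) \<Longrightarrow> fourier_proj w n f y = c * fourier_proj w n f x"
  unfolding fourier_proj_def by (simp add: mult.left_commute[of _ c])

lemma periodic_int_shift:
  fixes g :: "real \<Rightarrow> 'a"
  assumes per: "\<And>t. g (t + 1) = g t"
  shows "g (t + of_int n) = g t"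
proof (induction n rule: int_induct[where k = 0])
  case (step1 i)
  then show ?case using per[of "t + of_int i"] by (simp add: add.assoc)
next
  case (step2 i)
  then show ?case using per[of "t + of_int (i - 1)"] by (simp add: algebra_simps)
qed simp

lemma integral_periodic_shift:
  fixes g :: "real \<Rightarrow> complex"
  assumes cont: "continuous_on UNIV g" and per: "\<And>t. g (t + 1) = g t"
  shows "integral {0..1} (\<lambda>t. g (t + a)) = integral {0..1} g"
proof -
  have int: "g integrable_on {c..d}" for c d
    by (intro integrable_continuous_real continuous_on_subset[OF cont]) auto
  \<comment> \<open>Periodicity absorbs the integer part of \<open>a\<close>; the piece of the
    shifted interval beyond \<open>1\<close> is then moved back by one period.\<close>
  define r where "r = frac a"
  have r: "0 \<le> r" "r \<le> 1" by (auto simp: r_def frac_lt_1 less_imp_le)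
  have "integral {0..1} (\<lambda>t. g (t + a)) = integral {0..1} (g \<circ> (+) r)"
  proof (rule integral_cong)
    fix t
    have "t + a = (r + t) + of_int \<lfloor>a\<rfloor>" by (simp add: r_def frac_def)
    then show "g (t + a) = (g \<circ> (+) r) t"
      by (simp only: periodic_int_shift[of g, OF per] o_def)
  qed
  also have "\<dots> = integral {r..1 + r} g"
    using integral_shift_Icc_real[of 0 1 g r] by (simp add: add.commute)
  also have "\<dots> = integral {r..1} g + integral {1..1 + r} g"
    by (rule Henstock_Kurzweil_Integration.integral_combine[symmetric]) (use r int in auto)
  also have "integral {1..1 + r} g = integral {0..r} (g \<circ> (+) 1)"
    using integral_shift_Icc_real[of 0 r g 1] by (simp add: add.commute)
  also have "g \<circ> (+) 1 = g" using per by (auto simp: fun_eq_iff add.commute)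
  also have "integral {r..1} g + integral {0..r} g = integral {0..1} g"
    using r Henstock_Kurzweil_Integration.integral_combine[of 0 r 1 g] int by (simp add: add.commute)
  finally show ?thesis .
qed

lemma integral_cis_mode:
  "integral {0..1} (\<lambda>t. cis (2 * pi * of_int n * t)) = (if n = 0 then 1 else 0)"
proof (cases "n = 0")
  case False
  define a where "a = 2 * pi * of_int n"
  have a: "a \<noteq> 0" using False by (simp add: a_def)
  have "((\<lambda>t. cis (a * t)) has_integral (cis (a * 1) / (\<i> * a) - cis (a * 0) / (\<i> * a))) {0..1}"
  proof (rule fundamental_theorem_of_calculus)
    fix t
    have "((\<lambda>t. exp (\<i> * a * of_real t) / (\<i> * a)) has_vector_derivative exp (\<i> * a * of_real t))
        (at t within {0..1})"
      using a by (auto intro!: derivative_eq_intros has_vector_derivative_real_field)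
    then show "((\<lambda>t. cis (a * t) / (\<i> * a)) has_vector_derivative cis (a * t)) (at t within {0..1})"
      by (simp add: cis_conv_exp mult.assoc)
  qed simp
  moreover have "cis a = 1"
    using cis_multiple_2pi[of "of_int n"] by (simp add: a_def mult_ac)
  ultimately show ?thesis using False by (simp add: a_def integral_unique)
qed simp

lemma fourier_proj_mode:
  assumes "\<And>t. f (x + t *\<^sub>R w) = cis (2 * pi * of_int m * t) * f x"
  shows "fourier_proj w n f x = (if n = m then f x else 0)"
proof -
  have "cis (- (2 * pi * of_int n * t)) * (cis (2 * pi * of_int m * t) * f x)
      = f x * cis (2 * pi * of_int (m - n) * t)" for t
    unfolding mult.assoc[symmetric] cis_mult by (simp add: algebra_simps)
  then have "fourier_proj w n f x = integral {0..1} (\<lambda>t. f x * cis (2 * pi * of_int (m - n) * t))"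
    unfolding fourier_proj_def assms by (simp only:)
  then show ?thesis using integral_cis_mode[of "m - n"] by auto
qed

lemma fourier_proj_is_mode:
  assumes cont: "continuous_on UNIV f" and per: "\<And>x. f (x + w) = f x"
  shows "fourier_proj w n f (x + s *\<^sub>R w) = cis (2 * pi * of_int n * s) * fourier_proj w n f x"
proof -
  define g where "g t = cis (- (2 * pi * of_int n * t)) * f (x + t *\<^sub>R w)" for t
  have cg: "continuous_on UNIV g"
    unfolding g_def by (intro continuous_intros continuous_on_compose2[OF cont])
        (auto intro!: continuous_intros)
  have pg: "g (t + 1) = g t" for t
  proof -
    have "x + (t + 1) *\<^sub>R w = (x + t *\<^sub>R w) + w" by (simp add: algebra_simps)
    then have "f (x + (t + 1) *\<^sub>R w) = f (x + t *\<^sub>R w)" by (simp only: per)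
    moreover have "cis (- (2 * pi * of_int n * (t + 1))) = cis (- (2 * pi * of_int n * t))"
    proof -
      have "- (2 * pi * of_int n * (t + 1)) = - (2 * pi * of_int n * t) + 2 * pi * of_int (- n)"
        by (simp add: algebra_simps)
      then show ?thesis using cis_multiple_2pi[of "of_int (- n)"]
          by (simp only: cis_mult[symmetric]) simp
    qed
    ultimately show ?thesis by (simp add: g_def)
  qed
  have "cis (- (2 * pi * of_int n * t)) * f (x + s *\<^sub>R w + t *\<^sub>R w) = cis (2 * pi * of_int n * s) *
      g (t + s)" for t
  proof -
    have "cis (2 * pi * of_int n * s) * cis (- (2 * pi * of_int n * (t + s)))
        = cis (- (2 * pi * of_int n * t))"
      unfolding cis_mult by (simp add: algebra_simps)
    moreover have "x + s *\<^sub>R w + t *\<^sub>R w = x + (t + s) *\<^sub>R w" by (simp add: algebra_simps)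
    ultimately show ?thesis by (simp only: g_def mult.assoc[symmetric])
  qed
  then have "fourier_proj w n f (x + s *\<^sub>R w)
      = integral {0..1} (\<lambda>t. cis (2 * pi * of_int n * s) * g (t + s))"
    unfolding fourier_proj_def by (simp only:)
  also have "\<dots> = cis (2 * pi * of_int n * s) * integral {0..1} g"
    using integral_periodic_shift[OF cg pg, of s] by simp
  finally show ?thesis by (simp add: fourier_proj_def g_def[abs_def])
qed

section \<open>Uniqueness of Fourier coefficients, by Stone-Weierstrass on the circle\<close>

definition trig_polys :: "(real \<Rightarrow> complex) set" where
  "trig_polys = cfun.span (range (\<lambda>(n::int) t. cis (2 * pi * of_int n * t)))"

lemma trig_polys_add: "q \<in> trig_polys \<Longrightarrow> r \<in> trig_polys \<Longrightarrow> (\<lambda>t. q t + r t) \<in> trig_polys"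
  unfolding trig_polys_def using cfun.span_add[of q _ r] by (simp add: plus_fun_def)

lemma trig_polys_scale: "q \<in> trig_polys \<Longrightarrow> (\<lambda>t. c * q t) \<in> trig_polys"
  unfolding trig_polys_def by (rule cfun.span_scale)

lemma trig_polys_base: "(\<lambda>t. cis (2 * pi * of_int n * t)) \<in> trig_polys"
  unfolding trig_polys_def by (rule cfun.span_base) auto

lemma trig_polys_induct:
  assumes "q \<in> trig_polys" and zero: "P (\<lambda>t. 0)"
    and add: "\<And>f g. P f \<Longrightarrow> P g \<Longrightarrow> P (\<lambda>t. f t + g t)" and scale: "\<And>c f. P f \<Longrightarrow> P (\<lambda>t. c * f t)"
    and base: "\<And>n. P (\<lambda>t. cis (2 * pi * of_int n * t))"
  shows "P q"
  using assms(1) unfolding trig_polys_def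
proof (rule cfun.span_induct)
  show "cfun.subspace (Collect P)"
    by (rule cfun.subspaceI) (use zero add scale in \<open>simp_all add: zero_fun_def plus_fun_def\<close>)
qed (use base in auto)

lemma trig_polys_mult:
  assumes "q \<in> trig_polys" "r \<in> trig_polys"
  shows "(\<lambda>t. q t * r t) \<in> trig_polys"
proof -
  have base: "(\<lambda>t. q t * cis (2 * pi * of_int n * t)) \<in> trig_polys" for n :: int
    using assms(1)
  proof (rule trig_polys_induct)
    fix m :: int
    have "cis (2 * pi * of_int m * t) * cis (2 * pi * of_int n * t)
        = cis (2 * pi * of_int (m + n) * t)" for t
      by (simp add: cis_mult algebra_simps)
    then show "(\<lambda>t. cis (2 * pi * of_int m * t) * cis (2 * pi * of_int n * t)) \<in> trig_polys"
      using trig_polys_base[of "m + n"] by presburger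
  qed (use trig_polys_add trig_polys_scale trig_polys_scale[OF trig_polys_base, of 0]
       in \<open>auto simp: distrib_right mult.assoc\<close>)
  show ?thesis
    using assms(2)
  proof (rule trig_polys_induct)
    show "(\<lambda>t. q t * (c * f t)) \<in> trig_polys" if "(\<lambda>t. q t * f t) \<in> trig_polys" for c f
      using trig_polys_scale[OF that, of c] by (simp add: mult.left_commute)
  qed (use trig_polys_add base trig_polys_scale[OF trig_polys_base, of 0] in \<open>auto simp: distrib_left\<close>)
qed

lemma trig_polys_const: "(\<lambda>t. c) \<in> trig_polys"
  using trig_polys_scale[OF trig_polys_base[of 0], of c] by simp

text \<open>A real-linear form on the complex plane is a combination of \<open>z\<close> and its
  conjugate, hence on the circle of the modes \<open>1\<close> and \<open>- 1\<close>. Polynomials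
  follow because trigonometric polynomials form an algebra.\<close>

lemma trig_polys_real_polynomial:
  assumes "real_polynomial_function (p :: complex \<Rightarrow> real)"
  shows "(\<lambda>t. of_real (p (cis (2 * pi * t)))) \<in> trig_polys"
  using assms
proof (induction p rule: real_polynomial_function.induct)
  case (linear l)
  have "of_real (l (cis (2 * pi * t))) =
      (of_real (l 1) - \<i> * of_real (l \<i>)) / 2 * cis (2 * pi * of_int 1 * t) +
      (of_real (l 1) + \<i> * of_real (l \<i>)) / 2 * cis (2 * pi * of_int (- 1) * t)" for t
  proof -
    have "l (cis (2 * pi * t)) = l (cos (2 * pi * t) *\<^sub>R 1 + sin (2 * pi * t) *\<^sub>R \<i>)"
      by (rule arg_cong[where f = l]) (simp add: complex_eq_iff)
    also have "\<dots> = cos (2 * pi * t) * l 1 + sin (2 * pi * t) * l \<i>"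
      using bounded_linear.linear[OF linear] by (simp add: linear_add linear_cmul)
    finally show ?thesis
      by (simp add: complex_eq_iff field_simps)
  qed
  then show ?case
    using trig_polys_add[OF trig_polys_scale[OF trig_polys_base] trig_polys_scale[OF trig_polys_base]]
    by presburger
qed (use trig_polys_add trig_polys_mult trig_polys_const in auto)

lemma trig_polys_continuous: "q \<in> trig_polys \<Longrightarrow> continuous_on S q"
  by (erule trig_polys_induct) (auto intro!: continuous_intros)

lemma continuous_periodic_factors_through_circle:
  fixes g :: "real \<Rightarrow> complex"
  assumes cont: "continuous_on UNIV g" and per: "\<And>t. g (t + 1) = g t"
  obtains h where "continuous_on (sphere 0 1) h" "\<And>t. h (cis (2 * pi * t)) = g t"
proof
  define h where "h z = g (SOME t. z = cis (2 * pi * t))" for z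
  show h: "h (cis (2 * pi * t)) = g t" for t
  proof -
    define s where "s = (SOME s. cis (2 * pi * t) = cis (2 * pi * s))"
    have "cis (2 * pi * t) = cis (2 * pi * s)"
      unfolding s_def by (rule someI[of _ t]) simp
    then obtain n :: int where
        "\<i> * of_real (2 * pi * s) = \<i> * of_real (2 * pi * t) + (of_int (2 * n) * pi) * \<i>"
      unfolding cis_conv_exp using exp_eq by metis
    then have "2 * pi * s = 2 * pi * t + of_int (2 * n) * pi"
      by (simp add: complex_eq_iff)
    then have "2 * pi * s = 2 * pi * (t + of_int n)" by (simp add: algebra_simps)
    then have "s = t + of_int n" by simp
    then show ?thesis
      using periodic_int_shift[of g, OF per] unfolding h_def s_def[symmetric] by simp
  qed
  show "continuous_on (sphere 0 1) h"
  proof (subst continuous_on_closed_vimage)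
    show "\<forall>B. closed B \<longrightarrow> closed (h -` B \<inter> sphere 0 1)"
    proof (intro allI impI)
      fix B :: "complex set" assume B: "closed B"
      \<comment> \<open>\<open>Arg2pi\<close> gives every point of the circle a parameter in
        \<open>{0..1}\<close>, so the preimage of a closed set under \<open>h\<close> is the
        continuous image of a compact set.\<close>
      have "h -` B \<inter> sphere 0 1 = (\<lambda>t. cis (2 * pi * t)) ` ({0..1} \<inter> g -` B)"
      proof (intro equalityI subsetI)
        fix z assume z: "z \<in> h -` B \<inter> sphere 0 1"
        then have "z = cis (Arg2pi z)" using Arg2pi[of z] by (simp add: cis_conv_exp is_Arg_def)
        then have e: "z = cis (2 * pi * (Arg2pi z / (2 * pi)))" by simp
        then have "g (Arg2pi z / (2 * pi)) \<in> B" using h z by (metis IntD1 vimageD)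
        moreover have "Arg2pi z / (2 * pi) \<in> {0..1}"
          using Arg2pi_ge_0[of z] Arg2pi_lt_2pi[of z] by (auto simp: field_simps)
        ultimately show "z \<in> (\<lambda>t. cis (2 * pi * t)) ` ({0..1} \<inter> g -` B)" using e by blast
      qed (auto simp: h)
      moreover have "compact ({0..1} \<inter> g -` B)"
        using B cont by (intro compact_Int_closed)
            (auto simp: closed_vimage continuous_on_eq_continuous_at)
      then have "compact ((\<lambda>t. cis (2 * pi * t)) ` ({0..1} \<inter> g -` B))"
        by (intro compact_continuous_image continuous_intros)
      ultimately show "closed (h -` B \<inter> sphere 0 1)" by (simp add: compact_imp_closed)
    qed
  qed auto
qed

text \<open>Vanishing coefficients make \<open>g\<close> orthogonal to all trigonometric
  polynomials. These approximate the conjugate of \<open>g\<close> uniformly, so the integral of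
  \<open>|g|^2\<close> is \<open>0\<close>, and continuity gives \<open>g = 0\<close>.\<close>

lemma fourier_uniqueness:
  fixes g :: "real \<Rightarrow> complex"
  assumes cont: "continuous_on UNIV g" and per: "\<And>t. g (t + 1) = g t"
    and zero: "\<And>n::int. integral {0..1} (\<lambda>t. cis (- (2 * pi * of_int n * t)) * g t) = 0"
  shows "g t = 0"
proof -
  have gc: "continuous_on S g" for S using cont continuous_on_subset by blast
  have orth: "integral {0..1} (\<lambda>t. q t * g t) = 0" if "q \<in> trig_polys" for q
  proof -
    have "continuous_on UNIV q \<and> integral {0..1} (\<lambda>t. q t * g t) = 0"
      using that
    proof (rule trig_polys_induct)
      fix n :: int
      show "continuous_on UNIV (\<lambda>t. cis (2 * pi * of_int n * t))
          \<and> integral {0..1} (\<lambda>t. cis (2 * pi * of_int n * t) * g t) = 0"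
        using zero[of "- n"] by (auto intro!: continuous_intros)
    next
      fix q r :: "real \<Rightarrow> complex"
      assume q: "continuous_on UNIV q \<and> integral {0..1} (\<lambda>t. q t * g t) = 0"
        and r: "continuous_on UNIV r \<and> integral {0..1} (\<lambda>t. r t * g t) = 0"
      have "(\<lambda>t. q t * g t) integrable_on {0..1}" "(\<lambda>t. r t * g t) integrable_on {0..1}"
        using q r continuous_on_subset[of UNIV _ "{0..1}"]
            by (auto intro!: integrable_continuous_real continuous_intros gc)
      then show "continuous_on UNIV (\<lambda>t. q t + r t) \<and> integral {0..1} (\<lambda>t. (q t + r t) * g t) = 0"
        using q r by (auto simp: distrib_right integral_add intro!: continuous_intros)
    qed (auto simp: mult.assoc intro!: continuous_intros)
    then show ?thesis by blast
  qed
  obtain h where h: "continuous_on (sphere 0 1) h" "\<And>t. h (cis (2 * pi * t)) = g t"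
    using continuous_periodic_factors_through_circle[OF cont per] by blast
  obtain M where "\<forall>z\<in>g ` {0..1}. norm z \<le> M" and M0: "M > 0"
    using compact_imp_bounded[OF compact_continuous_image[OF gc compact_Icc[of 0 1]]]
    unfolding bounded_pos by blast
  then have M: "norm (g t) \<le> M" if "t \<in> {0..1}" for t using that by blast
  have small: "norm (integral {0..1} (\<lambda>t. cnj (g t) * g t)) \<le> e" if "e > 0" for e
  proof -
    \<comment> \<open>Each of the two polynomials below is within \<open>d\<close>, so the error is
      at most \<open>2 * d\<close> and the integral changes by at most
      \<open>2 * d * M = e\<close>.\<close>
    define d where "d = e / (2 * M)"
    have d: "d > 0" using that M0 by (simp add: d_def)
    obtain p1 where p1: "real_polynomial_function p1" "\<And>z. z \<in> sphere 0 1 \<Longrightarrow> \<bar>Re (h z) - p1 z\<bar> < d"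
      by (rule Stone_Weierstrass_real_polynomial_function[of "sphere (0::complex) 1" "\<lambda>z. Re (h z)" d])
        (use d h(1) in \<open>auto intro!: continuous_intros\<close>)
    obtain p2 where p2: "real_polynomial_function p2" "\<And>z. z \<in> sphere 0 1 \<Longrightarrow> \<bar>Im (h z) - p2 z\<bar> < d"
      by (rule Stone_Weierstrass_real_polynomial_function[of "sphere (0::complex) 1" "\<lambda>z. Im (h z)" d])
        (use d h(1) in \<open>auto intro!: continuous_intros\<close>)
    \<comment> \<open>The sign in front of the second polynomial makes \<open>q\<close> approximate
      \<open>cnj (g t)\<close>.\<close>
    define q where "q t = of_real (p1 (cis (2 * pi * t))) + (- \<i>) * of_real (p2 (cis (2 * pi * t)))"
        for t
    have q: "q \<in> trig_polys"
      unfolding q_def by (intro trig_polys_add trig_polys_scale trig_polys_real_polynomial p1 p2)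
    have close: "norm (cnj (g t) - q t) \<le> 2 * d" for t
    proof -
      have "norm (cnj (g t) - q t) \<le> \<bar>Re (cnj (g t) - q t)\<bar> + \<bar>Im (cnj (g t) - q t)\<bar>"
        by (rule cmod_le)
      also have "\<dots> \<le> d + d"
        using p1(2)[of "cis (2 * pi * t)"] p2(2)[of "cis (2 * pi * t)"]
        by (intro add_mono) (auto simp: q_def h(2) abs_minus_commute)
      finally show ?thesis by simp
    qed
    have int: "(\<lambda>t. q t * g t) integrable_on {0..1}" "(\<lambda>t. cnj (g t) * g t) integrable_on {0..1}"
      by (intro integrable_continuous_real continuous_intros gc trig_polys_continuous[OF q])+
    have "integral {0..1} (\<lambda>t. cnj (g t) * g t) = integral {0..1} (\<lambda>t. cnj (g t) * g t - q t * g t)"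
      using orth[OF q] int by (simp add: integral_diff)
    also have "norm \<dots> \<le> (2 * d * M) * (1 - 0)"
    proof (rule integral_bound)
      show "norm (cnj (g t) * g t - q t * g t) \<le> 2 * d * M" if "t \<in> {0..1}" for t
        using mult_mono[OF close[of t] M[OF that]] d by (simp add: norm_mult flip: left_diff_distrib)
    qed (auto intro!: continuous_intros gc trig_polys_continuous[OF q])
    finally show ?thesis using M0 by (simp add: d_def)
  qed
  have "integral {0..1} (\<lambda>t. cnj (g t) * g t) = 0"
    using small field_le_epsilon[of "norm (integral {0..1} (\<lambda>t. cnj (g t) * g t))" 0] by simp
  moreover have "cnj (g t) * g t = of_real ((norm (g t))\<^sup>2)" for t
    unfolding complex_norm_square by (rule mult.commute)
  ultimately have "integral {0..1} (complex_of_real \<circ> (\<lambda>t. (norm (g t))\<^sup>2)) = 0"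
    by (simp only: o_def)
  moreover have "(\<lambda>t. (norm (g t))\<^sup>2) integrable_on {0..1}"
    by (intro integrable_continuous_real continuous_intros gc)
  ultimately have "complex_of_real (integral {0..1} (\<lambda>t. (norm (g t))\<^sup>2)) = 0"
    by (simp only: integral_linear[OF _ bounded_linear_of_real])
  moreover have "continuous_on {0..1} (\<lambda>t. (norm (g t))\<^sup>2)"
    by (intro continuous_intros gc)
  ultimately have "\<forall>t\<in>{0..1}. (norm (g t))\<^sup>2 = 0"
    using integral_eq_0_iff[of 0 1 "\<lambda>t. (norm (g t))\<^sup>2"] by simp
  then have "g t = 0" if "t \<in> {0..1}" for t using that by simp
  from this[of "frac t"] have "g (frac t) = 0" by (simp add: frac_lt_1 less_imp_le)
  then show ?thesis
    using periodic_int_shift[of g "frac t" "\<lfloor>t\<rfloor>", OF per] by (simp only: frac_def diff_add_cancel)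
qed

lemma fourier_proj_zero_imp_zero:
  assumes cont: "continuous_on UNIV f" and per: "\<And>x. f (x + w) = f x"
    and zero: "\<And>n. fourier_proj w n f x = 0"
  shows "f x = 0"
proof -
  have "f (x + 0 *\<^sub>R w) = 0"
  proof (rule fourier_uniqueness[of "\<lambda>t. f (x + t *\<^sub>R w)"])
    show "continuous_on UNIV (\<lambda>t. f (x + t *\<^sub>R w))"
      by (intro continuous_on_compose2[OF cont] continuous_intros) auto
    show "f (x + (t + 1) *\<^sub>R w) = f (x + t *\<^sub>R w)" for t
      using per[of "x + t *\<^sub>R w"] by (simp add: algebra_simps)
  qed (use zero in \<open>simp add: fourier_proj_def\<close>)
  then show ?thesis by simp
qed

section \<open>Magnetic covariant derivatives\<close>

text \<open>Fourier modes along \<open>w\<close> are the joint eigenspaces of the translations by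
  multiples of \<open>w\<close>. When only finitely many are nonzero, \<open>f\<close> minus the sum
  of its projections has all Fourier coefficients equal to \<open>0\<close>, so it vanishes.\<close>

lemma mdim_le_fourier:
  fixes E :: "('a::euclidean_space \<Rightarrow> complex) set" and E' :: "('b::euclidean_space \<Rightarrow> complex) set"
  assumes sub: "cfun.subspace E" and sub': "cfun.subspace E'"
    and cont: "\<And>f. f \<in> E \<Longrightarrow> continuous_on UNIV f" and per: "\<And>f x. f \<in> E \<Longrightarrow> f (x + w) = f x"
    and proj: "\<And>f n. f \<in> E \<Longrightarrow> fourier_proj w n f \<in> E"
    and le: "\<And>n::int. mdim {f \<in> E. \<forall>x t. f (x + t *\<^sub>R w) = cis (2 * pi * of_int n * t) * f x}
      \<le> mdim {f \<in> E'. \<forall>x t. f (x + t *\<^sub>R w') = cis (2 * pi * of_int n * t) * f x}"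
  shows "mdim E \<le> mdim E'"
proof -
  define Q' where "Q' t f = (\<lambda>x. f (x + t *\<^sub>R w'))" for t :: real and f :: "'b \<Rightarrow> complex"
  define Q where "Q t f = (\<lambda>x. f (x + t *\<^sub>R w))" for t :: real and f :: "'a \<Rightarrow> complex"
  define \<theta> where "\<theta> n t = cis (2 * pi * of_int n * t)" for n :: int and t :: real
  have eig: "joint_eigenspace Q E (\<theta> n)
      = {f \<in> E. \<forall>x t. f (x + t *\<^sub>R w) = cis (2 * pi * of_int n * t) * f x}"
    "joint_eigenspace Q' E' (\<theta> n) = {f \<in> E'. \<forall>x t. f (x + t *\<^sub>R w') = cis (2 * pi * of_int n * t) *
        f x}" for n
    by (auto simp: joint_eigenspace_def Q_def Q'_def \<theta>_def fun_eq_iff)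
  show ?thesis
  proof (rule mdim_le_decomposition[where Q = Q and Q' = Q' and I = UNIV and \<theta> = \<theta>])
    show "linear_on E' (Q' t)" for t
      by (simp add: linear_on_def Q'_def plus_fun_def)
    show "\<exists>t. \<theta> i t \<noteq> \<theta> j t" if "i \<noteq> j" for i j
    proof
      \<comment> \<open>For this \<open>t\<close> the two characters differ by the factor
        \<open>cis pi = - 1\<close>.\<close>
      define t where "t = 1 / (2 * of_int (i - j) :: real)"
      have "2 * pi * of_int i * t = 2 * pi * of_int j * t + pi"
        using that by (simp add: t_def field_simps)
      then have "\<theta> i t = - \<theta> j t" by (simp add: \<theta>_def flip: cis_mult)
      moreover have "\<theta> j t \<noteq> 0" by (simp add: \<theta>_def)
      ultimately show "\<theta> i t \<noteq> \<theta> j t" by (auto simp: eq_neg_iff_add_eq_0 simp flip: mult_2)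
    qed
    show "mdim (joint_eigenspace Q E (\<theta> i)) \<le> mdim (joint_eigenspace Q' E' (\<theta> i))" for i
      unfolding eig by (rule le)
    fix F :: "int set" assume F: "finite F"
        and off: "\<And>i. i \<in> UNIV - F \<Longrightarrow> joint_eigenspace Q E (\<theta> i) \<subseteq> {0}"
    show "E \<subseteq> cfun.span (\<Union>i\<in>F. joint_eigenspace Q E (\<theta> i))"
    proof
      fix f assume f: "f \<in> E"
      have mode: "fourier_proj w n f \<in> joint_eigenspace Q E (\<theta> n)" for n
        unfolding eig using proj[OF f] fourier_proj_is_mode[OF cont[OF f] per[OF f]] by blast
      define g where "g = (\<lambda>x. f x + (\<Sum>n\<in>F. - 1 * fourier_proj w n f x))"
      have cp: "continuous_on UNIV (fourier_proj w n f)" for n by (rule cont[OF proj[OF f]])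
      have "g x = 0" for x
      proof (rule fourier_proj_zero_imp_zero[where w = w])
        show "continuous_on UNIV g"
          unfolding g_def by (intro continuous_intros cont f cp)
        show "g (x + w) = g x" for x
          using per[OF f] per[OF proj[OF f]] by (simp add: g_def)
        fix n
        have "fourier_proj w n g x = fourier_proj w n f x
            + (\<Sum>m\<in>F. - 1 * fourier_proj w n (fourier_proj w m f) x)"
          unfolding g_def
          by (subst fourier_proj_add, intro cont f, intro continuous_intros cp,
              subst fourier_proj_sum, rule F, intro continuous_intros cp, simp only: fourier_proj_cmult)
        also have "(\<Sum>m\<in>F. - 1 * fourier_proj w n (fourier_proj w m f) x) =
            (\<Sum>m\<in>F. if n = m then - fourier_proj w n f x else 0)"
          using mode unfolding eig by (intro sum.cong refl, subst fourier_proj_mode) auto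
        also have "\<dots> = (if n \<in> F then - fourier_proj w n f x else 0)"
          using F by simp
        finally show "fourier_proj w n g x = 0"
          using mode[of n] off[of n] by (auto split: if_splits)
      qed
      then have "f = (\<Sum>n\<in>F. fourier_proj w n f)"
        by (auto simp: g_def fun_eq_iff sum_fun_apply sum_negf)
      also have "\<dots> \<in> cfun.span (\<Union>i\<in>F. joint_eigenspace Q E (\<theta> i))"
        using mode by (intro cfun.span_sum cfun.span_base) blast
      finally show "f \<in> cfun.span (\<Union>i\<in>F. joint_eigenspace Q E (\<theta> i))" .
    qed
  qed (use sub' in auto)
qed

text \<open>
  Covariant derivative and translation for the connection form \<open>\<i> \<omega>(x, u)\<close>, of curvature
  \<open>2 \<i> \<omega>\<close>. On functions with a fixed central character these are the actions of the left-invariant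
  fields and of the left translations.
\<close>

definition cov_deriv :: "('a \<Rightarrow> 'a \<Rightarrow> real) \<Rightarrow> 'a \<Rightarrow> ('a::euclidean_space \<Rightarrow> complex) \<Rightarrow> 'a \<Rightarrow> complex" where
  "cov_deriv \<omega> u f = (\<lambda>x. dir_deriv u f x + \<i> * of_real (\<omega> x u) * f x)"

definition mag_transl :: "('a \<Rightarrow> 'a \<Rightarrow> real) \<Rightarrow> 'a \<Rightarrow> ('a::euclidean_space \<Rightarrow> complex) \<Rightarrow> 'a \<Rightarrow> complex" where
  "mag_transl \<omega> m f = (\<lambda>x. cis (\<omega> m x) * f (x + m))"

definition mag_lap :: "('a \<Rightarrow> 'a \<Rightarrow> real) \<Rightarrow> ('a::euclidean_space \<Rightarrow> complex) \<Rightarrow> 'a \<Rightarrow> complex" where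
  "mag_lap \<omega> f = (\<lambda>x. - (\<Sum>b\<in>Basis. cov_deriv \<omega> b (cov_deriv \<omega> b f) x))"

text \<open>A constant magnetic field: the potential at \<open>x\<close> is the linear form
  \<open>\<omega> x\<close>. The form may be degenerate, and in dimension three it always
  is.\<close>

locale magnetic =
  fixes \<omega> :: "'a::euclidean_space \<Rightarrow> 'a \<Rightarrow> real"
  assumes bil: "bilinear \<omega>" and skew: "\<omega> x y = - \<omega> y x"
begin

lemmas form_simps = bilinear_ladd[OF bil] bilinear_radd[OF bil] bilinear_lmul[OF bil]
    bilinear_rmul[OF bil]
  bilinear_lneg[OF bil] bilinear_rneg[OF bil] bilinear_lzero[OF bil] bilinear_rzero[OF bil]

lemma bounded_linear_form: "bounded_linear (\<omega> u)" "bounded_linear (\<lambda>x. \<omega> x u)"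
  using bil by (auto simp: bilinear_def linear_conv_bounded_linear)

lemma form_self [simp]: "\<omega> x x = 0"
  using skew[of x x] by simp

lemma smooth_fun_form: "smooth_fun (\<lambda>x. complex_of_real (\<omega> x u))"
  by (rule smooth_fun_of_real[OF bounded_linear_form(2)])

lemma dir_deriv_form: "dir_deriv v (\<lambda>x. complex_of_real (\<omega> x u)) x = of_real (\<omega> v u)"
  by (rule fun_cong[OF smooth_fun_bounded_linear(2)[OF
      bounded_linear_compose[OF bounded_linear_of_real bounded_linear_form(2)]]])

lemma smooth_fun_cov_deriv: "smooth_fun f \<Longrightarrow> smooth_fun (cov_deriv \<omega> u f)"
  unfolding cov_deriv_def by (intro smooth_fun_add smooth_fun_dir_deriv smooth_fun_mult
      smooth_fun_const smooth_fun_form)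

lemma smooth_fun_mag_transl: "smooth_fun f \<Longrightarrow> smooth_fun (mag_transl \<omega> m f)"
  unfolding mag_transl_def using smooth_fun_affine[OF bounded_linear_ident]
  by (intro smooth_fun_mult smooth_fun_cis bounded_linear_form)

lemma cov_deriv_add: "smooth_fun f \<Longrightarrow> smooth_fun g \<Longrightarrow> cov_deriv \<omega> u (\<lambda>x. f x + g x)
    = (\<lambda>x. cov_deriv \<omega> u f x + cov_deriv \<omega> u g x)"
  by (simp add: cov_deriv_def fun_eq_iff dir_deriv_add smooth_fun_differentiable distrib_left)

lemma cov_deriv_cmult: "smooth_fun f \<Longrightarrow> cov_deriv \<omega> u (\<lambda>x. c * f x) = (\<lambda>x. c * cov_deriv \<omega> u f x)"
  by (simp add: cov_deriv_def fun_eq_iff dir_deriv_cmult distrib_left mult.left_commute)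

lemma cov_deriv_sum: "(\<And>i. i \<in> S \<Longrightarrow> smooth_fun (f i)) \<Longrightarrow> cov_deriv \<omega> u (\<lambda>x. \<Sum>i\<in>S. f i x)
    = (\<lambda>x. \<Sum>i\<in>S. cov_deriv \<omega> u (f i) x)"
  by (simp add: cov_deriv_def fun_eq_iff dir_deriv_sum sum.distrib sum_distrib_left)

lemma cov_deriv_vec_add: "smooth_fun f \<Longrightarrow> cov_deriv \<omega> (u + v) f x = cov_deriv \<omega> u f x
    + cov_deriv \<omega> v f x"
  by (simp add: cov_deriv_def dir_deriv_add_vec smooth_fun_differentiable form_simps algebra_simps)

lemma cov_deriv_vec_scale: "smooth_fun f \<Longrightarrow> cov_deriv \<omega> (c *\<^sub>R v) f x = of_real c * cov_deriv \<omega> v f x"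
  by (simp add: cov_deriv_def dir_deriv_scale_vec smooth_fun_differentiable form_simps algebra_simps
      scaleR_conv_of_real)

lemma cov_deriv_vec_sum:
  assumes "smooth_fun f" "finite S"
  shows "cov_deriv \<omega> (\<Sum>i\<in>S. c i *\<^sub>R v i) f x = (\<Sum>i\<in>S. of_real (c i) * cov_deriv \<omega> (v i) f x)"
  using assms(2)
proof (induction S rule: finite_induct)
  case empty
  show ?case using cov_deriv_vec_scale[OF assms(1), of 0 0 x] by simp
qed (simp add: cov_deriv_vec_add cov_deriv_vec_scale assms(1))

lemma dir_deriv_mag_transl:
  assumes "smooth_fun f"
  shows "dir_deriv u (mag_transl \<omega> m f) x = mag_transl \<omega> m (dir_deriv u f) x + \<i> * of_real (\<omega> m u) *
      mag_transl \<omega> m f x"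
  unfolding mag_transl_def
  by (subst dir_deriv_mult[OF smooth_fun_cis[OF bounded_linear_form(1)]
      smooth_fun_affine[OF bounded_linear_ident assms]])
    (simp add: dir_deriv_cis[OF bounded_linear_form(1)] dir_deriv_affine[OF bounded_linear_ident
        smooth_fun_differentiable[OF assms]])

text \<open>Differentiating the phase \<open>\<omega> m x\<close> produces
  \<open>\<omega> m u\<close>, which is exactly the change of the potential between \<open>x\<close>
  and \<open>x + m\<close>. This reflects that left translations preserve left-invariant
  fields.\<close>

lemma cov_deriv_mag_transl:
    "smooth_fun f \<Longrightarrow> cov_deriv \<omega> u (mag_transl \<omega> m f) = mag_transl \<omega> m (cov_deriv \<omega> u f)"
  unfolding cov_deriv_def
  by (rule ext, subst dir_deriv_mag_transl) (simp_all add: mag_transl_def form_simps algebra_simps)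

lemma mag_transl_mag_transl:
    "mag_transl \<omega> m (mag_transl \<omega> l f) x = cis (\<omega> l m) * mag_transl \<omega> (m + l) f x"
  unfolding mag_transl_def mult.assoc[symmetric] cis_mult by (simp add: form_simps algebra_simps)

lemma mag_transl_cmult: "mag_transl \<omega> m (\<lambda>x. c * f x) = (\<lambda>x. c * mag_transl \<omega> m f x)"
  by (simp add: mag_transl_def mult.left_commute)

lemma mag_transl_add: "mag_transl \<omega> m (\<lambda>x. f x + g x) = (\<lambda>x. mag_transl \<omega> m f x + mag_transl \<omega> m g x)"
  by (simp add: mag_transl_def distrib_left)

lemma cov_deriv_comm:
  assumes f: "smooth_fun f"
  shows "cov_deriv \<omega> u (cov_deriv \<omega> v f) x = cov_deriv \<omega> v (cov_deriv \<omega> u f) x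
      + 2 * \<i> * of_real (\<omega> u v) * f x"
proof -
  have e: "dir_deriv u (cov_deriv \<omega> v f) x = dir_deriv u (dir_deriv v f) x
      + \<i> * (of_real (\<omega> x v) * dir_deriv u f x + of_real (\<omega> u v) * f x)" for u v
    unfolding cov_deriv_def mult.assoc
    by (subst dir_deriv_add; (intro smooth_fun_differentiable smooth_fun_dir_deriv smooth_fun_mult
        smooth_fun_const smooth_fun_form f)?)
      (simp add: dir_deriv_cmult smooth_fun_mult smooth_fun_form f dir_deriv_mult dir_deriv_form)
  show ?thesis
    unfolding cov_deriv_def[of \<omega> u "cov_deriv \<omega> v f"] cov_deriv_def[of \<omega> v "cov_deriv \<omega> u f"] e
    by (simp add: cov_deriv_def fun_cong[OF dir_deriv_commute[OF f, of u v]] skew[of v u] algebra_simps)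
qed

lemma mag_lap_add: "smooth_fun f \<Longrightarrow> smooth_fun g \<Longrightarrow> mag_lap \<omega> (\<lambda>x. f x + g x)
    = (\<lambda>x. mag_lap \<omega> f x + mag_lap \<omega> g x)"
  by (simp add: mag_lap_def cov_deriv_add smooth_fun_cov_deriv sum.distrib)

lemma mag_lap_cmult: "smooth_fun f \<Longrightarrow> mag_lap \<omega> (\<lambda>x. c * f x) = (\<lambda>x. c * mag_lap \<omega> f x)"
  by (simp add: mag_lap_def cov_deriv_cmult smooth_fun_cov_deriv sum_distrib_left)

lemma mag_lap_mag_transl: "smooth_fun f \<Longrightarrow> mag_lap \<omega> (mag_transl \<omega> m f) = mag_transl \<omega> m (mag_lap \<omega> f)"
  by (simp add: mag_lap_def cov_deriv_mag_transl smooth_fun_cov_deriv)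
      (simp add: mag_transl_def sum_distrib_left)

text \<open>Moving \<open>cov_deriv \<omega> u\<close> past the square of
  \<open>cov_deriv \<omega> b\<close> costs the curvature \<open>2 * \<i> * \<omega> b u\<close>
  twice. Summed over \<open>b\<close>, these terms assemble to the derivative along
  \<open>j\<close>, the vector that represents the form in its first argument.\<close>

lemma mag_lap_cov_deriv:
  assumes f: "smooth_fun f" and j: "\<And>x. \<omega> x u = x \<bullet> j"
  shows "mag_lap \<omega> (cov_deriv \<omega> u f) x = cov_deriv \<omega> u (mag_lap \<omega> f) x - 4 * \<i> * cov_deriv \<omega> j f x"
proof -
  have "cov_deriv \<omega> b (cov_deriv \<omega> b (cov_deriv \<omega> u f)) x
      = cov_deriv \<omega> u (cov_deriv \<omega> b (cov_deriv \<omega> b f)) x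
      + 4 * \<i> * (of_real (b \<bullet> j) * cov_deriv \<omega> b f x)" for b
  proof -
    have "cov_deriv \<omega> b (cov_deriv \<omega> u f) = (\<lambda>x. cov_deriv \<omega> u (cov_deriv \<omega> b f) x
        + (2 * \<i> * of_real (\<omega> b u)) * f x)"
      by (rule ext) (simp add: cov_deriv_comm[OF f, of b u])
    then have "cov_deriv \<omega> b (cov_deriv \<omega> b (cov_deriv \<omega> u f)) x
        = cov_deriv \<omega> b (cov_deriv \<omega> u (cov_deriv \<omega> b f)) x + (2 * \<i> * of_real (\<omega> b u)) * cov_deriv
        \<omega> b f x"
      by (simp only: cov_deriv_add cov_deriv_cmult smooth_fun_cov_deriv smooth_fun_mult
          smooth_fun_const f)
    then show ?thesis
      using cov_deriv_comm[OF smooth_fun_cov_deriv[OF f], of b u b x] by (simp add: j algebra_simps)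
  qed
  then have "mag_lap \<omega> (cov_deriv \<omega> u f) x =
      - (\<Sum>b\<in>Basis. cov_deriv \<omega> u (cov_deriv \<omega> b (cov_deriv \<omega> b f)) x)
          - 4 * \<i> * (\<Sum>b\<in>Basis. of_real (b \<bullet> j) * cov_deriv \<omega> b f x)"
    by (simp add: mag_lap_def sum.distrib sum_distrib_left)
  also have "(\<Sum>b\<in>Basis. of_real (b \<bullet> j) * cov_deriv \<omega> b f x) = cov_deriv \<omega> (\<Sum>b\<in>Basis. (b \<bullet> j) *\<^sub>R b)
      f x"
    by (rule cov_deriv_vec_sum[OF f, symmetric]) simp
  also have "(\<Sum>b\<in>Basis. (b \<bullet> j) *\<^sub>R b) = j"
    by (simp add: inner_commute[of _ j] euclidean_representation)
  also have "- (\<Sum>b\<in>Basis. cov_deriv \<omega> u (cov_deriv \<omega> b (cov_deriv \<omega> b f)) x)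
      = cov_deriv \<omega> u (mag_lap \<omega> f) x"
  proof -
    have "cov_deriv \<omega> u (\<lambda>x. (- 1) * (\<Sum>b\<in>Basis. cov_deriv \<omega> b (cov_deriv \<omega> b f) x)) x
      = (- 1) * (\<Sum>b\<in>Basis. cov_deriv \<omega> u (cov_deriv \<omega> b (cov_deriv \<omega> b f)) x)"
      by (simp only: cov_deriv_cmult cov_deriv_sum smooth_fun_sum smooth_fun_cov_deriv f)
    then show ?thesis by (simp add: mag_lap_def)
  qed
  finally show ?thesis .
qed

end

section \<open>Maximum principle and ladder operators\<close>

text \<open>Subtracting the integer parts of its coordinates moves any point into the unit cube
  without changing \<open>g\<close>, so the maximum over the compact cube is global.\<close>

lemma periodic_attains_max:
  fixes g :: "'a::euclidean_space \<Rightarrow> real"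
  assumes cont: "continuous_on UNIV g" and per: "\<And>b x. b \<in> Basis \<Longrightarrow> g (x + b) = g x"
  obtains x0 where "x0 \<in> cbox 0 One" "\<And>x. g x \<le> g x0"
proof -
  have int: "g (x + of_int n *\<^sub>R b) = g x" if "b \<in> Basis" for b x and n :: int
    using periodic_int_shift[of "\<lambda>t. g (x + t *\<^sub>R b)" 0 n] per[OF that]
    by (simp add: scaleR_add_left flip: add.assoc)
  have ints: "g (x + (\<Sum>b\<in>S. of_int (n b) *\<^sub>R b)) = g x" if "finite S" "S \<subseteq> Basis" for S x
      and n :: "'a \<Rightarrow> int"
    using that
  proof (induction S arbitrary: x rule: finite_induct)
    case (insert a S)
    have "g (x + (\<Sum>b\<in>insert a S. of_int (n b) *\<^sub>R b))
        = g ((x + of_int (n a) *\<^sub>R a) + (\<Sum>b\<in>S. of_int (n b) *\<^sub>R b))"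
      using insert.hyps by (simp add: add.assoc)
    then show ?case using insert int by simp
  qed simp
  obtain x0 where x0: "x0 \<in> cbox 0 One" "\<And>x. x \<in> cbox 0 One \<Longrightarrow> g x \<le> g x0"
    using continuous_attains_sup[OF compact_cbox[of 0 "One::'a"] _ continuous_on_subset[OF cont]]
    by (auto simp: box_ne_empty)
  have "g x \<le> g x0" for x
  proof -
    define y where "y = x + (\<Sum>b\<in>Basis. of_int (- \<lfloor>x \<bullet> b\<rfloor>) *\<^sub>R b)"
    have "y \<bullet> b = frac (x \<bullet> b)" if "b \<in> Basis" for b
      using that by (simp add: y_def inner_add_left inner_sum_left inner_Basis frac_def if_distrib
          cong: if_cong)
    then have "y \<in> cbox 0 One" by (auto simp: mem_box frac_lt_1 less_imp_le)
    moreover have "g y = g x" unfolding y_def by (rule ints) auto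
    ultimately show ?thesis using x0(2) by metis
  qed
  with x0(1) show ?thesis by (rule that)
qed

text \<open>A positive second derivative would make \<open>g'\<close> positive just to the right of
  the critical point \<open>0\<close>, so \<open>g\<close> would increase there.\<close>

lemma second_derivative_at_max:
  fixes g :: "real \<Rightarrow> real"
  assumes d1: "\<And>t. (g has_real_derivative g' t) (at t)" and d2: "(g' has_real_derivative D) (at 0)"
    and max: "\<And>t. g t \<le> g 0"
  shows "D \<le> 0"
proof (rule ccontr)
  assume "\<not> D \<le> 0"
  then have "D > 0" by simp
  have g'0: "g' 0 = 0"
    using DERIV_local_max[OF d1[of 0], of 1] max by auto
  obtain e where e: "e > 0" "\<And>h. 0 < h \<Longrightarrow> h < e \<Longrightarrow> g' 0 < g' (0 + h)"
    using DERIV_pos_inc_right[OF d2 \<open>D > 0\<close>] by auto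
  have "g 0 < g (e / 2)"
  proof (rule DERIV_pos_imp_increasing_open[where f = g and a = 0 and b = "e / 2"])
    show "0 < e / 2" using e by simp
    show "\<exists>y. (g has_real_derivative y) (at x) \<and> 0 < y" if "0 < x" "x < e / 2" for x
      using d1 e(2)[of x] that e(1) g'0 by auto
    show "continuous_on {0..e / 2} g"
      by (intro DERIV_continuous_on) (use d1 has_field_derivative_at_within in blast)
  qed
  then show False using max[of "e / 2"] by simp
qed

context magnetic
begin

lemma dir_deriv_hermitian:
  assumes "smooth_fun f" "smooth_fun g"
  shows "dir_deriv u (\<lambda>x. f x * cnj (g x)) x = cov_deriv \<omega> u f x * cnj (g x)
      + f x * cnj (cov_deriv \<omega> u g x)"
  using assms by (simp add: dir_deriv_mult smooth_fun_cnj dir_deriv_cnj cov_deriv_def algebra_simps)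

text \<open>Along the line in direction \<open>u\<close> the function \<open>|f|^2\<close> is
  maximal at \<open>x0\<close>, and its second derivative there is twice the left-hand side: the
  potential is imaginary, so it drops out of derivatives of hermitian products.\<close>

lemma cov_deriv_at_max:
  assumes f: "smooth_fun f" and max: "\<And>x. norm (f x) \<le> norm (f x0)"
  shows "Re (cov_deriv \<omega> u (cov_deriv \<omega> u f) x0 * cnj (f x0)) + (norm (cov_deriv \<omega> u f x0))\<^sup>2 \<le> 0"
proof -
  define F where "F = (\<lambda>x. f x * cnj (f x))"
  have smF: "smooth_fun F" unfolding F_def by (intro smooth_fun_mult smooth_fun_cnj f)
  have ddF: "dir_deriv u F = (\<lambda>x. cov_deriv \<omega> u f x * cnj (f x) + f x * cnj (cov_deriv \<omega> u f x))"
    unfolding F_def by (rule ext) (rule dir_deriv_hermitian[OF f f])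
  have "dir_deriv u (dir_deriv u F) x0 = dir_deriv u (\<lambda>x. cov_deriv \<omega> u f x * cnj (f x)) x0
      + dir_deriv u (\<lambda>x. f x * cnj (cov_deriv \<omega> u f x)) x0"
    unfolding ddF by (intro dir_deriv_add smooth_fun_differentiable smooth_fun_mult smooth_fun_cnj
        smooth_fun_cov_deriv f)
  also have "\<dots> = cov_deriv \<omega> u (cov_deriv \<omega> u f) x0 * cnj (f x0)
      + 2 * (cov_deriv \<omega> u f x0 * cnj (cov_deriv \<omega> u f x0))
      + f x0 * cnj (cov_deriv \<omega> u (cov_deriv \<omega> u f) x0)"
    by (simp add: dir_deriv_hermitian f smooth_fun_cov_deriv)
  finally have ddd: "Re (dir_deriv u (dir_deriv u F) x0)
      = 2 * (Re (cov_deriv \<omega> u (cov_deriv \<omega> u f) x0 * cnj (f x0)) + (norm (cov_deriv \<omega> u f x0))\<^sup>2)"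
    unfolding cmod_power2 by (simp add: power2_eq_square algebra_simps)
  have der: "((\<lambda>t. Re (h (x0 + t *\<^sub>R u))) has_real_derivative Re (dir_deriv u h (x0 + t *\<^sub>R u)))
      (at t)" if "smooth_fun h" for h t
  proof -
    have "((\<lambda>r. x0 + r *\<^sub>R u) has_derivative (\<lambda>r. r *\<^sub>R u)) (at t)"
      by (auto intro!: derivative_eq_intros)
    from diff_chain_at[OF this smooth_fun_has_derivative[OF that]]
    have "((\<lambda>r. h (x0 + r *\<^sub>R u)) has_derivative (\<lambda>r. r *\<^sub>R dir_deriv u h (x0 + t *\<^sub>R u))) (at t)"
      by (simp add: o_def dir_deriv_scale_vec smooth_fun_differentiable[OF that])
    from bounded_linear.has_derivative[OF bounded_linear_Re this]
    show ?thesis by (simp add: has_field_derivative_def mult.commute[of _ "Re _"])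
  qed
  have "Re (dir_deriv u (dir_deriv u F) (x0 + 0 *\<^sub>R u)) \<le> 0"
  proof (rule second_derivative_at_max[OF der[OF smF] der[OF smooth_fun_dir_deriv[OF smF]]])
    have "Re (F x) = (norm (f x))\<^sup>2" for x
      unfolding cmod_power2 by (simp add: F_def power2_eq_square)
    then show "Re (F (x0 + t *\<^sub>R u)) \<le> Re (F (x0 + 0 *\<^sub>R u))" for t
      using max by (simp add: power_mono)
  qed
  then show ?thesis using ddd by simp
qed

lemma mag_lap_eigenvalue_nonneg:
  assumes f: "smooth_fun f" and eig: "\<And>x. mag_lap \<omega> f x = \<kappa> * f x"
    and max: "\<And>x. norm (f x) \<le> norm (f x0)" and "f x0 \<noteq> 0"
  shows "0 \<le> Re \<kappa>"
proof -
  have "(\<Sum>b\<in>Basis. Re (cov_deriv \<omega> b (cov_deriv \<omega> b f) x0 * cnj (f x0))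
      + (norm (cov_deriv \<omega> b f x0))\<^sup>2) \<le> 0"
    by (intro sum_nonpos cov_deriv_at_max f max)
  then have "(\<Sum>b\<in>Basis. Re (cov_deriv \<omega> b (cov_deriv \<omega> b f) x0 * cnj (f x0))) \<le> 0"
    using sum_nonneg[of Basis "\<lambda>b. (norm (cov_deriv \<omega> b f x0))\<^sup>2"] by (simp add: sum.distrib)
  also have "(\<Sum>b\<in>Basis. Re (cov_deriv \<omega> b (cov_deriv \<omega> b f) x0 * cnj (f x0)))
      = Re (- mag_lap \<omega> f x0 * cnj (f x0))"
    unfolding mag_lap_def by (simp add: sum_distrib_right)
  also have "\<dots> = - (Re \<kappa> * (norm (f x0))\<^sup>2)"
    unfolding eig cmod_power2 by (simp add: power2_eq_square algebra_simps)
  finally show ?thesis using \<open>f x0 \<noteq> 0\<close> by (simp add: zero_le_mult_iff)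
qed

end

text \<open>An oriented plane on which the field has strength \<open>\<beta>\<close>; its vectors
  pair under \<open>\<omega>\<close> only with components in the same plane. It may sit in a larger
  space, so the ladder operators also act on functions of both \<open>s\<close> and
  \<open>d\<close>.\<close>

locale magnetic_plane = magnetic \<omega> for \<omega> :: "'a::euclidean_space \<Rightarrow> 'a \<Rightarrow> real" +
  fixes u1 u2 :: 'a and \<beta> :: real
  assumes form_u1: "\<omega> x u1 = - \<beta> * (x \<bullet> u2)" and form_u2: "\<omega> x u2 = \<beta> * (x \<bullet> u1)"
    and unit: "u1 \<bullet> u1 = 1" "u2 \<bullet> u2 = 1" "u1 \<bullet> u2 = 0" and pos: "\<beta> > 0"
begin

definition lower :: "('a \<Rightarrow> complex) \<Rightarrow> 'a \<Rightarrow> complex" where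
  "lower f = (\<lambda>x. cov_deriv \<omega> u1 f x + (- \<i>) * cov_deriv \<omega> u2 f x)"

text \<open>The formal adjoint of \<open>lower\<close>. With this sign
  \<open>raise (lower f)\<close> is the part of the Laplacian in the plane minus the ground energy
  \<open>2 * \<beta>\<close>.\<close>

definition raise :: "('a \<Rightarrow> complex) \<Rightarrow> 'a \<Rightarrow> complex" where
  "raise f = (\<lambda>x. (- 1) * cov_deriv \<omega> u1 f x + (- \<i>) * cov_deriv \<omega> u2 f x)"

lemma smooth_fun_lower: "smooth_fun f \<Longrightarrow> smooth_fun (lower f)"
  unfolding lower_def by (intro smooth_fun_add smooth_fun_mult smooth_fun_const smooth_fun_cov_deriv)

lemma smooth_fun_raise: "smooth_fun f \<Longrightarrow> smooth_fun (raise f)"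
  unfolding raise_def by (intro smooth_fun_add smooth_fun_mult smooth_fun_const smooth_fun_cov_deriv)

lemma lower_linear:
  "smooth_fun f \<Longrightarrow> smooth_fun g \<Longrightarrow> lower (\<lambda>x. f x + g x) = (\<lambda>x. lower f x + lower g x)"
  "smooth_fun f \<Longrightarrow> lower (\<lambda>x. c * f x) = (\<lambda>x. c * lower f x)"
  by (simp_all add: lower_def cov_deriv_add cov_deriv_cmult algebra_simps)

lemma raise_linear:
  "smooth_fun f \<Longrightarrow> smooth_fun g \<Longrightarrow> raise (\<lambda>x. f x + g x) = (\<lambda>x. raise f x + raise g x)"
  "smooth_fun f \<Longrightarrow> raise (\<lambda>x. c * f x) = (\<lambda>x. c * raise f x)"
  by (simp_all add: raise_def cov_deriv_add cov_deriv_cmult algebra_simps)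

lemma mag_lap_u:
  assumes "smooth_fun f"
  shows "mag_lap \<omega> (cov_deriv \<omega> u1 f) x = cov_deriv \<omega> u1 (mag_lap \<omega> f) x + 4 * \<i> * of_real \<beta> *
      cov_deriv \<omega> u2 f x"
    "mag_lap \<omega> (cov_deriv \<omega> u2 f) x = cov_deriv \<omega> u2 (mag_lap \<omega> f) x - 4 * \<i> * of_real \<beta> * cov_deriv
        \<omega> u1 f x"
  using mag_lap_cov_deriv[OF assms, of u1 "(- \<beta>) *\<^sub>R u2" x]
      mag_lap_cov_deriv[OF assms, of u2 "\<beta> *\<^sub>R u1" x]
  by (simp_all add: form_u1 form_u2 cov_deriv_vec_scale assms del: scaleR_minus_left)

lemma mag_lap_lower:
  assumes f: "smooth_fun f"
  shows "mag_lap \<omega> (lower f) x = lower (mag_lap \<omega> f) x - 4 * of_real \<beta> * lower f x"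
  unfolding lower_def
  by (simp only: mag_lap_add mag_lap_cmult smooth_fun_cov_deriv smooth_fun_mult smooth_fun_const f
      mag_lap_u) (simp add: algebra_simps)

lemma mag_lap_raise:
  assumes f: "smooth_fun f"
  shows "mag_lap \<omega> (raise f) x = raise (mag_lap \<omega> f) x + 4 * of_real \<beta> * raise f x"
  unfolding raise_def
  by (simp only: mag_lap_add mag_lap_cmult smooth_fun_cov_deriv smooth_fun_mult smooth_fun_const f
      mag_lap_u) (simp add: algebra_simps)

lemma cov_deriv_u1_u2:
  assumes f: "smooth_fun f"
  shows "cov_deriv \<omega> u1 (cov_deriv \<omega> u2 f) x = cov_deriv \<omega> u2 (cov_deriv \<omega> u1 f) x
      + 2 * \<i> * of_real \<beta> * f x"
  using cov_deriv_comm[OF f, of u1 u2 x] by (simp add: form_u2 unit)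

lemma raise_lower:
  assumes f: "smooth_fun f"
  shows "raise (lower f) x = - cov_deriv \<omega> u1 (cov_deriv \<omega> u1 f) x
      - cov_deriv \<omega> u2 (cov_deriv \<omega> u2 f) x - 2 * of_real \<beta> * f x"
  unfolding raise_def lower_def
  by (simp only: cov_deriv_add cov_deriv_cmult smooth_fun_cov_deriv smooth_fun_mult smooth_fun_const
      f cov_deriv_u1_u2) (simp add: algebra_simps)

lemma lower_raise:
  assumes f: "smooth_fun f"
  shows "lower (raise f) x = raise (lower f) x + 4 * of_real \<beta> * f x"
  unfolding raise_lower[OF f] unfolding raise_def lower_def
  by (simp only: cov_deriv_add cov_deriv_cmult smooth_fun_cov_deriv smooth_fun_mult smooth_fun_const
      f cov_deriv_u1_u2) (simp add: algebra_simps)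

lemma lower_mag_transl: "smooth_fun f \<Longrightarrow> lower (mag_transl \<omega> m f) = mag_transl \<omega> m (lower f)"
  unfolding lower_def by (simp only: cov_deriv_mag_transl mag_transl_add mag_transl_cmult)

lemma raise_mag_transl: "smooth_fun f \<Longrightarrow> raise (mag_transl \<omega> m f) = mag_transl \<omega> m (raise f)"
  unfolding raise_def by (simp only: cov_deriv_mag_transl mag_transl_add mag_transl_cmult)

end

text \<open>Here \<open>X \<nu>\<close> is the eigenspace at energy \<open>\<nu>\<close>, and
  \<open>A\<close> and \<open>R\<close> lower and raise the energy by \<open>\<kappa>\<close>.
  Induction on \<open>k\<close>: the function \<open>g = (A ^^ k) f\<close> of the next case is
  killed by \<open>A\<close>, so \<open>(R ^^ k) g\<close> is an eigenfunction of the number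
  operator, and subtracting a multiple of it from \<open>f\<close> leaves a function killed by
  \<open>A ^^ k\<close>.\<close>

lemma ladder_decomposition:
  fixes X :: "complex \<Rightarrow> ('a \<Rightarrow> complex) set" and \<kappa> :: complex
  assumes sub: "\<And>\<nu>. cfun.subspace (X \<nu>)"
    and linA: "\<And>\<nu>. linear_on (X \<nu>) A" and linR: "\<And>\<nu>. linear_on (X \<nu>) R"
    and down: "\<And>\<nu> f. f \<in> X \<nu> \<Longrightarrow> A f \<in> X (\<nu> - \<kappa>)" and up: "\<And>\<nu> f. f \<in> X \<nu> \<Longrightarrow> R f \<in> X (\<nu> + \<kappa>)"
    and comm: "\<And>\<nu> f. f \<in> X \<nu> \<Longrightarrow> A (R f) = R (A f) + (\<lambda>x. \<kappa> * f x)" and nz: "\<kappa> \<noteq> 0"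
  shows "f \<in> X \<nu> \<Longrightarrow> (A ^^ k) f = 0 \<Longrightarrow> f
      \<in> cfun.span {h \<in> X \<nu>. \<exists>j::nat. R (A h) = (\<lambda>x. (of_nat j * \<kappa>) * h x)}"
proof (induction k arbitrary: f)
  case 0
  then have "f = 0" by (simp only: funpow_0)
  then show ?case by (simp only: cfun.span_zero)
next
  case (Suc k)
  have downk: "(A ^^ j) h \<in> X (\<nu>' - of_nat j * \<kappa>)" if "h \<in> X \<nu>'" for h \<nu>' j
  proof (induction j)
    case (Suc j)
    then show ?case using down[OF Suc] by (simp add: algebra_simps)
  qed (use that in simp)
  have upk: "(R ^^ j) h \<in> X (\<nu>' + of_nat j * \<kappa>)" if "h \<in> X \<nu>'" for h \<nu>' j
  proof (induction j)
    case (Suc j)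
    then show ?case using up[OF Suc] by (simp add: algebra_simps)
  qed (use that in simp)
  have Aadd: "(A ^^ j) (\<lambda>x. p x + c * q x) = (\<lambda>x. (A ^^ j) p x + c * (A ^^ j) q x)"
    if "p \<in> X \<nu>'" "q \<in> X \<nu>'" for p q \<nu>' c j
  proof (induction j)
    case (Suc j)
    have "A ((A ^^ j) p + (\<lambda>x. c * (A ^^ j) q x)) = A ((A ^^ j) p) + (\<lambda>x. c * A ((A ^^ j) q) x)"
      by (simp only: linear_onD(1)[OF linA downk[OF that(1)]
          cfun.subspace_scale[OF sub downk[OF that(2)]]]
          linear_onD(2)[OF linA downk[OF that(2)]])
    then show ?case by (simp add: Suc plus_fun_def)
  qed simp
  define g where "g = (A ^^ k) f"
  have gX: "g \<in> X (\<nu> - of_nat k * \<kappa>)" unfolding g_def by (rule downk[OF Suc.prems(1)])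
  have Ag: "A g = 0" using Suc.prems(2) by (simp only: g_def funpow.simps o_def)
  \<comment> \<open>Each of the \<open>Suc j\<close> factors \<open>R\<close> that \<open>A\<close>
    passes contributes one \<open>\<kappa>\<close>; at the end \<open>A\<close> meets
    \<open>g\<close> and gives \<open>0\<close>.\<close>
  have Ar: "A ((R ^^ Suc j) g) = (\<lambda>x. (of_nat (Suc j) * \<kappa>) * (R ^^ j) g x)" for j
  proof (induction j)
    case 0
    have "R (A g) = 0" unfolding Ag by (rule linear_on_zero[OF linR sub])
    then show ?case using comm[OF gX] by (simp add: plus_fun_def)
  next
    case (Suc j)
    have "A (R ((R ^^ Suc j) g)) = R (A ((R ^^ Suc j) g)) + (\<lambda>x. \<kappa> * (R ^^ Suc j) g x)"
      by (rule comm[OF upk[OF gX]])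
    also have "R (A ((R ^^ Suc j) g)) = (\<lambda>x. (of_nat (Suc j) * \<kappa>) * (R ^^ Suc j) g x)"
      unfolding Suc.IH by (simp only: linear_onD(2)[OF linR upk[OF gX]] funpow.simps o_def)
    finally show ?case by (simp add: plus_fun_def fun_eq_iff algebra_simps)
  qed
  define r where "r = (R ^^ k) g"
  have rX: "r \<in> X \<nu>" unfolding r_def using upk[OF gX, of k] by simp
  have Nr: "R (A r) = (\<lambda>x. (of_nat k * \<kappa>) * r x)"
  proof (cases k)
    case 0
    then show ?thesis using Ag linear_on_zero[OF linR sub] by (simp add: r_def zero_fun_def)
  next
    case (Suc j)
    show ?thesis unfolding r_def Suc Ar
        by (simp only: linear_onD(2)[OF linR upk[OF gX]] funpow.simps o_def)
  qed
  have Akr: "(A ^^ i) ((R ^^ i) g) = (\<lambda>x. (of_nat (fact i) * \<kappa> ^ i) * g x)" for i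
  proof (induction i)
    case (Suc i)
    have "(A ^^ Suc i) ((R ^^ Suc i) g) = (A ^^ i) (A ((R ^^ Suc i) g))"
      by (simp only: funpow_Suc_right o_def)
    also have "\<dots> = (A ^^ i) (\<lambda>x. 0 x + (of_nat (Suc i) * \<kappa>) * (R ^^ i) g x)"
      unfolding Ar by simp
    also have "\<dots> = (\<lambda>x. (A ^^ i) 0 x + (of_nat (Suc i) * \<kappa>) * (A ^^ i) ((R ^^ i) g) x)"
      by (rule Aadd[OF cfun.subspace_0[OF sub] upk[OF gX]])
    also have "(A ^^ i) 0 = 0"
      by (induction i) (simp_all only: funpow.simps o_def id_apply linear_on_zero[OF linA sub])
    finally show ?case by (simp add: Suc.IH algebra_simps)
  qed simp
  \<comment> \<open>\<open>(A ^^ k) r\<close> is \<open>fact k * \<kappa> ^ k\<close> times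
    \<open>g\<close>, so \<open>c\<close> times \<open>r\<close> cancels
    \<open>(A ^^ k) f = g\<close>.\<close>
  define c where "c = 1 / (of_nat (fact k) * \<kappa> ^ k)"
  define h where "h = (\<lambda>x. f x + (- c) * r x)"
  have hX: "h \<in> X \<nu>"
    using cfun.subspace_add[OF sub Suc.prems(1) cfun.subspace_scale[OF sub rX, of "- c"]]
    by (simp only: h_def plus_fun_def)
  have "(A ^^ k) h = (\<lambda>x. g x + (- c) * ((of_nat (fact k) * \<kappa> ^ k) * g x))"
    unfolding h_def Aadd[OF Suc.prems(1) rX] g_def[symmetric] unfolding r_def Akr ..
  also have "\<dots> = 0" using nz by (simp add: c_def fun_eq_iff)
  finally have "h \<in> cfun.span {h \<in> X \<nu>. \<exists>j::nat. R (A h) = (\<lambda>x. (of_nat j * \<kappa>) * h x)}"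
    by (rule Suc.IH[OF hX])
  moreover have "r \<in> cfun.span {h \<in> X \<nu>. \<exists>j::nat. R (A h) = (\<lambda>x. (of_nat j * \<kappa>) * h x)}"
    using rX Nr by (intro cfun.span_base) blast
  ultimately have "h + (\<lambda>x. c * r x)
      \<in> cfun.span {h \<in> X \<nu>. \<exists>j::nat. R (A h) = (\<lambda>x. (of_nat j * \<kappa>) * h x)}"
    by (rule cfun.span_add[OF _ cfun.span_scale])
  also have "h + (\<lambda>x. c * r x) = f" by (simp add: h_def fun_eq_iff)
  finally show ?case .
qed

section \<open>Finite-dimensional function spaces\<close>

lemma mdim_finite_iff: "mdim E \<noteq> \<infinity> \<longleftrightarrow> (\<exists>B. finite B \<and> E \<subseteq> cfun.span B)"
  by (simp add: mdim_def)

lemma mdim_finite_subset: "mdim E' \<noteq> \<infinity> \<Longrightarrow> E \<subseteq> E' \<Longrightarrow> mdim E \<noteq> \<infinity>"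
  unfolding mdim_finite_iff by blast

text \<open>The first \<open>k\<close> functionals embed \<open>W\<close> in the space of sequences
  supported below \<open>k\<close>.\<close>

lemma mdim_finite_functionals:
  fixes \<Theta> :: "('a \<Rightarrow> complex) \<Rightarrow> nat \<Rightarrow> complex"
  assumes sub: "cfun.subspace W" and lin: "linear_on W \<Theta>"
    and inj: "\<And>f. f \<in> W \<Longrightarrow> (\<And>n. n < k \<Longrightarrow> \<Theta> f n = 0) \<Longrightarrow> f = 0"
  shows "mdim W \<noteq> \<infinity>"
proof -
  define \<Theta>' where "\<Theta>' f = (\<lambda>n::nat. if n < k then \<Theta> f n else 0)" for f
  define T where "T = {g :: nat \<Rightarrow> complex. \<forall>n\<ge>k. g n = 0}"
  have lin': "linear_on W \<Theta>'"
    unfolding linear_on_def \<Theta>'_def using linear_onD[OF lin] by (auto simp: fun_eq_iff)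
  have "mdim W \<le> mdim T"
  proof (rule mdim_le_inj[OF sub lin'])
    show "f = 0" if "f \<in> W" "\<Theta>' f = 0" for f
    proof (rule inj[OF that(1)])
      show "\<Theta> f n = 0" if "n < k" for n
        using fun_cong[OF \<open>\<Theta>' f = 0\<close>, of n] that by (simp add: \<Theta>'_def)
    qed
  qed (auto simp: T_def \<Theta>'_def)
  moreover have "T \<subseteq> cfun.span ((\<lambda>m n. if n = m then 1 else 0) ` {..<k})"
  proof
    fix g assume g: "g \<in> T"
    have "g = (\<Sum>m<k. (\<lambda>n. g m * (if n = m then 1 else 0)))"
    proof
      fix n
      have "(\<Sum>m<k. g m * (if n = m then 1 else 0)) = (if n < k then g n else 0)"
        by (simp add: if_distrib cong: if_cong)
      then show "g n = (\<Sum>m<k. (\<lambda>n. g m * (if n = m then 1 else 0))) n"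
        using g by (simp add: sum_fun_apply T_def)
    qed
    also have "\<dots> \<in> cfun.span ((\<lambda>m n. if n = m then 1 else 0) ` {..<k})"
      by (intro cfun.span_sum cfun.span_scale cfun.span_base) auto
    finally show "g \<in> cfun.span ((\<lambda>m n. if n = m then 1 else 0) ` {..<k})" .
  qed
  then have "mdim T \<noteq> \<infinity>" unfolding mdim_finite_iff by blast
  ultimately show ?thesis by (cases "mdim T"; cases "mdim W") auto
qed

text \<open>Preimages of a finite basis of the image, together with a finite set spanning the
  kernel, span \<open>W\<close>.\<close>

lemma mdim_finite_kernel_image:
  assumes sub: "cfun.subspace W" and lin: "linear_on W A"
    and ker: "mdim {f \<in> W. A f = 0} \<noteq> \<infinity>" and im: "mdim (A ` W) \<noteq> \<infinity>"
  shows "mdim W \<noteq> \<infinity>"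
proof -
  obtain K where K: "finite K" "{f \<in> W. A f = 0} \<subseteq> cfun.span K"
    using ker unfolding mdim_finite_iff by blast
  obtain B where B: "finite B" "A ` W \<subseteq> cfun.span B"
    using im unfolding mdim_finite_iff by blast
  obtain S where S: "S \<subseteq> A ` W" "cfun.independent S" "A ` W \<subseteq> cfun.span S" "card S = cfun.dim (A ` W)"
    using cfun.basis_exists by blast
  have finS: "finite S" using cfun.independent_span_bound[OF B(1) S(2)] S(1) B(2) by blast
  define p where "p s = (SOME f. f \<in> W \<and> A f = s)" for s
  have p: "p s \<in> W \<and> A (p s) = s" if "s \<in> S" for s
    unfolding p_def using that S(1) by (intro someI_ex[of "\<lambda>f. f \<in> W \<and> A f = s"]) blast
  have "W \<subseteq> cfun.span (p ` S \<union> K)"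
  proof
    fix f assume f: "f \<in> W"
    obtain c where c: "A f = (\<Sum>s\<in>S. (\<lambda>x. c s * s x))"
      using f S(3) cfun.span_finite[OF finS] by (auto simp: image_iff)
    define h where "h = (\<Sum>s\<in>S. (\<lambda>x. c s * p s x))"
    have hW: "h \<in> W" unfolding h_def using p
        by (intro cfun.subspace_sum[OF sub] cfun.subspace_scale[OF sub]) blast
    have "A h = (\<Sum>s\<in>S. A (\<lambda>x. c s * p s x))"
      unfolding h_def using p by (intro linear_on_sum[OF lin sub finS] cfun.subspace_scale[OF sub])
          blast
    also have "\<dots> = (\<Sum>s\<in>S. (\<lambda>x. c s * s x))"
      using p by (intro sum.cong refl) (simp add: linear_onD(2)[OF lin])
    finally have Ah: "A h = A f" using c by simp
    have "A (f + (\<lambda>x. (- 1) * h x)) = A f + (\<lambda>x. (- 1) * A h x)"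
      by (simp only: linear_onD(1)[OF lin f cfun.subspace_scale[OF sub hW]] linear_onD(2)[OF lin hW])
    also have "\<dots> = 0" unfolding Ah by (simp add: fun_eq_iff)
    finally have "f + (\<lambda>x. (- 1) * h x) \<in> cfun.span K"
      using K(2) cfun.subspace_add[OF sub f cfun.subspace_scale[OF sub hW, of "- 1"]] by blast
    then have 1: "f + (\<lambda>x. (- 1) * h x) \<in> cfun.span (p ` S \<union> K)"
      using cfun.span_mono[of K "p ` S \<union> K"] by blast
    have 2: "h \<in> cfun.span (p ` S \<union> K)"
      unfolding h_def by (intro cfun.span_sum cfun.span_scale cfun.span_base) blast
    have "(f + (\<lambda>x. (- 1) * h x)) + h = f" by (simp add: fun_eq_iff)
    with cfun.span_add[OF 1 2] show "f \<in> cfun.span (p ` S \<union> K)" by (simp only: )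
  qed
  moreover have "finite (p ` S \<union> K)" using finS K(1) by simp
  ultimately show ?thesis unfolding mdim_finite_iff by (intro exI[of _ "p ` S \<union> K"] conjI)
qed

text \<open>A basis whose coordinates are point evaluations. For a function of two variables with
  slices in \<open>F\<close>, the coefficients of the expansion are then slices in the other
  variable, so they inherit smoothness and all equations in that variable.\<close>

lemma evaluation_dual_basis:
  assumes "cfun.subspace F" "mdim F \<noteq> \<infinity>"
  obtains S \<phi> where "finite S" "\<And>p. p \<in> S \<Longrightarrow> \<phi> p \<in> F"
    "\<And>p q. p \<in> S \<Longrightarrow> q \<in> S \<Longrightarrow> \<phi> p q = (if p = q then 1 else 0)"
    "\<And>f x. f \<in> F \<Longrightarrow> f x = (\<Sum>p\<in>S. f p * \<phi> p x)"
proof -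
  have *: "\<exists>S \<phi>. finite S \<and> (\<forall>p\<in>S. \<phi> p \<in> F) \<and> (\<forall>p\<in>S. \<forall>q\<in>S. \<phi> p q = (if p = q then 1 else 0)) \<and>
      (\<forall>f\<in>F. \<forall>x. f x = (\<Sum>p\<in>S. f p * \<phi> p x))"
    if "cfun.subspace F" "\<And>T. finite T \<Longrightarrow> T \<subseteq> F \<Longrightarrow> cfun.independent T \<Longrightarrow> card T \<le> n"
    for n and F :: "('a \<Rightarrow> complex) set"
    using that
  proof (induction n arbitrary: F)
    case 0
    have "f x = 0" if "f \<in> F" for f x
    proof (rule ccontr)
      assume "f x \<noteq> 0"
      then have "f \<noteq> 0" by (auto simp: fun_eq_iff)
      then have "cfun.independent {f}" by (simp only: cfun.dependent_single not_False_eq_True)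
      from 0(2)[OF _ _ this] that show False by simp
    qed
    then show ?case by (intro exI[of _ "{}"]) auto
  next
    case (Suc n)
    show ?case
    proof (cases "\<exists>f\<in>F. \<exists>p. f p \<noteq> 0")
      case False
      then show ?thesis by (intro exI[of _ "{}"]) auto
    next
      case True
      then obtain f0 p where f0: "f0 \<in> F" "f0 p \<noteq> 0" by blast
      define g where "g = (\<lambda>x. (1 / f0 p) * f0 x)"
      have g: "g \<in> F" "g p = 1"
        unfolding g_def by (rule cfun.subspace_scale[OF Suc.prems(1) f0(1)]) (use f0(2) in simp)
      \<comment> \<open>Evaluation at \<open>p\<close> cuts the dimension by one: \<open>g\<close>
        with \<open>g p = 1\<close> enlarges every independent subset of \<open>F'\<close>, so the
        bound drops to \<open>n\<close>.\<close>
      define F' where "F' = {f \<in> F. f p = 0}"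
      have sub': "cfun.subspace F'"
        unfolding F'_def by (rule cfun.subspaceI)
          (use cfun.subspace_0[OF Suc.prems(1)] cfun.subspace_add[OF Suc.prems(1)]
              cfun.subspace_scale[OF Suc.prems(1)] in auto)
      have cardT: "card T \<le> n" if T: "finite T" "T \<subseteq> F'" "cfun.independent T" for T
      proof -
        have "cfun.span T \<subseteq> F'" using cfun.span_minimal[OF T(2) sub'] .
        then have "g \<notin> cfun.span T" using g(2) by (auto simp: F'_def)
        then have "cfun.independent (insert g T)" "g \<notin> T"
          using cfun.independent_insertI T(3) cfun.span_base by blast+
        then have "card (insert g T) \<le> Suc n"
          using T g(1) by (intro Suc.prems(2)) (auto simp: F'_def)
        then show ?thesis using \<open>g \<notin> T\<close> T(1) by simp
      qed
      have "\<exists>S \<phi>. finite S \<and> (\<forall>p\<in>S. \<phi> p \<in> F') \<and>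
          (\<forall>p\<in>S. \<forall>q\<in>S. \<phi> p q = (if p = q then 1 else 0)) \<and> (\<forall>f\<in>F'. \<forall>x. f x = (\<Sum>p\<in>S. f p * \<phi> p x))"
        by (rule Suc.IH[OF sub']) (rule cardT)
      then obtain S \<phi> where S': "finite S \<and> (\<forall>p\<in>S. \<phi> p \<in> F') \<and>
          (\<forall>p\<in>S. \<forall>q\<in>S. \<phi> p q = (if p = q then 1 else 0)) \<and> (\<forall>f\<in>F'. \<forall>x. f x = (\<Sum>p\<in>S. f p * \<phi> p x))"
        by (elim exE)
      have S: "finite S" "\<And>q. q \<in> S \<Longrightarrow> \<phi> q \<in> F'"
        "\<And>q r. q \<in> S \<Longrightarrow> r \<in> S \<Longrightarrow> \<phi> q r = (if q = r then 1 else 0)"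
        "\<And>f x. f \<in> F' \<Longrightarrow> f x = (\<Sum>q\<in>S. f q * \<phi> q x)" using S' by (auto simp only:)
      have pS: "p \<notin> S" using S(2,3) unfolding F'_def by force
      have \<phi>p: "\<phi> q p = 0" if "q \<in> S" for q using S(2)[OF that] by (simp add: F'_def)
      \<comment> \<open>\<open>g\<close> is corrected so as to vanish at the old points; the old
        functions already vanish at \<open>p\<close>, being in \<open>F'\<close>.\<close>
      define \<psi> where "\<psi> = \<phi>(p := (\<lambda>x. g x + (\<Sum>q\<in>S. (- g q) * \<phi> q x)))"
      have eq: "f x = (\<Sum>q\<in>insert p S. f q * \<psi> q x)" if f: "f \<in> F" for f x
      proof -
        have "f + (\<lambda>x. (- f p) * g x) \<in> F'"
          unfolding F'_def using cfun.subspace_add[OF Suc.prems(1) f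
              cfun.subspace_scale[OF Suc.prems(1) g(1), of "- f p"]] g(2)
          by simp
        from S(4)[OF this, of x]
        have 1: "f x - f p * g x = (\<Sum>q\<in>S. f q * \<phi> q x) - f p * (\<Sum>q\<in>S. g q * \<phi> q x)"
          by (simp add: left_diff_distrib sum_subtractf sum_distrib_left mult.assoc)
        have 2: "(\<Sum>q\<in>insert p S. f q * \<psi> q x) = f p * (g x - (\<Sum>q\<in>S. g q * \<phi> q x)) + (\<Sum>q\<in>S. f q * \<phi> q x)"
          using S(1) pS by (auto simp: \<psi>_def sum_negf intro!: sum.cong)
        show ?thesis unfolding 2 using 1 by algebra
      qed
      have \<psi>F: "\<psi> q \<in> F" if "q \<in> insert p S" for q
      proof (cases "q = p")
        case True
        have "g + (\<Sum>q\<in>S. (\<lambda>x. (- g q) * \<phi> q x)) \<in> F"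
          using S(2) unfolding F'_def
          by (intro cfun.subspace_add[OF Suc.prems(1)] cfun.subspace_sum[OF Suc.prems(1)]
              cfun.subspace_scale[OF Suc.prems(1)] g) auto
        moreover have "g + (\<Sum>q\<in>S. (\<lambda>x. (- g q) * \<phi> q x)) = \<psi> q"
          unfolding True \<psi>_def by (simp add: fun_eq_iff sum_fun_apply)
        ultimately show ?thesis by simp
      next
        case False
        then show ?thesis using that S(2) by (auto simp: \<psi>_def F'_def)
      qed
      have \<psi>d: "\<psi> q r = (if q = r then 1 else 0)" if "q \<in> insert p S" "r \<in> insert p S" for q r
      proof (cases "q = p")
        case True
        have "(\<Sum>q\<in>S. g q * \<phi> q r) = (if r = p then 0 else g r)"
        proof (cases "r = p")
          case False
          then have "r \<in> S" using that by simp
          then have "(\<Sum>q\<in>S. g q * \<phi> q r) = (\<Sum>q\<in>S. if q = r then g q else 0)"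
            using S(3) by (intro sum.cong) auto
          then show ?thesis using False \<open>r \<in> S\<close> S(1) by simp
        qed (use \<phi>p in simp)
        then show ?thesis using True g(2) by (auto simp: \<psi>_def sum_negf)
      next
        case False
        then show ?thesis using that S(3) \<phi>p pS by (auto simp: \<psi>_def)
      qed
      show ?thesis
        using S(1) eq \<psi>F \<psi>d by (intro exI[of _ "insert p S"] exI[of _ \<psi>] conjI ballI allI) auto
    qed
  qed
  obtain B where B: "finite B" "F \<subseteq> cfun.span B" using assms(2) unfolding mdim_finite_iff by blast
  have cardB: "card T \<le> card B" if "finite T" "T \<subseteq> F" "cfun.independent T" for T
    using cfun.independent_span_bound[OF B(1) that(3)] that(2) B(2) by blast
  have "\<exists>S \<phi>. finite S \<and> (\<forall>p\<in>S. \<phi> p \<in> F) \<and> (\<forall>p\<in>S. \<forall>q\<in>S. \<phi> p q = (if p = q then 1 else 0)) \<and>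
      (\<forall>f\<in>F. \<forall>x. f x = (\<Sum>p\<in>S. f p * \<phi> p x))"
    by (rule *[OF assms(1)]) (rule cardB)
  then obtain S \<phi> where D: "finite S \<and> (\<forall>p\<in>S. \<phi> p \<in> F)
      \<and> (\<forall>p\<in>S. \<forall>q\<in>S. \<phi> p q = (if p = q then 1 else 0)) \<and>
      (\<forall>f\<in>F. \<forall>x. f x = (\<Sum>p\<in>S. f p * \<phi> p x))"
    by (elim exE)
  show ?thesis
  proof (rule that[of S \<phi>])
    show "f x = (\<Sum>p\<in>S. f p * \<phi> p x)" if "f \<in> F" for f x using D that by blast
  qed (use D in \<open>simp_all only: simp_thms ball_simps\<close>)
qed

section \<open>Lowest Landau levels and entire functions\<close>

lemma entire_vanishing_order_bound:
  fixes F :: "complex \<Rightarrow> complex"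
  assumes hol: "F holomorphic_on UNIV" and van: "\<And>n. n < k \<Longrightarrow> (deriv ^^ n) F 0 = 0"
    and r: "0 < r" "norm z \<le> r" and bound: "\<And>w. norm w = 2 * r \<Longrightarrow> norm (F w) \<le> C"
  shows "norm (F z) \<le> 2 * (1 / 2) ^ k * C"
proof -
  define t where "t n = (deriv ^^ n) F 0 / fact n * z ^ n" for n
  have "F holomorphic_on ball 0 (2 * r)" using hol holomorphic_on_subset by blast
  from holomorphic_power_series[OF this, of z] have sums: "t sums F z"
    using r unfolding t_def by simp
  have C: "0 \<le> C"
    using order_trans[OF norm_ge_zero bound[of "of_real (2 * r)"]] r by simp
  \<comment> \<open>Cauchy's estimate on the circle of radius \<open>2 * r\<close>, evaluated at a
    point of norm at most \<open>r\<close>, gains a factor \<open>1 / 2\<close> per order. The terms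
    from \<open>k\<close> on then sum to at most \<open>2 * (1 / 2) ^ k * C\<close>.\<close>
  have tn: "norm (t n) \<le> C * (1 / 2) ^ n" for n
  proof -
    have "norm ((deriv ^^ n) F 0) \<le> fact n * C / (2 * r) ^ n"
      by (rule Cauchy_inequality)
        (use hol holomorphic_on_subset holomorphic_on_imp_continuous_on r bound in
            \<open>auto simp: norm_minus_commute\<close>)
    then have "norm (t n) \<le> (fact n * C / (2 * r) ^ n) / fact n * r ^ n"
      unfolding t_def norm_mult norm_divide norm_power norm_fact
      using r C by (intro mult_mono divide_right_mono power_mono) auto
    also have "\<dots> = C * (1 / 2) ^ n"
      using r by (simp add: power_mult_distrib power_divide)
    finally show ?thesis .
  qed
  have tz: "t n = 0" if "n < k" for n using van[OF that] by (simp add: t_def)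
  have "(\<lambda>i. t (i + k)) sums F z"
    using sums_zero_iff_shift[of k t "F z"] sums tz by blast
  moreover have "(\<lambda>i. C * (1 / 2) ^ k * (1 / 2) ^ i) sums (C * (1 / 2) ^ k * (1 / (1 - 1 / 2)))"
    by (intro sums_mult geometric_sums) simp
  moreover have "norm (t (i + k)) \<le> C * (1 / 2) ^ k * (1 / 2) ^ i" for i
    using tn[of "i + k"] by (simp add: power_add mult_ac)
  ultimately have "norm (F z) \<le> C * (1 / 2) ^ k * (1 / (1 - 1 / 2))"
    by (metis norm_suminf_le sums_unique sums_summable)
  then show ?thesis by (simp add: mult_ac)
qed

context magnetic_plane
begin

text \<open>
  The lowering operator is a \<open>\<partial>\<close>-operator in the plane of \<open>u1, u2\<close>; the conjugate coordinate and a
  Gaussian factor turn its kernel into entire functions.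
\<close>

definition plane_pt :: "complex \<Rightarrow> 'a" where
  "plane_pt z = Re z *\<^sub>R u1 + (- Im z) *\<^sub>R u2"

definition holo :: "('a \<Rightarrow> complex) \<Rightarrow> complex \<Rightarrow> complex" where
  "holo f z = exp (of_real (\<beta> * ((Re z)\<^sup>2 + (Im z)\<^sup>2) / 2)) * f (plane_pt z)"

lemma holo_deriv:
  assumes f: "smooth_fun f" and low: "lower f = 0"
  shows "\<exists>D. (holo f has_field_derivative D) (at z)"
proof -
  define e where "e = exp (complex_of_real (\<beta> * ((Re z)\<^sup>2 + (Im z)\<^sup>2) / 2))"
  define p where "p = plane_pt z"
  \<comment> \<open>The derivative in the real direction. Since \<open>lower f = 0\<close> expresses
    the derivative along \<open>u2\<close> through that along \<open>u1\<close>, the real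
    differential turns out to be multiplication by \<open>D\<close>.\<close>
  define D where "D = e * (\<beta> * Re z * f p + dir_deriv u1 f p)"
  have "((\<lambda>z. \<beta> * ((Re z)\<^sup>2 + (Im z)\<^sup>2) / 2) has_derivative (\<lambda>h. \<beta> * (Re z * Re h + Im z * Im h)))
      (at z)"
    by (auto intro!: derivative_eq_intros bounded_linear_imp_has_derivative bounded_linear_Re
        bounded_linear_Im
        simp: field_simps)
  from bounded_linear.has_derivative[OF bounded_linear_of_real this]
  have "((\<lambda>z. exp (complex_of_real (\<beta> * ((Re z)\<^sup>2 + (Im z)\<^sup>2) / 2))) has_derivative
      (\<lambda>h. e * of_real (\<beta> * (Re z * Re h + Im z * Im h)))) (at z)"
    unfolding e_def by (rule has_derivative_compose[OF _ DERIV_exp[unfolded has_field_derivative_def]])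
  moreover have "(plane_pt has_derivative plane_pt) (at z)"
  proof (rule bounded_linear_imp_has_derivative)
    show "bounded_linear plane_pt"
      unfolding plane_pt_def scaleR_minus_left
      by (intro bounded_linear_add bounded_linear_minus bounded_linear_scaleR_const
          bounded_linear_Re bounded_linear_Im)
  qed
  then have "((\<lambda>z. f (plane_pt z)) has_derivative (\<lambda>h. dir_deriv (plane_pt h) f p)) (at z)"
    unfolding p_def by (rule has_derivative_compose[OF _ smooth_fun_has_derivative[OF f]])
  ultimately have "(holo f has_derivative (\<lambda>h. e * dir_deriv (plane_pt h) f p
      + e * of_real (\<beta> * (Re z * Re h + Im z * Im h)) * f p)) (at z)"
    unfolding holo_def[abs_def] e_def p_def by (rule has_derivative_mult)
  moreover have "e * dir_deriv (plane_pt h) f p + e * of_real (\<beta> * (Re z * Re h + Im z * Im h)) * f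
      p = D * h" for h
  proof -
    have "dir_deriv (plane_pt h) f p = Re h * dir_deriv u1 f p - Im h * dir_deriv u2 f p"
      unfolding plane_pt_def
      by (simp only: dir_deriv_add_vec dir_deriv_scale_vec smooth_fun_differentiable[OF f])
          (simp add: scaleR_conv_of_real)
    moreover have "dir_deriv u2 f p = - \<i> * dir_deriv u1 f p + \<beta> * Im z * f p - \<i> * \<beta> * Re z * f p"
    proof -
      have "\<omega> p u1 = \<beta> * Im z" "\<omega> p u2 = \<beta> * Re z"
        using unit by (simp_all add: form_u1 form_u2 p_def plane_pt_def inner_diff_left
            inner_add_left inner_commute[of u2 u1])
      then have "dir_deriv u1 f p + \<i> * of_real (\<beta> * Im z) * f p
          + (- \<i>) * (dir_deriv u2 f p + \<i> * of_real (\<beta> * Re z) * f p) = 0"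
        using fun_cong[OF low, of p] by (simp add: lower_def cov_deriv_def)
      then have "\<i> * dir_deriv u2 f p = dir_deriv u1 f p + \<i> * of_real (\<beta> * Im z) * f p
          + of_real (\<beta> * Re z) * f p"
        by (simp add: algebra_simps)
      moreover have "\<i> * \<i> = (- 1 :: complex)" by simp
      ultimately have "dir_deriv u2 f p = - \<i> * dir_deriv u1 f p + of_real (\<beta> * Im z) * f p
          - \<i> * of_real (\<beta> * Re z) * f p"
        by algebra
      then show ?thesis by simp
    qed
    moreover have "h = Re h + \<i> * Im h" by (rule complex_eq)
    moreover have "\<i> * \<i> = (- 1 :: complex)" by simp
    ultimately show ?thesis
      unfolding D_def of_real_mult of_real_add by algebra
  qed
  ultimately have "(holo f has_field_derivative D) (at z)"
    by (simp add: has_field_derivative_def)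
  then show ?thesis by blast
qed

text \<open>Let \<open>M\<close> be the maximum of \<open>|f|\<close>, attained within radius
  \<open>r\<close>. If the first \<open>k\<close> Taylor coefficients of \<open>holo f\<close>
  vanish, then \<open>M \<le> 2 * (1 / 2) ^ k * C * M\<close>, where \<open>C\<close> is the inverse
  Gaussian factor at radius \<open>2 * r\<close> and does not depend on \<open>f\<close>. With
  \<open>k\<close> large this forces \<open>M = 0\<close>, so \<open>k\<close> coefficients
  determine \<open>f\<close>.\<close>

lemma lower_kernel_finite:
  assumes sub: "cfun.subspace W" and W: "\<And>f. f \<in> W \<Longrightarrow> smooth_fun f" "\<And>f. f \<in> W \<Longrightarrow> lower f = 0"
    and r: "0 < r" and max: "\<And>f. f \<in> W \<Longrightarrow> \<exists>z. norm z \<le> r \<and> (\<forall>x. norm (f x) \<le> norm (f (plane_pt z)))"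
  shows "mdim W \<noteq> \<infinity>"
proof -
  have hol: "holo f holomorphic_on UNIV" if "f \<in> W" for f
    using holo_deriv[OF W(1)[OF that] W(2)[OF that]]
        by (auto simp: holomorphic_on_def field_differentiable_def)
  define C where "C = exp (\<beta> * (2 * r)\<^sup>2 / 2)"
  have "(\<lambda>k. 2 * (1 / 2) ^ k * C) \<longlonglongrightarrow> 2 * 0 * C"
    by (intro tendsto_intros LIMSEQ_power_zero) simp
  then have "eventually (\<lambda>k. 2 * (1 / 2) ^ k * C < 1) sequentially"
    by (auto dest!: order_tendstoD(2)[of _ _ _ 1])
  then obtain k where k: "2 * (1 / 2) ^ k * C < 1" by (auto simp: eventually_sequentially)
  define \<Theta> where "\<Theta> f n = (deriv ^^ n) (holo f) 0" for f n
  have "linear_on W \<Theta>"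
    unfolding linear_on_def
  proof (intro conjI ballI allI ext)
    fix f g n assume fg: "f \<in> W" "g \<in> W"
    have "holo (f + g) = (\<lambda>z. holo f z + holo g z)" by (simp add: holo_def fun_eq_iff distrib_left)
    then show "\<Theta> (f + g) n = (\<Theta> f + \<Theta> g) n"
      using higher_deriv_add[OF hol[OF fg(1)] hol[OF fg(2)] open_UNIV, of 0 n] by (simp add: \<Theta>_def)
  next
    fix c f n assume f: "f \<in> W"
    have "holo (\<lambda>x. c * f x) = (\<lambda>z. c * holo f z)" by (simp add: holo_def fun_eq_iff mult.left_commute)
    then show "\<Theta> (\<lambda>x. c * f x) n = c * \<Theta> f n"
      using higher_deriv_cmult[OF hol[OF f] _ open_UNIV, of 0 n c] by (simp add: \<Theta>_def)
  qed
  then show ?thesis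
  proof (rule mdim_finite_functionals[OF sub])
    fix f assume f: "f \<in> W" and van: "\<And>n. n < k \<Longrightarrow> \<Theta> f n = 0"
    obtain z where z: "norm z \<le> r" "\<And>x. norm (f x) \<le> norm (f (plane_pt z))" using max[OF f] by blast
    define M where "M = norm (f (plane_pt z))"
    have nrm: "norm (holo f w) = exp (\<beta> * (norm w)\<^sup>2 / 2) * norm (f (plane_pt w))" for w
      by (simp add: holo_def norm_mult cmod_power2)
    have "M \<le> norm (holo f z)"
      unfolding nrm M_def using pos mult_right_mono[of 1 "exp (\<beta> * (norm z)\<^sup>2 / 2)"
          "norm (f (plane_pt z))"] by simp
    also have "norm (holo f z) \<le> 2 * (1 / 2) ^ k * (C * M)"
    proof (rule entire_vanishing_order_bound[OF hol[OF f] _ r z(1)])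
      show "(deriv ^^ n) (holo f) 0 = 0" if "n < k" for n using van[OF that] by (simp add: \<Theta>_def)
      show "norm (holo f w) \<le> C * M" if "norm w = 2 * r" for w
        unfolding nrm that C_def M_def by (intro mult_left_mono z) simp
    qed
    finally have "M \<le> (2 * (1 / 2) ^ k * C) * M" by simp
    then have "(1 - 2 * (1 / 2) ^ k * C) * M \<le> 0" by (simp add: algebra_simps)
    then have "M \<le> 0" using k by (simp add: mult_le_0_iff)
    then have "f x = 0" for x using z(2)[of x] by (simp add: M_def)
    then show "f = 0" by (simp add: fun_eq_iff)
  qed
qed

end

section \<open>Magnetic forms from the cross product on \<open>real ^ 3\<close>\<close>

lemma full_if_spanned:
  assumes "E \<subseteq> cfun.span (\<Union>i\<in>I. D i)" "\<And>i. i \<in> I - F \<Longrightarrow> D i \<subseteq> {0}"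
  shows "E \<subseteq> cfun.span (\<Union>i\<in>F. D i)"
proof -
  have "(\<Union>i\<in>I. D i) \<subseteq> cfun.span (\<Union>i\<in>F. D i)"
  proof (rule UN_least)
    fix i assume "i \<in> I"
    show "D i \<subseteq> cfun.span (\<Union>i\<in>F. D i)"
    proof (cases "i \<in> F")
      case True
      then show ?thesis using cfun.span_superset[of "\<Union>i\<in>F. D i"] by blast
    next
      case False
      then have "D i \<subseteq> {0}" using assms(2) \<open>i \<in> I\<close> by blast
      then show ?thesis using cfun.span_zero[of "\<Union>i\<in>F. D i"] by blast
    qed
  qed
  then have "cfun.span (\<Union>i\<in>I. D i) \<subseteq> cfun.span (\<Union>i\<in>F. D i)"
    by (rule cfun.span_minimal[OF _ cfun.subspace_span])
  with assms(1) show ?thesis by (rule order_trans)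
qed

context magnetic
begin

text \<open>The potential is constant along the null direction \<open>w\<close>, so it can be taken
  out of the average along \<open>w\<close>.\<close>

lemma fourier_proj_cov_deriv:
  assumes f: "smooth_fun f" and w: "\<And>u. \<omega> w u = 0"
  shows "cov_deriv \<omega> u (fourier_proj w n f) = fourier_proj w n (cov_deriv \<omega> u f)"
proof
  fix x
  have "fourier_proj w n (\<lambda>x. dir_deriv u f x + \<i> * of_real (\<omega> x u) * f x) x =
      fourier_proj w n (dir_deriv u f) x + fourier_proj w n (\<lambda>x. \<i> * of_real (\<omega> x u) * f x) x"
    by (intro fourier_proj_add smooth_fun_continuous smooth_fun_dir_deriv smooth_fun_mult
        smooth_fun_const smooth_fun_form f)
  also have "fourier_proj w n (\<lambda>x. \<i> * of_real (\<omega> x u) * f x) x = \<i> * of_real (\<omega> x u) * fourier_proj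
      w n f x"
    unfolding fourier_proj_def using w
        by (simp add: form_simps mult.left_commute[of _ "\<i> * _"] flip: integral_mult_right)
  finally show "cov_deriv \<omega> u (fourier_proj w n f) x = fourier_proj w n (cov_deriv \<omega> u f) x"
    by (simp add: cov_deriv_def dir_deriv_fourier_proj[OF f])
qed

lemma fourier_proj_mag_transl:
  assumes w: "\<And>u. \<omega> w u = 0"
  shows "mag_transl \<omega> m (fourier_proj w n f) = fourier_proj w n (mag_transl \<omega> m f)"
proof
  fix x
  have "\<omega> m w = 0" using w skew[of m w] by simp
  then show "mag_transl \<omega> m (fourier_proj w n f) x = fourier_proj w n (mag_transl \<omega> m f) x"
    unfolding mag_transl_def fourier_proj_def
    by (simp add: form_simps add_ac mult.left_commute[of _ "cis (\<omega> m x)"])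
qed

lemma fourier_proj_mag_lap:
  assumes f: "smooth_fun f" and w: "\<And>u. \<omega> w u = 0"
  shows "mag_lap \<omega> (fourier_proj w n f) = fourier_proj w n (mag_lap \<omega> f)"
proof
  fix x
  have "fourier_proj w n (\<lambda>x. (- 1) * (\<Sum>b\<in>Basis. cov_deriv \<omega> b (cov_deriv \<omega> b f) x)) x =
      (- 1) * (\<Sum>b\<in>Basis. fourier_proj w n (cov_deriv \<omega> b (cov_deriv \<omega> b f)) x)"
    unfolding fourier_proj_cmult
        by (subst fourier_proj_sum) (auto intro!: smooth_fun_continuous smooth_fun_cov_deriv f)
  then show "mag_lap \<omega> (fourier_proj w n f) x = fourier_proj w n (mag_lap \<omega> f) x"
    by (simp add: mag_lap_def fourier_proj_cov_deriv f w smooth_fun_cov_deriv)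
qed

text \<open>Two magnetic translations commute up to \<open>cis (2 * \<omega> l m)\<close>, the
  holonomy of the flux through the parallelogram that they span.\<close>

lemma mag_transl_commute:
  assumes "cis (2 * \<omega> l m) = 1"
  shows "mag_transl \<omega> m (mag_transl \<omega> l f) = mag_transl \<omega> l (mag_transl \<omega> m f)"
proof
  fix x
  have "cis (\<omega> l m) = cis (2 * \<omega> l m) * cis (\<omega> m l)"
    using skew[of m l] by (simp add: cis_mult)
  then show "mag_transl \<omega> m (mag_transl \<omega> l f) x = mag_transl \<omega> l (mag_transl \<omega> m f) x"
    using assms by (simp add: mag_transl_mag_transl add.commute)
qed

text \<open>The trace of a quadratic expression is the same in every orthonormal frame. The map
  \<open>L\<close> embeds the frame in a larger space, so that the Laplacian in one of two variables
  is covered.\<close>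

lemma cov_deriv_frame_sum:
  fixes L :: "'b::euclidean_space \<Rightarrow> 'a"
  assumes f: "smooth_fun f" and L: "linear L" and S: "finite S"
    and expand: "\<And>x. x = (\<Sum>u\<in>S. (x \<bullet> u) *\<^sub>R u)"
    and ortho: "\<And>u v. u \<in> S \<Longrightarrow> v \<in> S \<Longrightarrow> u \<bullet> v = (if u = v then 1 else 0)"
  shows "(\<Sum>e\<in>Basis. cov_deriv \<omega> (L e) (cov_deriv \<omega> (L e) f) x)
      = (\<Sum>u\<in>S. cov_deriv \<omega> (L u) (cov_deriv \<omega> (L u) f) x)"
proof -
  have Le: "L e = (\<Sum>u\<in>S. (e \<bullet> u) *\<^sub>R L u)" for e
    using arg_cong[OF expand[of e], of L] L by (simp add: linear_sum linear_cmul)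
  have n: "cov_deriv \<omega> (L e) g = (\<lambda>x. \<Sum>u\<in>S. of_real (e \<bullet> u) * cov_deriv \<omega> (L u) g x)"
      if "smooth_fun g" for e g
    by (rule ext) (simp only: Le[of e] cov_deriv_vec_sum[OF that S])
  have "cov_deriv \<omega> (L e) (cov_deriv \<omega> (L e) f) x
      = (\<Sum>u\<in>S. \<Sum>v\<in>S. of_real ((e \<bullet> u) * (e \<bullet> v)) * cov_deriv \<omega> (L u) (cov_deriv \<omega> (L v) f) x)" for e
  proof -
    have "cov_deriv \<omega> (L e) (cov_deriv \<omega> (L e) f) x
        = (\<Sum>u\<in>S. of_real (e \<bullet> u) * cov_deriv \<omega> (L u) (cov_deriv \<omega> (L e) f) x)"
      by (rule fun_cong[OF n[OF smooth_fun_cov_deriv[OF f]]])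
    also have "\<dots> = (\<Sum>u\<in>S. of_real (e \<bullet> u) * (\<Sum>v\<in>S. of_real (e \<bullet> v) * cov_deriv \<omega> (L u)
        (cov_deriv \<omega> (L v) f) x))"
      unfolding n[OF f, of e] by (simp only: cov_deriv_sum cov_deriv_cmult smooth_fun_mult
          smooth_fun_const smooth_fun_cov_deriv f)
    finally show ?thesis by (simp add: sum_distrib_left mult.assoc)
  qed
  then have "(\<Sum>e\<in>Basis. cov_deriv \<omega> (L e) (cov_deriv \<omega> (L e) f) x) =
      (\<Sum>u\<in>S. \<Sum>v\<in>S. of_real (\<Sum>e\<in>Basis. (e \<bullet> u) * (e \<bullet> v)) * cov_deriv \<omega> (L u) (cov_deriv \<omega> (L v) f) x)"
    by (simp add: sum_distrib_right sum.swap[of _ S Basis] del: of_real_mult)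
  also have "\<dots> = (\<Sum>u\<in>S. \<Sum>v\<in>S. if u = v then cov_deriv \<omega> (L u) (cov_deriv \<omega> (L v) f) x else 0)"
    using ortho by (intro sum.cong refl)
        (auto simp: euclidean_inner[symmetric] inner_commute[of _ "_::'b"])
  finally show ?thesis using S by simp
qed

end

text \<open>The constant \<open>pi\<close> is the \<open>4 * pi\<close> of the central phase, halved
  by the \<open>1 / 2\<close> in the group law and halved again because the bracket is half of a sum
  of cross products in the coordinates \<open>(s, d)\<close>.\<close>

definition cross_form :: "real ^ 3 \<Rightarrow> real ^ 3 \<Rightarrow> real ^ 3 \<Rightarrow> real" where
  "cross_form b x y = pi * (b \<bullet> cross3 x y)"

definition cross_form2 ::
    "real ^ 3 \<Rightarrow> real ^ 3 \<Rightarrow> (real ^ 3) \<times> (real ^ 3) \<Rightarrow> (real ^ 3) \<times> (real ^ 3) \<Rightarrow> real" where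
  "cross_form2 b c x y = cross_form b (fst x) (fst y) + cross_form c (snd x) (snd y)"

interpretation cross_form: magnetic "cross_form b"
proof
  have lin: "linear (cross_form b x)" "linear (\<lambda>x. cross_form b x y)" for x y
    by (auto intro!: linearI simp: cross_form_def cross_add_left cross_add_right cross_mult_left
        cross_mult_right
        inner_add_right algebra_simps)
  then show "bilinear (cross_form b)" by (simp add: bilinear_def)
  show "cross_form b x y = - cross_form b y x" for x y
    unfolding cross_form_def by (subst cross_skew) simp
qed

interpretation cross_form2: magnetic "cross_form2 b c"
proof
  show "bilinear (cross_form2 b c)"
    unfolding bilinear_def by (auto intro!: linearI simp: cross_form2_def cross_form.form_simps
        algebra_simps)
  show "cross_form2 b c x y = - cross_form2 b c y x" for x y
    unfolding cross_form2_def
        using cross_form.skew[of b "fst x" "fst y"] cross_form.skew[of c "snd x" "snd y"] by simp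
qed

lemma cross_form_scale_self: "cross_form b (r *\<^sub>R b) x = 0" "cross_form b x (r *\<^sub>R b) = 0"
  by (simp_all add: cross_form_def cross_mult_left cross_mult_right dot_cross_self)

lemma cross_form_minus: "cross_form (- b) x y = - cross_form b x y"
  by (simp add: cross_form_def)

definition int_vec :: "real ^ 'n::finite \<Rightarrow> bool" where
  "int_vec v \<longleftrightarrow> (\<forall>i. v $ i \<in> \<int>)"

lemma int_vec_Basis: "e \<in> Basis \<Longrightarrow> int_vec e"
  by (auto simp: int_vec_def Basis_vec_def axis_def)

lemma int_vec_cross_form:
  assumes "int_vec b" "int_vec x" "int_vec y"
  obtains n :: int where "cross_form b x y = pi * of_int n"
proof -
  have "b \<bullet> cross3 x y \<in> \<int>"
    using assms by (auto simp: int_vec_def cross3_def inner_vec_def sum_3 intro!: Ints_add Ints_mult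
        Ints_diff)
  then show ?thesis using that by (auto simp: cross_form_def Ints_def)
qed

lemma cis_int_vec_cross_form:
  assumes "int_vec b" "int_vec x" "int_vec y"
  shows "cis (cross_form b x y) = 1 \<or> cis (cross_form b x y) = - 1" "cis (2 * cross_form b x y) = 1"
proof -
  obtain n :: int where n: "cross_form b x y = pi * of_int n" using int_vec_cross_form[OF assms] .
  show "cis (2 * cross_form b x y) = 1" using cis_multiple_2pi[of "of_int n"] by (simp add: n mult_ac)
  then have "(cis (cross_form b x y))\<^sup>2 = 1" by (simp add: power2_eq_square cis_mult)
  then show "cis (cross_form b x y) = 1 \<or> cis (cross_form b x y) = - 1" by (simp add: power2_eq_1_iff)
qed

lemma int_vec_induct:
  fixes v :: "real ^ 'n::finite"
  assumes v: "int_vec v" and zero: "P 0" and add: "\<And>x e. e \<in> Basis \<Longrightarrow> P x \<Longrightarrow> P (x + e)"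
    and diff: "\<And>x e. e \<in> Basis \<Longrightarrow> P x \<Longrightarrow> P (x - e)"
  shows "P v"
proof -
  have step: "P (x + of_int n *\<^sub>R e)" if "e \<in> Basis" "P x" for x e and n :: int
  proof (induction n rule: int_induct[where k = 0])
    case (step1 i)
    then show ?case using add[OF that(1), of "x + of_int i *\<^sub>R e"] by (simp add: algebra_simps)
  next
    case (step2 i)
    then show ?case using diff[OF that(1), of "x + of_int i *\<^sub>R e"] by (simp add: algebra_simps)
  qed (use that in simp)
  have "P (\<Sum>e\<in>S. of_int (n e) *\<^sub>R e)" if "finite S" "S \<subseteq> Basis" for S and n :: "real ^ 'n \<Rightarrow> int"
    using that
  proof (induction S rule: finite_induct)
    case (insert a S)
    then show ?case using step[of a "\<Sum>e\<in>S. of_int (n e) *\<^sub>R e" "n a"] by (simp add: add.commute)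
  qed (use zero in simp)
  from this[OF finite_Basis order_refl, of "\<lambda>e. \<lfloor>v \<bullet> e\<rfloor>"]
  have "P (\<Sum>e\<in>Basis. of_int \<lfloor>v \<bullet> e\<rfloor> *\<^sub>R e)" .
  also have "(\<Sum>e\<in>Basis. of_int \<lfloor>v \<bullet> e\<rfloor> *\<^sub>R e) = (\<Sum>e\<in>Basis. (v \<bullet> e) *\<^sub>R e)"
  proof (intro sum.cong refl)
    fix e :: "real ^ 'n" assume "e \<in> Basis"
    then have "v \<bullet> e \<in> \<int>" using v by (auto simp: int_vec_def Basis_vec_def inner_axis)
    then show "of_int \<lfloor>v \<bullet> e\<rfloor> *\<^sub>R e = (v \<bullet> e) *\<^sub>R e" by (auto elim: Ints_cases)
  qed
  finally show ?thesis by (simp add: euclidean_representation)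
qed

text \<open>Composing magnetic translations by integral vectors produces only the factors
  \<open>1\<close> and \<open>- 1\<close>, so translation by \<open>b\<close> acts on
  \<open>\<phi>\<close> by a sign. As \<open>b\<close> is null for its own form, that translation is
  an ordinary shift, and its square is the shift by \<open>2 *\<^sub>R b\<close>.\<close>

lemma quasi_periodic_2b:
  assumes b: "int_vec b" and \<xi>: "\<And>e. e \<in> Basis \<Longrightarrow> \<xi> e = 1 \<or> \<xi> e = (- 1 :: real)"
    and T: "\<And>e. e \<in> Basis \<Longrightarrow> mag_transl (cross_form b) e \<phi> = (\<lambda>x. of_real (\<xi> e) * \<phi> x)"
  shows "\<phi> (s + 2 *\<^sub>R b) = \<phi> s"
proof -
  define P where "P m \<longleftrightarrow> int_vec m \<and> (\<exists>\<epsilon>. (\<epsilon> = 1 \<or> \<epsilon> = - 1) \<and> mag_transl (cross_form b) m \<phi>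
      = (\<lambda>x. \<epsilon> * \<phi> x))" for m
  have step: "P (m + d)" if m: "P m" and d: "int_vec d" and r: "r = 1 \<or> r = - 1"
      and Td: "mag_transl (cross_form b) d \<phi> = (\<lambda>x. r * \<phi> x)" for m d r
  proof -
    from m obtain \<epsilon> where \<epsilon>: "int_vec m" "\<epsilon> = 1 \<or> \<epsilon> = - 1"
        "mag_transl (cross_form b) m \<phi> = (\<lambda>x. \<epsilon> * \<phi> x)"
      unfolding P_def by blast
    define z where "z = cis (cross_form b d m)"
    have z: "z = 1 \<or> z = - 1" unfolding z_def by (rule cis_int_vec_cross_form(1)[OF b d \<epsilon>(1)])
    have "mag_transl (cross_form b) m (mag_transl (cross_form b) d \<phi>) x
        = z * mag_transl (cross_form b) (m + d) \<phi> x" for x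
      unfolding z_def by (rule cross_form.mag_transl_mag_transl)
    moreover have "mag_transl (cross_form b) m (mag_transl (cross_form b) d \<phi>) = (\<lambda>x. r * (\<epsilon> * \<phi> x))"
      by (simp only: Td cross_form.mag_transl_cmult \<epsilon>(3))
    ultimately have e: "z * mag_transl (cross_form b) (m + d) \<phi> x = r * (\<epsilon> * \<phi> x)" for x
        by (simp only: fun_eq_iff)
    have "mag_transl (cross_form b) (m + d) \<phi> x = (z * r * \<epsilon>) * \<phi> x" for x
    proof -
      have "mag_transl (cross_form b) (m + d) \<phi> x = z * (z * mag_transl (cross_form b) (m + d) \<phi> x)"
        using z by (auto simp flip: mult.assoc)
      then show ?thesis by (simp only: e mult.assoc)
    qed
    moreover have "z * r * \<epsilon> = 1 \<or> z * r * \<epsilon> = - 1" using z r \<epsilon>(2) by auto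
    moreover have "int_vec (m + d)" using \<epsilon>(1) d by (auto simp: int_vec_def)
    ultimately show ?thesis unfolding P_def by blast
  qed
  have "P b"
  proof (rule int_vec_induct[OF b])
    show "P 0" unfolding P_def by (auto simp: int_vec_def mag_transl_def cross_form.form_simps)
    fix x e :: "real ^ 3" assume e: "e \<in> Basis" and x: "P x"
    define r where "r = complex_of_real (\<xi> e)"
    have r: "r = 1 \<or> r = - 1" using \<xi>[OF e] by (auto simp: r_def)
    show "P (x + e)" by (rule step[OF x int_vec_Basis[OF e] r]) (simp add: T[OF e] r_def)
    have me: "int_vec (- e)" using int_vec_Basis[OF e] by (auto simp: int_vec_def)
    have "mag_transl (cross_form b) (- e) (mag_transl (cross_form b) e \<phi>) = \<phi>"
      by (rule ext) (simp add: cross_form.mag_transl_mag_transl cross_form.form_simps, simp add: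
          mag_transl_def cross_form.form_simps)
    then have "(\<lambda>x. r * mag_transl (cross_form b) (- e) \<phi> x) = \<phi>"
        by (simp only: T[OF e] cross_form.mag_transl_cmult r_def)
    then have "r * mag_transl (cross_form b) (- e) \<phi> x = \<phi> x" for x by (rule fun_cong)
    then have "mag_transl (cross_form b) (- e) \<phi> x = r * \<phi> x" for x
      using r by (metis minus_minus mult_1 mult_minus1)
    then have "mag_transl (cross_form b) (- e) \<phi> = (\<lambda>x. r * \<phi> x)" by (rule ext)
    from step[OF x me r this] show "P (x - e)" by simp
  qed
  then obtain \<epsilon> where \<epsilon>: "\<epsilon> = 1 \<or> \<epsilon> = - 1" "mag_transl (cross_form b) b \<phi> = (\<lambda>x. \<epsilon> * \<phi> x)"
      unfolding P_def by blast
  have "\<phi> (x + b) = \<epsilon> * \<phi> x" for x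
    using fun_cong[OF \<epsilon>(2), of x] cross_form_scale_self(1)[of b 1 x] by (simp add: mag_transl_def)
  from this[of s] this[of "s + b"] \<epsilon>(1) show ?thesis by (auto simp: add.assoc scaleR_2)
qed

text \<open>\<open>u1\<close> is any unit vector orthogonal to \<open>b\<close>, and
  \<open>u2\<close> is its rotation by the cross product with \<open>sgn b\<close>.\<close>

lemma frame_exists:
  fixes b :: "real ^ 3"
  assumes "b \<noteq> 0"
  obtains u1 u2 where "magnetic_plane (cross_form b) u1 u2 (pi * norm b)" "u1 \<bullet> b = 0" "u2 \<bullet> b = 0"
    "\<And>x. x = (x \<bullet> u1) *\<^sub>R u1 + (x \<bullet> u2) *\<^sub>R u2 + (x \<bullet> sgn b) *\<^sub>R sgn b"
proof -
  obtain y where y: "y \<noteq> 0" "orthogonal b y"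
    by (rule orthogonal_to_vector_exists[of b]) auto
  define u1 where "u1 = sgn y"
  define n where "n = sgn b"
  define u2 where "u2 = cross3 n u1"
  have n: "n \<bullet> n = 1" "b = norm b *\<^sub>R n" using assms
      by (simp_all add: n_def dot_square_norm norm_sgn sgn_div_norm)
  have u1: "u1 \<bullet> u1 = 1" using y(1) by (simp add: u1_def dot_square_norm norm_sgn)
  have u1n: "u1 \<bullet> n = 0" using y(2)
      by (simp add: u1_def n_def sgn_div_norm orthogonal_def inner_commute)
  have u2n: "u2 \<bullet> n = 0" "u1 \<bullet> u2 = 0" by (simp_all add: u2_def dot_cross_self)
  have cc: "cross3 u2 n = u1"
  proof -
    have "cross3 (cross3 n u1) n = (n \<bullet> n) *\<^sub>R u1 - (u1 \<bullet> n) *\<^sub>R n"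
      by (simp add: cross3_simps forall_3)
    then show ?thesis using n(1) u1n by (simp add: u2_def)
  qed
  have "u2 \<bullet> u2 = (n \<bullet> n) * (u1 \<bullet> u1) - (u1 \<bullet> n)\<^sup>2"
    unfolding u2_def by (simp add: cross3_simps power2_eq_square)
  then have u2: "u2 \<bullet> u2 = 1" using n(1) u1 u1n by simp
  have triple: "x \<bullet> cross3 y z = z \<bullet> cross3 x y" for x y z :: "real ^ 3"
    by (simp add: cross3_simps)
  have "magnetic_plane (cross_form b) u1 u2 (pi * norm b)"
  proof
    fix x :: "real ^ 3"
    have "b \<bullet> cross3 x u1 = norm b * (n \<bullet> cross3 x u1)" by (subst n(2)) simp
    also have "n \<bullet> cross3 x u1 = u1 \<bullet> cross3 n x" by (rule triple)
    also have "\<dots> = - (x \<bullet> u2)" unfolding u2_def by (simp add: cross3_simps)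
    finally show "cross_form b x u1 = - (pi * norm b) * (x \<bullet> u2)" by (simp add: cross_form_def)
    have "b \<bullet> cross3 x u2 = norm b * (n \<bullet> cross3 x u2)" by (subst n(2)) simp
    also have "n \<bullet> cross3 x u2 = x \<bullet> cross3 u2 n" by (simp add: cross3_simps)
    finally show "cross_form b x u2 = pi * norm b * (x \<bullet> u1)" by (simp add: cross_form_def cc)
  qed (use u1 u2 u2n assms in auto)
  moreover have "x = (x \<bullet> u1) *\<^sub>R u1 + (x \<bullet> u2) *\<^sub>R u2 + (x \<bullet> n) *\<^sub>R n" for x
  proof -
    have ne: "u1 \<noteq> u2" "u1 \<noteq> n" "u2 \<noteq> n" using u1 u2 n(1) u1n u2n by auto
    have po: "pairwise orthogonal {u1, u2, n}"
      using u1n u2n by (auto simp: pairwise_def orthogonal_def inner_commute)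
    have nz: "0 \<notin> {u1, u2, n}" using u1 u2 n(1) by auto
    have "independent {u1, u2, n}" by (rule pairwise_orthogonal_independent[OF po nz])
    moreover have "card {u1, u2, n} = DIM(real ^ 3)" using ne by simp
    ultimately have "span {u1, u2, n} = UNIV"
      by (metis card_eq_dim dim_UNIV finite.emptyI finite.insertI subset_UNIV top.extremum_uniqueI)
    then have "(\<Sum>i\<in>{u1, u2, n}. (x \<bullet> i) *\<^sub>R i) = x"
      using u1 u2 n(1) by (intro orthonormal_basis_expand po) (auto simp: norm_eq_sqrt_inner)
    then show ?thesis using ne by (simp add: add.assoc)
  qed
  moreover have "u1 \<bullet> b = 0" "u2 \<bullet> b = 0" using u1n u2n by (subst n(2), simp)+
  ultimately show ?thesis using that unfolding n_def by blast
qed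

section \<open>Eigenspaces of quasi-periodic functions\<close>

lemma subspace_kernel:
  assumes sub: "cfun.subspace W" and lin: "linear_on W A"
  shows "cfun.subspace {f \<in> W. A f = 0}"
proof (rule cfun.subspaceI)
  show "0 \<in> {f \<in> W. A f = 0}"
    using cfun.subspace_0[OF sub] linear_on_zero[OF lin sub] by blast
  show "f + g \<in> {f \<in> W. A f = 0}" if "f \<in> {f \<in> W. A f = 0}" "g \<in> {f \<in> W. A f = 0}" for f g
  proof -
    from that have a: "f \<in> W" "g \<in> W" "A f = 0" "A g = 0" by auto
    have "A (f + g) = 0" by (simp only: linear_onD(1)[OF lin a(1,2)] a(3,4) add_0_left)
    then show ?thesis using cfun.subspace_add[OF sub a(1,2)] by blast
  qed
  show "(\<lambda>x. c * f x) \<in> {f \<in> W. A f = 0}" if "f \<in> {f \<in> W. A f = 0}" for c f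
  proof -
    from that have a: "f \<in> W" "A f = 0" by auto
    have "A (\<lambda>x. c * f x) = 0" by (simp only: linear_onD(2)[OF lin a(1)] a(2)) (simp add: fun_eq_iff)
    then show ?thesis using cfun.subspace_scale[OF sub a(1)] by blast
  qed
qed

text \<open>
  A pair \<open>(m, \<theta>)\<close> in \<open>\<M>\<close> demands quasi-periodicity under \<open>m\<close> with factor \<open>\<theta>\<close>. A continuous family of
  translations expresses a Fourier mode.
\<close>

definition mag_eig :: "('a \<Rightarrow> 'a \<Rightarrow> real) \<Rightarrow> ('a \<times> complex) set \<Rightarrow> complex \<Rightarrow>
    ('a::euclidean_space \<Rightarrow> complex) set" where
  "mag_eig \<omega> \<M> \<kappa> = {f. smooth_fun f \<and> (\<forall>(m, \<theta>)\<in>\<M>. mag_transl \<omega> m f = (\<lambda>x. \<theta> * f x)) \<and> mag_lap \<omega> f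
      = (\<lambda>x. \<kappa> * f x)}"

lemma twsD:
  assumes "f \<in> mag_eig \<omega> \<M> \<kappa>"
  shows "smooth_fun f" "(m, \<theta>) \<in> \<M> \<Longrightarrow> mag_transl \<omega> m f = (\<lambda>x. \<theta> * f x)" "mag_lap \<omega> f = (\<lambda>x. \<kappa> * f x)"
  using assms by (auto simp: mag_eig_def)

lemma twsI:
  "smooth_fun f \<Longrightarrow> (\<And>m \<theta>. (m, \<theta>) \<in> \<M> \<Longrightarrow> mag_transl \<omega> m f = (\<lambda>x. \<theta> * f x)) \<Longrightarrow> mag_lap \<omega> f
      = (\<lambda>x. \<kappa> * f x) \<Longrightarrow> f \<in> mag_eig \<omega> \<M> \<kappa>"
  by (auto simp: mag_eig_def)

lemma mag_eig_Un: "f \<in> mag_eig \<omega> (\<M> \<union> \<N>) \<kappa> \<longleftrightarrow> f \<in> mag_eig \<omega> \<M> \<kappa>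
    \<and> (\<forall>(m, \<theta>)\<in>\<N>. mag_transl \<omega> m f = (\<lambda>x. \<theta> * f x))"
  by (auto simp: mag_eig_def)

lemma linear_on_smooth_fun:
  assumes "\<And>f g. smooth_fun f \<Longrightarrow> smooth_fun g \<Longrightarrow> A (\<lambda>x. f x + g x) = (\<lambda>x. A f x + A g x)"
    and "\<And>c f. smooth_fun f \<Longrightarrow> A (\<lambda>x. c * f x) = (\<lambda>x. c * A f x)"
  shows "linear_on (Collect smooth_fun) A"
  using assms by (simp add: linear_on_def plus_fun_def)

lemma linear_on_mag_eig: "linear_on (Collect smooth_fun) A \<Longrightarrow> linear_on (mag_eig \<omega> \<M> \<kappa>) A"
  by (erule linear_on_mono) (auto simp: mag_eig_def)

context magnetic
begin

lemma subspace_mag_eig: "cfun.subspace (mag_eig \<omega> \<M> \<kappa>)"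
proof (rule cfun.subspaceI)
  have z: "smooth_fun (\<lambda>x::'a. 0::complex)" by (rule smooth_fun_const)
  have "mag_lap \<omega> (\<lambda>x. 0 * (0::complex)) = (\<lambda>x. 0 * mag_lap \<omega> (\<lambda>x. 0) x)" by (rule mag_lap_cmult[OF z])
  then show "0 \<in> mag_eig \<omega> \<M> \<kappa>"
    unfolding zero_fun_def by (intro twsI z) (simp_all add: mag_transl_def)
  show "f + g \<in> mag_eig \<omega> \<M> \<kappa>" if f: "f \<in> mag_eig \<omega> \<M> \<kappa>" and g: "g \<in> mag_eig \<omega> \<M> \<kappa>" for f g
    unfolding plus_fun_def
    by (intro twsI smooth_fun_add twsD(1)[OF f] twsD(1)[OF g])
      (simp_all add: mag_transl_add mag_lap_add twsD[OF f] twsD[OF g] distrib_left)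
  show "(\<lambda>x. c * f x) \<in> mag_eig \<omega> \<M> \<kappa>" if f: "f \<in> mag_eig \<omega> \<M> \<kappa>" for c f
    by (intro twsI smooth_fun_mult smooth_fun_const twsD(1)[OF f])
      (simp_all add: mag_transl_cmult mag_lap_cmult twsD[OF f] mult.left_commute)
qed

text \<open>The factors have modulus one, so \<open>|f|\<close> is periodic under the standard basis
  and attains its maximum. If it were nonzero, the maximum principle would give
  \<open>0 \<le> Re \<kappa>\<close>.\<close>

lemma mag_eig_zero_if_neg:
  assumes f: "f \<in> mag_eig \<omega> \<M> \<kappa>" and bas: "\<And>e. e \<in> Basis \<Longrightarrow> \<exists>\<theta>. norm \<theta> = 1 \<and> (e, \<theta>) \<in> \<M>"
    and neg: "Re \<kappa> < 0"
  shows "f x = 0"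
proof -
  have per: "norm (f (x + e)) = norm (f x)" if "e \<in> Basis" for e x
  proof -
    obtain \<theta> where \<theta>: "norm \<theta> = 1" "(e, \<theta>) \<in> \<M>" using bas[OF \<open>e \<in> Basis\<close>] by blast
    have "norm (cis (\<omega> e x) * f (x + e)) = norm (\<theta> * f x)"
      using fun_cong[OF twsD(2)[OF f \<theta>(2)], of x] by (simp add: mag_transl_def)
    then show ?thesis using \<theta>(1) by (simp add: norm_mult)
  qed
  have "continuous_on UNIV (\<lambda>x. norm (f x))"
      by (intro continuous_on_norm smooth_fun_continuous[of f] twsD(1)[OF f])
  then obtain x0 where x0: "\<And>x. norm (f x) \<le> norm (f x0)"
    by (rule periodic_attains_max) (use per in auto)
  have "f x0 = 0"
    using mag_lap_eigenvalue_nonneg[OF twsD(1)[OF f] fun_cong[OF twsD(3)[OF f]] x0] neg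
        by (meson not_le)
  then show ?thesis using x0[of x] by simp
qed

lemma mag_eig_fourier_proj:
  assumes f: "f \<in> mag_eig \<omega> \<M> \<kappa>" and w: "\<And>u. \<omega> w u = 0"
  shows "fourier_proj w n f \<in> mag_eig \<omega> \<M> \<kappa>"
proof (rule twsI)
  show "smooth_fun (fourier_proj w n f)" by (rule smooth_fun_fourier_proj[OF twsD(1)[OF f]])
  show "mag_transl \<omega> m (fourier_proj w n f) = (\<lambda>x. \<theta> * fourier_proj w n f x)" if "(m, \<theta>) \<in> \<M>" for m \<theta>
    unfolding fourier_proj_mag_transl[OF w] twsD(2)[OF f that] by (rule ext) (rule fourier_proj_cmult)
  show "mag_lap \<omega> (fourier_proj w n f) = (\<lambda>x. \<kappa> * fourier_proj w n f x)"
    unfolding fourier_proj_mag_lap[OF twsD(1)[OF f] w] twsD(3)[OF f]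
        by (rule ext) (rule fourier_proj_cmult)
qed

end

context magnetic_plane
begin

lemma linear_on_lower: "linear_on (mag_eig \<omega> \<M> \<kappa>) lower"
    and linear_on_raise: "linear_on (mag_eig \<omega> \<M> \<kappa>) raise"
  by (intro linear_on_mag_eig linear_on_smooth_fun lower_linear raise_linear; assumption)+

lemma lower_mag_eig:
  assumes f: "f \<in> mag_eig \<omega> \<M> \<kappa>"
  shows "lower f \<in> mag_eig \<omega> \<M> (\<kappa> - 4 * of_real \<beta>)"
proof (rule twsI)
  show "smooth_fun (lower f)" by (rule smooth_fun_lower[OF twsD(1)[OF f]])
  show "mag_transl \<omega> m (lower f) = (\<lambda>x. \<theta> * lower f x)" if "(m, \<theta>) \<in> \<M>" for m \<theta>
    unfolding lower_mag_transl[OF twsD(1)[OF f], symmetric] twsD(2)[OF f that]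
        by (rule lower_linear(2)[OF twsD(1)[OF f]])
  show "mag_lap \<omega> (lower f) = (\<lambda>x. (\<kappa> - 4 * of_real \<beta>) * lower f x)"
    by (rule ext, subst mag_lap_lower[OF twsD(1)[OF f]])
      (simp only: twsD(3)[OF f] lower_linear(2)[OF twsD(1)[OF f]] left_diff_distrib)
qed

lemma raise_mag_eig:
  assumes f: "f \<in> mag_eig \<omega> \<M> \<kappa>"
  shows "raise f \<in> mag_eig \<omega> \<M> (\<kappa> + 4 * of_real \<beta>)"
proof (rule twsI)
  show "smooth_fun (raise f)" by (rule smooth_fun_raise[OF twsD(1)[OF f]])
  show "mag_transl \<omega> m (raise f) = (\<lambda>x. \<theta> * raise f x)" if "(m, \<theta>) \<in> \<M>" for m \<theta>
    unfolding raise_mag_transl[OF twsD(1)[OF f], symmetric] twsD(2)[OF f that]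
        by (rule raise_linear(2)[OF twsD(1)[OF f]])
  show "mag_lap \<omega> (raise f) = (\<lambda>x. (\<kappa> + 4 * of_real \<beta>) * raise f x)"
    by (rule ext, subst mag_lap_raise[OF twsD(1)[OF f]])
      (simp only: twsD(3)[OF f] raise_linear(2)[OF twsD(1)[OF f]] distrib_right)
qed

text \<open>Each application lowers the eigenvalue by \<open>4 * \<beta>\<close>; once its real part
  is negative, the eigenspace is zero.\<close>

lemma lower_nilpotent:
  assumes f: "f \<in> mag_eig \<omega> \<M> \<kappa>" and bas: "\<And>e. e \<in> Basis \<Longrightarrow> \<exists>\<theta>. norm \<theta> = 1 \<and> (e, \<theta>) \<in> \<M>"
  shows "\<exists>k. (lower ^^ k) f = 0"
proof -
  have *: "(lower ^^ k) f \<in> mag_eig \<omega> \<M> (\<kappa> - of_nat k * (4 * of_real \<beta>))" for k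
  proof (induction k)
    case (Suc k)
    then show ?case using lower_mag_eig[OF Suc] by (simp add: algebra_simps)
  qed (use f in simp)
  obtain k :: nat where k: "Re \<kappa> < of_nat k * (4 * \<beta>)"
    using pos ex_less_of_nat_mult[of "4 * \<beta>" "Re \<kappa>"] by auto
  have "(lower ^^ k) f x = 0" for x
    by (rule mag_eig_zero_if_neg[OF * bas]) (use k in simp_all)
  then show ?thesis by (auto simp: fun_eq_iff)
qed

lemma mag_eig_ladder:
  assumes f: "f \<in> mag_eig \<omega> \<M> \<kappa>" and bas: "\<And>e. e \<in> Basis \<Longrightarrow> \<exists>\<theta>. norm \<theta> = 1 \<and> (e, \<theta>) \<in> \<M>"
  shows "f \<in> cfun.span {h \<in> mag_eig \<omega> \<M> \<kappa>. \<exists>j::nat. raise (lower h)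
      = (\<lambda>x. (of_nat j * (4 * of_real \<beta>)) * h x)}"
proof -
  obtain k where k: "(lower ^^ k) f = 0" using lower_nilpotent[OF assms] by blast
  show ?thesis
  proof (rule ladder_decomposition[where X = "mag_eig \<omega> \<M>", OF subspace_mag_eig linear_on_lower
      linear_on_raise lower_mag_eig raise_mag_eig _ _ f k])
    show "lower (raise g) = raise (lower g) + (\<lambda>x. 4 * of_real \<beta> * g x)" if "g \<in> mag_eig \<omega> \<M> \<nu>" for g \<nu>
      by (rule ext) (simp only: plus_fun_def lower_raise[OF twsD(1)[OF that]])
  qed (use pos in \<open>auto simp: complex_eq_iff\<close>)
qed

end

text \<open>Signs under the basis vectors together with the \<open>n\<close>-th Fourier mode along
  the null direction \<open>b\<close>; the period is \<open>2 *\<^sub>R b\<close> by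
  \<open>quasi_periodic_2b\<close>.\<close>

definition slice_conds :: "real ^ 3 \<Rightarrow> (real ^ 3 \<Rightarrow> real) \<Rightarrow> int \<Rightarrow> ((real ^ 3) \<times> complex) set" where
  "slice_conds b \<xi> n = (\<lambda>e. (e, of_real (\<xi> e))) ` Basis \<union>
     range (\<lambda>t. (t *\<^sub>R (2 *\<^sub>R b), cis (2 * pi * of_int n * t)))"

definition signs :: "(real ^ 3 \<Rightarrow> real) \<Rightarrow> bool" where
  "signs \<xi> \<longleftrightarrow> (\<forall>e. \<xi> e = 1 \<or> \<xi> e = - 1)"

lemma norm_signs: "signs \<xi> \<Longrightarrow> norm (complex_of_real (\<xi> e)) = 1"
  unfolding signs_def by (metis abs_minus_cancel abs_one norm_of_real)

lemma slice_mode: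
  assumes "f \<in> mag_eig (cross_form b) (slice_conds b \<xi> n) \<mu>"
  shows "f (s + t *\<^sub>R (2 *\<^sub>R b)) = cis (2 * pi * of_int n * t) * f s"
proof -
  have "(t *\<^sub>R (2 *\<^sub>R b), cis (2 * pi * of_int n * t)) \<in> slice_conds b \<xi> n"
    by (auto simp: slice_conds_def)
  from fun_cong[OF twsD(2)[OF assms this], of s] show ?thesis
    using cross_form_scale_self(1)[of b "t * 2" s] by (simp add: mag_transl_def)
qed

lemma slice_bas: "signs \<xi> \<Longrightarrow> e \<in> Basis \<Longrightarrow> \<exists>\<theta>. norm \<theta> = 1 \<and> (e, \<theta>) \<in> slice_conds b \<xi> n"
  by (intro exI[of _ "of_real (\<xi> e)"] conjI norm_signs) (simp_all add: slice_conds_def)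

text \<open>Induction on the number of steps of size \<open>4 * pi * norm b\<close> that bring
  \<open>Re \<mu>\<close> below zero. \<open>lower\<close> maps the space to the one a step lower,
  and its kernel is finite-dimensional: the mode along \<open>b\<close> determines a function from
  its values on the plane of \<open>u1\<close> and \<open>u2\<close>, where the kernel consists of
  weighted entire functions.\<close>

lemma slice_space_finite:
  assumes b: "b \<noteq> 0" and \<xi>: "signs \<xi>"
  shows "mdim (mag_eig (cross_form b) (slice_conds b \<xi> n) \<mu>) \<noteq> \<infinity>"
proof -
  obtain u1 u2 where fr: "magnetic_plane (cross_form b) u1 u2 (pi * norm b)" "u1 \<bullet> b = 0" "u2 \<bullet> b = 0"
    "\<And>x. x = (x \<bullet> u1) *\<^sub>R u1 + (x \<bullet> u2) *\<^sub>R u2 + (x \<bullet> sgn b) *\<^sub>R sgn b"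
    using frame_exists[OF b] by blast
  interpret P: magnetic_plane "cross_form b" u1 u2 "pi * norm b" by (rule fr(1))
  let ?S = "\<lambda>\<mu>. mag_eig (cross_form b) (slice_conds b \<xi> n) \<mu>"
  obtain r where r: "r > 0" "\<And>x. x \<in> cbox 0 (One :: real ^ 3) \<Longrightarrow> norm x \<le> r"
    using bounded_cbox[of 0 "One :: real ^ 3"] unfolding bounded_pos by auto
  have ker: "mdim {f \<in> ?S \<mu>. P.lower f = 0} \<noteq> \<infinity>" for \<mu>
  proof (rule P.lower_kernel_finite[where r = r])
    show "cfun.subspace {f \<in> ?S \<mu>. P.lower f = 0}"
      by (rule subspace_kernel[OF cross_form.subspace_mag_eig P.linear_on_lower])
    show "0 < r" by (rule r)
    fix f assume f: "f \<in> {f \<in> ?S \<mu>. P.lower f = 0}"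
    then show "smooth_fun f" "P.lower f = 0" using twsD(1) by auto
    from f have fS: "f \<in> ?S \<mu>" by simp
    have per: "norm (f (x + e)) = norm (f x)" if e: "e \<in> Basis" for e x
    proof -
      have "(e, of_real (\<xi> e)) \<in> slice_conds b \<xi> n" using e by (simp add: slice_conds_def)
      then have "norm (cis (cross_form b e x) * f (x + e)) = norm (of_real (\<xi> e) * f x)"
        using fun_cong[OF twsD(2)[OF fS], of e _ x] by (simp add: mag_transl_def)
      then show ?thesis using norm_signs[OF \<xi>, of e] by (simp add: norm_mult)
    qed
    have "continuous_on UNIV (\<lambda>x. norm (f x))"
        by (intro continuous_on_norm smooth_fun_continuous[of f] twsD(1)[OF fS])
    then obtain x0 where x0: "x0 \<in> cbox 0 One" "\<And>x. norm (f x) \<le> norm (f x0)"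
      by (rule periodic_attains_max) (use per in auto)
    \<comment> \<open>The maximum point is moved along \<open>b\<close> into the plane of
      \<open>u1, u2\<close>, which changes \<open>f\<close> only by the phase of its Fourier mode.
      The minus sign matches the one in \<open>plane_pt\<close>.\<close>
    define z where "z = Complex (x0 \<bullet> u1) (- (x0 \<bullet> u2))"
    have zs: "P.plane_pt z = (x0 \<bullet> u1) *\<^sub>R u1 + (x0 \<bullet> u2) *\<^sub>R u2"
      by (simp add: P.plane_pt_def z_def)
    have "r *\<^sub>R sgn b = (r / (2 * norm b)) *\<^sub>R (2 *\<^sub>R b)" for r
      unfolding sgn_div_norm scaleR_scaleR
          by (rule arg_cong[where f = "\<lambda>a. a *\<^sub>R b"]) (simp add: field_simps)
    then have "(x0 \<bullet> sgn b) *\<^sub>R sgn b = ((x0 \<bullet> sgn b) / (2 * norm b)) *\<^sub>R (2 *\<^sub>R b)" .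
    then have "x0 = P.plane_pt z + ((x0 \<bullet> sgn b) / (2 * norm b)) *\<^sub>R (2 *\<^sub>R b)"
      unfolding zs by (rule subst) (rule fr(4))
    from arg_cong[OF this, of f] have "norm (f x0) = norm (f (P.plane_pt z))"
      using slice_mode[OF fS, of "P.plane_pt z" "(x0 \<bullet> sgn b) / (2 * norm b)"] by (simp add: norm_mult)
    moreover have "norm z \<le> r"
    proof -
      have "x0 \<bullet> x0 = (x0 \<bullet> u1)\<^sup>2 + (x0 \<bullet> u2)\<^sup>2 + (x0 \<bullet> sgn b)\<^sup>2"
        using arg_cong[OF fr(4)[of x0], of "\<lambda>y. x0 \<bullet> y"] by (simp add: inner_add_right power2_eq_square)
      then have "(norm z)\<^sup>2 \<le> (norm x0)\<^sup>2"
        unfolding cmod_power2 by (simp add: z_def dot_square_norm)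
      then have "norm z \<le> norm x0" by (rule power2_le_imp_le) simp
      then show ?thesis using r(2)[OF x0(1)] by simp
    qed
    ultimately show "\<exists>z. norm z \<le> r \<and> (\<forall>x. norm (f x) \<le> norm (f (P.plane_pt z)))"
      using x0(2) by metis
  qed
  have "mdim (?S \<mu>) \<noteq> \<infinity>" if "Re \<mu> < of_nat k * (4 * (pi * norm b))" for k \<mu>
    using that
  proof (induction k arbitrary: \<mu>)
    case 0
    have "?S \<mu> \<subseteq> cfun.span {}"
    proof
      fix f assume "f \<in> ?S \<mu>"
      from cross_form.mag_eig_zero_if_neg[OF this slice_bas[OF \<xi>]] 0 have "f = 0"
          by (auto simp: fun_eq_iff)
      then show "f \<in> cfun.span {}" by (simp only: cfun.span_zero)
    qed
    then show ?case unfolding mdim_finite_iff by blast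
  next
    case (Suc k)
    show ?case
    proof (rule mdim_finite_kernel_image[OF cross_form.subspace_mag_eig P.linear_on_lower ker])
      have "mdim (?S (\<mu> - 4 * of_real (pi * norm b))) \<noteq> \<infinity>"
        by (rule Suc.IH) (use Suc.prems in \<open>simp add: algebra_simps\<close>)
      then show "mdim (P.lower ` ?S \<mu>) \<noteq> \<infinity>"
        by (rule mdim_finite_subset) (use P.lower_mag_eig in blast)
    qed
  qed
  moreover obtain k :: nat where "Re \<mu> < of_nat k * (4 * (pi * norm b))"
    using P.pos ex_less_of_nat_mult[of "4 * (pi * norm b)" "Re \<mu>"] by auto
  ultimately show ?thesis by blast
qed

section \<open>Separation of the two \<open>real ^ 3\<close> factors\<close>

definition fst_lap :: "real ^ 3 \<Rightarrow> real ^ 3 \<Rightarrow> ((real ^ 3) \<times> (real ^ 3) \<Rightarrow> complex) \<Rightarrow> (real ^ 3) \<times>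
    (real ^ 3) \<Rightarrow> complex" where
  "fst_lap b c f = (\<lambda>x. - (\<Sum>e\<in>Basis. cov_deriv (cross_form2 b c) (e, 0)
      (cov_deriv (cross_form2 b c) (e, 0) f) x))"

lemma smooth_fun_slice:
  fixes f :: "(real ^ 3) \<times> (real ^ 3) \<Rightarrow> complex"
  assumes "smooth_fun f"
  shows "smooth_fun (\<lambda>s. f (s, d))" "smooth_fun (\<lambda>d. f (s, d))"
proof -
  have "bounded_linear (\<lambda>s::real ^ 3. (s, 0::real ^ 3))"
      "bounded_linear (\<lambda>d::real ^ 3. (0::real ^ 3, d))"
    by (intro bounded_linear_Pair bounded_linear_ident bounded_linear_zero)+
  from smooth_fun_affine[OF this(1) assms, of "(0, d)"] smooth_fun_affine[OF this(2) assms, of "(s, 0)"]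
  show "smooth_fun (\<lambda>s. f (s, d))" "smooth_fun (\<lambda>d. f (s, d))" by simp_all
qed

lemma cov_deriv_slice:
  assumes "smooth_fun f"
  shows "cov_deriv (cross_form2 b c) (u, 0) f (s, d) = cov_deriv (cross_form b) u (\<lambda>s. f (s, d)) s"
    and "cov_deriv (cross_form2 b c) (0, u) f (s, d) = cov_deriv (cross_form c) u (\<lambda>d. f (s, d)) d"
proof -
  have bl: "bounded_linear (\<lambda>s::real ^ 3. (s, 0::real ^ 3))"
      "bounded_linear (\<lambda>d::real ^ 3. (0::real ^ 3, d))"
    by (intro bounded_linear_Pair bounded_linear_ident bounded_linear_zero)+
  have "dir_deriv u (\<lambda>s. f (s, d)) s = dir_deriv (u, 0) f (s, d)"
    using dir_deriv_affine[OF bl(1) smooth_fun_differentiable[OF assms], of u "(0, d)" s] by simp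
  moreover have "dir_deriv u (\<lambda>d. f (s, d)) d = dir_deriv (0, u) f (s, d)"
    using dir_deriv_affine[OF bl(2) smooth_fun_differentiable[OF assms], of u "(s, 0)" d] by simp
  ultimately show "cov_deriv (cross_form2 b c) (u, 0) f (s, d) = cov_deriv (cross_form b) u
      (\<lambda>s. f (s, d)) s"
    "cov_deriv (cross_form2 b c) (0, u) f (s, d) = cov_deriv (cross_form c) u (\<lambda>d. f (s, d)) d"
    by (simp_all add: cov_deriv_def cross_form2_def cross_form.form_simps)
qed

lemma mag_transl_slice:
  "mag_transl (cross_form2 b c) (m, 0) f (s, d) = mag_transl (cross_form b) m (\<lambda>s. f (s, d)) s"
  "mag_transl (cross_form2 b c) (0, m) f (s, d) = mag_transl (cross_form c) m (\<lambda>d. f (s, d)) d"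
  by (simp_all add: mag_transl_def cross_form2_def cross_form.form_simps)

lemma fst_lap_slice:
  assumes "smooth_fun f"
  shows "fst_lap b c f (s, d) = mag_lap (cross_form b) (\<lambda>s. f (s, d)) s"
  unfolding fst_lap_def mag_lap_def
      by (simp only: cov_deriv_slice[OF cross_form2.smooth_fun_cov_deriv[OF assms]]
      cov_deriv_slice[OF assms])

lemma sum_Basis_prod:
  fixes g :: "'a::euclidean_space \<times> 'b::euclidean_space \<Rightarrow> 'c::comm_monoid_add"
  shows "sum g Basis = (\<Sum>e\<in>Basis. g (e, 0)) + (\<Sum>e\<in>Basis. g (0, e))"
proof -
  have "inj_on (\<lambda>u. (u::'a, 0::'b)) Basis" "inj_on (\<lambda>u. (0::'a, u::'b)) Basis"
    by (auto intro!: inj_onI)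
  then show ?thesis
    unfolding Basis_prod_def by (subst sum.union_disjoint) (auto simp: sum.reindex)
qed

lemma mag_lap_slice:
  assumes "smooth_fun f"
  shows "mag_lap (cross_form2 b c) f (s, d) = mag_lap (cross_form b) (\<lambda>s. f (s, d)) s
      + mag_lap (cross_form c) (\<lambda>d. f (s, d)) d"
  unfolding mag_lap_def
  by (subst sum_Basis_prod)
      (simp only: minus_add_distrib o_def
      cov_deriv_slice[OF cross_form2.smooth_fun_cov_deriv[OF assms]] cov_deriv_slice[OF assms])

definition conds_s :: "(real ^ 3) set \<Rightarrow> (real ^ 3 \<Rightarrow> real) \<Rightarrow> (((real ^ 3) \<times> (real ^ 3)) \<times> complex)
    set" where
  "conds_s A \<xi> = (\<lambda>e. ((e, 0), of_real (\<xi> e))) ` A"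

definition conds_d :: "(real ^ 3 \<Rightarrow> real) \<Rightarrow> (((real ^ 3) \<times> (real ^ 3)) \<times> complex) set" where
  "conds_d \<xi> = (\<lambda>e. ((0, e), of_real (\<xi> e))) ` Basis"

definition conds_n :: "real ^ 3 \<Rightarrow> int \<Rightarrow> (((real ^ 3) \<times> (real ^ 3)) \<times> complex) set" where
  "conds_n b n = range (\<lambda>t. ((t *\<^sub>R (2 *\<^sub>R b), 0), cis (2 * pi * of_int n * t)))"

text \<open>Lattice invariance on the generators: \<open>qmap\<close> sends the basis vectors
  \<open>X\<close> to \<open>(e, e)\<close> and the basis vectors \<open>Y\<close> to
  \<open>(e, - e)\<close>.\<close>

definition conds_pm :: "(((real ^ 3) \<times> (real ^ 3)) \<times> complex) set" where
  "conds_pm = (\<lambda>e. ((e, e), 1)) ` Basis \<union> (\<lambda>e. ((e, - e), 1)) ` Basis"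

definition basis_conds :: "(real ^ 3 \<Rightarrow> real) \<Rightarrow> ((real ^ 3) \<times> complex) set" where
  "basis_conds \<xi> = (\<lambda>e. (e, of_real (\<xi> e))) ` Basis"

text \<open>Separation of variables. The Laplacian is the sum of one in each variable, so fixing
  \<open>\<mu>\<close> in \<open>s\<close> fixes \<open>\<kappa> - \<mu>\<close> in
  \<open>d\<close>, and every other condition concerns a single variable.\<close>

lemma level_space_iff:
  "f \<in> mag_eig (cross_form2 b c) (conds_s Basis \<xi> \<union> conds_d \<xi> \<union> conds_n b n) \<kappa> \<and> fst_lap b c f
      = (\<lambda>x. \<mu> * f x) \<longleftrightarrow>
   smooth_fun f \<and> (\<forall>d. (\<lambda>s. f (s, d)) \<in> mag_eig (cross_form b) (slice_conds b \<xi> n) \<mu>) \<and>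
     (\<forall>s. (\<lambda>d. f (s, d)) \<in> mag_eig (cross_form c) (basis_conds \<xi>) (\<kappa> - \<mu>))" (is "?L \<longleftrightarrow> ?R")
proof
  assume L: ?L
  then have f: "f \<in> mag_eig (cross_form2 b c) (conds_s Basis \<xi> \<union> conds_d \<xi> \<union> conds_n b n) \<kappa>"
    and fst_lap: "fst_lap b c f = (\<lambda>x. \<mu> * f x)" by auto
  have smf: "smooth_fun f" by (rule twsD(1)[OF f])
  show ?R
  proof (intro conjI allI smf)
    fix d
    show "(\<lambda>s. f (s, d)) \<in> mag_eig (cross_form b) (slice_conds b \<xi> n) \<mu>"
    proof (rule twsI)
      show "smooth_fun (\<lambda>s. f (s, d))" by (rule smooth_fun_slice[OF smf])
      show "mag_transl (cross_form b) m (\<lambda>s. f (s, d)) = (\<lambda>x. \<theta> * f (x, d))"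
          if "(m, \<theta>) \<in> slice_conds b \<xi> n" for m \<theta>
      proof -
        have "((m, 0), \<theta>) \<in> conds_s Basis \<xi> \<union> conds_d \<xi> \<union> conds_n b n"
          using that by (auto simp: slice_conds_def conds_s_def conds_n_def)
        from twsD(2)[OF f this] show ?thesis by (simp add: fun_eq_iff mag_transl_slice)
      qed
      show "mag_lap (cross_form b) (\<lambda>s. f (s, d)) = (\<lambda>x. \<mu> * f (x, d))"
        using fst_lap by (simp add: fun_eq_iff fst_lap_slice[OF smf])
    qed
  next
    fix s
    show "(\<lambda>d. f (s, d)) \<in> mag_eig (cross_form c) (basis_conds \<xi>) (\<kappa> - \<mu>)"
    proof (rule twsI)
      show "smooth_fun (\<lambda>d. f (s, d))" by (rule smooth_fun_slice[OF smf])
      show "mag_transl (cross_form c) m (\<lambda>d. f (s, d)) = (\<lambda>x. \<theta> * f (s, x))"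
          if "(m, \<theta>) \<in> basis_conds \<xi>" for m \<theta>
      proof -
        have "((0, m), \<theta>) \<in> conds_s Basis \<xi> \<union> conds_d \<xi> \<union> conds_n b n"
          using that by (auto simp: basis_conds_def conds_d_def)
        from twsD(2)[OF f this] show ?thesis by (simp add: fun_eq_iff mag_transl_slice)
      qed
      show "mag_lap (cross_form c) (\<lambda>d. f (s, d)) = (\<lambda>x. (\<kappa> - \<mu>) * f (s, x))"
      proof
        fix d
        have "mag_lap (cross_form b) (\<lambda>s. f (s, d)) s + mag_lap (cross_form c) (\<lambda>d. f (s, d)) d
            = \<kappa> * f (s, d)"
          using fun_cong[OF twsD(3)[OF f], of "(s, d)"] by (simp only: mag_lap_slice[OF smf])
        moreover have "mag_lap (cross_form b) (\<lambda>s. f (s, d)) s = \<mu> * f (s, d)"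
          using fun_cong[OF fst_lap, of "(s, d)"] by (simp only: fst_lap_slice[OF smf])
        ultimately show "mag_lap (cross_form c) (\<lambda>d. f (s, d)) d = (\<kappa> - \<mu>) * f (s, d)"
          by (simp add: left_diff_distrib eq_diff_eq add.commute)
      qed
    qed
  qed
next
  assume R: ?R
  then have smf: "smooth_fun f"
      and R1: "\<And>d. (\<lambda>s. f (s, d)) \<in> mag_eig (cross_form b) (slice_conds b \<xi> n) \<mu>"
    and R2: "\<And>s. (\<lambda>d. f (s, d)) \<in> mag_eig (cross_form c) (basis_conds \<xi>) (\<kappa> - \<mu>)" by auto
  have fst_lap: "fst_lap b c f x = \<mu> * f x" for x
    using fun_cong[OF twsD(3)[OF R1[of "snd x"]], of "fst x"]
        fst_lap_slice[OF smf, of b c "fst x" "snd x"] by simp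
  have "f \<in> mag_eig (cross_form2 b c) (conds_s Basis \<xi> \<union> conds_d \<xi> \<union> conds_n b n) \<kappa>"
  proof (rule twsI[OF smf])
    fix m \<theta> assume m: "(m, \<theta>) \<in> conds_s Basis \<xi> \<union> conds_d \<xi> \<union> conds_n b n"
    then consider m' where "m = (m', 0)" "(m', \<theta>) \<in> slice_conds b \<xi> n" | m' where "m = (0, m')"
        "(m', \<theta>) \<in> basis_conds \<xi>"
      by (auto simp: slice_conds_def conds_s_def conds_n_def basis_conds_def conds_d_def)
    then show "mag_transl (cross_form2 b c) m f = (\<lambda>x. \<theta> * f x)"
    proof cases
      case 1
      then show ?thesis using twsD(2)[OF R1 1(2)] by (auto simp: fun_eq_iff mag_transl_slice)
    next
      case 2
      then show ?thesis using twsD(2)[OF R2 2(2)] by (auto simp: fun_eq_iff mag_transl_slice)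
    qed
  next
    show "mag_lap (cross_form2 b c) f = (\<lambda>x. \<kappa> * f x)"
    proof
      fix x
      show "mag_lap (cross_form2 b c) f x = \<kappa> * f x"
        using mag_lap_slice[OF smf, of b c "fst x" "snd x"] fun_cong[OF twsD(3)[OF R1[of "snd x"]],
            of "fst x"]
          fun_cong[OF twsD(3)[OF R2[of "fst x"]], of "snd x"] by (simp add: left_diff_distrib)
    qed
  qed
  then show ?L using fst_lap by auto
qed

lemma cov_deriv_cnj: "smooth_fun \<phi> \<Longrightarrow> cov_deriv (cross_form (- b)) u (\<lambda>s. cnj (\<phi> s))
    = (\<lambda>s. cnj (cov_deriv (cross_form b) u \<phi> s))"
  by (simp add: cov_deriv_def fun_eq_iff dir_deriv_cnj cross_form_minus)

text \<open>Conjugation reverses the field, while the signs and the eigenvalue are real and survive.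
  It turns mode \<open>n\<close> along \<open>b\<close> into mode \<open>- n\<close>, which is mode
  \<open>n\<close> along \<open>- b\<close>.\<close>

lemma slice_space_cnj:
  assumes \<phi>: "\<phi> \<in> mag_eig (cross_form b) (slice_conds b \<xi> n) (of_real \<mu>)"
  shows "(\<lambda>s. cnj (\<phi> s)) \<in> mag_eig (cross_form (- b)) (slice_conds (- b) \<xi> n) (of_real \<mu>)"
proof (rule twsI)
  have smooth_fun\<phi>: "smooth_fun \<phi>" by (rule twsD(1)[OF \<phi>])
  show "smooth_fun (\<lambda>s. cnj (\<phi> s))" by (rule smooth_fun_cnj[OF smooth_fun\<phi>])
  have mag_transl_cnj: "mag_transl (cross_form (- b)) m (\<lambda>s. cnj (\<phi> s))
      = (\<lambda>s. cnj (mag_transl (cross_form b) m \<phi> s))" for m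
    by (simp add: mag_transl_def cross_form_minus cis_cnj)
  fix m \<theta> assume "(m, \<theta>) \<in> slice_conds (- b) \<xi> n"
  then have "(m, cnj \<theta>) \<in> slice_conds b \<xi> n"
  proof (unfold slice_conds_def, elim UnE imageE)
    fix t assume "(m, \<theta>) = (t *\<^sub>R 2 *\<^sub>R - b, cis (2 * pi * of_int n * t))"
    then have "(m, cnj \<theta>) = ((- t) *\<^sub>R (2 *\<^sub>R b), cis (2 * pi * of_int n * (- t)))"
      by (simp add: cis_cnj)
    then show "(m, cnj \<theta>) \<in> (\<lambda>e. (e, complex_of_real (\<xi> e))) ` Basis \<union>
        range (\<lambda>t. (t *\<^sub>R 2 *\<^sub>R b, cis (2 * pi * of_int n * t)))" by blast
  qed auto
  from twsD(2)[OF \<phi> this] show "mag_transl (cross_form (- b)) m (\<lambda>s. cnj (\<phi> s)) = (\<lambda>s. \<theta> * cnj (\<phi> s))"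
    unfolding mag_transl_cnj by simp
next
  have smooth_fun\<phi>: "smooth_fun \<phi>" by (rule twsD(1)[OF \<phi>])
  have "mag_lap (cross_form (- b)) (\<lambda>s. cnj (\<phi> s)) = (\<lambda>s. cnj (mag_lap (cross_form b) \<phi> s))"
    unfolding mag_lap_def by (simp add: cov_deriv_cnj smooth_fun\<phi> cross_form.smooth_fun_cov_deriv)
  then show "mag_lap (cross_form (- b)) (\<lambda>s. cnj (\<phi> s)) = (\<lambda>s. of_real \<mu> * cnj (\<phi> s))"
    by (simp add: twsD(3)[OF \<phi>])
qed

text \<open>In the evaluation basis \<open>f (s, d)\<close> is the sum of
  \<open>f (p, d) * \<phi> p s\<close>. Only the factors \<open>\<phi> p s\<close> are conjugated;
  the coefficients stay as they are, so the map is complex-linear and the conditions in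
  \<open>d\<close> persist.\<close>

lemma level_space_le:
  assumes b: "b \<noteq> 0" and \<xi>: "signs \<xi>"
  shows "mdim {f \<in> mag_eig (cross_form2 b c) (conds_s Basis \<xi> \<union> conds_d \<xi> \<union> conds_n b n) \<kappa>. fst_lap
      b c f = (\<lambda>x. of_real \<mu> * f x)}
    \<le> mdim {f \<in> mag_eig (cross_form2 (- b) c) (conds_s Basis \<xi> \<union> conds_d \<xi> \<union> conds_n (- b) n) \<kappa>.
        fst_lap (- b) c f = (\<lambda>x. of_real \<mu> * f x)}"
    (is "mdim ?E \<le> mdim ?E'")
proof -
  obtain S \<phi> where S: "finite S"
      "\<And>p. p \<in> S \<Longrightarrow> \<phi> p \<in> mag_eig (cross_form b) (slice_conds b \<xi> n) (of_real \<mu>)"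
    "\<And>p q. p \<in> S \<Longrightarrow> q \<in> S \<Longrightarrow> \<phi> p q = (if p = q then 1 else 0)"
    "\<And>f x. f \<in> mag_eig (cross_form b) (slice_conds b \<xi> n) (of_real \<mu>) \<Longrightarrow> f x = (\<Sum>p\<in>S. f p * \<phi> p x)"
    using evaluation_dual_basis[OF cross_form.subspace_mag_eig slice_space_finite[OF b \<xi>]] by blast
  define \<Theta> where "\<Theta> f x = (\<Sum>p\<in>S. cnj (\<phi> p (fst x)) * f (p, snd x))"
      for f :: "(real ^ 3) \<times> (real ^ 3) \<Rightarrow> complex" and x
  have E: "f \<in> ?E \<longleftrightarrow> smooth_fun f \<and> (\<forall>d. (\<lambda>s. f (s, d)) \<in> mag_eig (cross_form b) (slice_conds b \<xi> n)
      (of_real \<mu>)) \<and>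
     (\<forall>s. (\<lambda>d. f (s, d)) \<in> mag_eig (cross_form c) (basis_conds \<xi>) (\<kappa> - of_real \<mu>))" for f
    using level_space_iff[of f b c \<xi> n \<kappa> "of_real \<mu>"] by simp
  have E': "f \<in> ?E' \<longleftrightarrow> smooth_fun f
      \<and> (\<forall>d. (\<lambda>s. f (s, d)) \<in> mag_eig (cross_form (- b)) (slice_conds (- b) \<xi> n) (of_real \<mu>)) \<and>
     (\<forall>s. (\<lambda>d. f (s, d)) \<in> mag_eig (cross_form c) (basis_conds \<xi>) (\<kappa> - of_real \<mu>))" for f
    using level_space_iff[of f "- b" c \<xi> n \<kappa> "of_real \<mu>"] by simp
  show ?thesis
  proof (rule mdim_le_inj[where \<Theta> = \<Theta>])
    show "cfun.subspace ?E"
    proof (rule subspace_kernel[where A = "\<lambda>f x. fst_lap b c f x + (- of_real \<mu>) * f x", OF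
        cross_form2.subspace_mag_eig, THEN back_subst[of cfun.subspace]])
      show "linear_on (mag_eig (cross_form2 b c) (conds_s Basis \<xi> \<union> conds_d \<xi> \<union> conds_n b n) \<kappa>)
          (\<lambda>f x. fst_lap b c f x + (- of_real \<mu>) * f x)"
        by (intro linear_on_mag_eig linear_on_smooth_fun)
          (simp_all add: fst_lap_def cross_form2.cov_deriv_add cross_form2.cov_deriv_cmult
              cross_form2.smooth_fun_cov_deriv sum.distrib sum_distrib_left algebra_simps)
    qed (auto simp: fun_eq_iff)
    show "linear_on ?E \<Theta>"
      unfolding linear_on_def \<Theta>_def
      by (auto simp: fun_eq_iff sum_distrib_left distrib_left sum.distrib mult_ac)
    show "\<Theta> f \<in> ?E'" if "f \<in> ?E" for f
    proof -
      from that have smf: "smooth_fun f"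
          and f2: "\<And>s. (\<lambda>d. f (s, d)) \<in> mag_eig (cross_form c) (basis_conds \<xi>) (\<kappa> - of_real \<mu>)"
        unfolding E by auto
      have "smooth_fun (\<Theta> f)"
        unfolding \<Theta>_def
      proof (intro smooth_fun_sum smooth_fun_mult)
        fix p assume p: "p \<in> S"
        show "smooth_fun (\<lambda>x. cnj (\<phi> p (fst x)))"
          using smooth_fun_affine[OF bounded_linear_fst smooth_fun_cnj[OF twsD(1)[OF S(2)[OF p]]],
              of 0] by simp
        show "smooth_fun (\<lambda>x. f (p, snd x))"
          using smooth_fun_affine[OF bounded_linear_snd smooth_fun_slice(2)[OF smf], of p 0] by simp
      qed
      moreover have "(\<lambda>s. \<Theta> f (s, d)) \<in> mag_eig (cross_form (- b)) (slice_conds (- b) \<xi> n)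
          (of_real \<mu>)" for d
      proof -
        have "(\<Sum>p\<in>S. (\<lambda>s. f (p, d) * cnj (\<phi> p s))) \<in> mag_eig (cross_form (- b))
            (slice_conds (- b) \<xi> n) (of_real \<mu>)"
          by (intro cfun.subspace_sum[OF cross_form.subspace_mag_eig]
              cfun.subspace_scale[OF cross_form.subspace_mag_eig] slice_space_cnj S(2))
        also have "(\<Sum>p\<in>S. (\<lambda>s. f (p, d) * cnj (\<phi> p s))) = (\<lambda>s. \<Theta> f (s, d))"
          by (simp add: fun_eq_iff sum_fun_apply \<Theta>_def mult.commute)
        finally show ?thesis .
      qed
      moreover have "(\<lambda>d. \<Theta> f (s, d)) \<in> mag_eig (cross_form c) (basis_conds \<xi>) (\<kappa> - of_real \<mu>)" for s
      proof -
        have "(\<Sum>p\<in>S. (\<lambda>d. cnj (\<phi> p s) * f (p, d))) \<in> mag_eig (cross_form c) (basis_conds \<xi>)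
            (\<kappa> - of_real \<mu>)"
          by (intro cfun.subspace_sum[OF cross_form.subspace_mag_eig]
              cfun.subspace_scale[OF cross_form.subspace_mag_eig] f2)
        also have "(\<Sum>p\<in>S. (\<lambda>d. cnj (\<phi> p s) * f (p, d))) = (\<lambda>d. \<Theta> f (s, d))"
          by (simp add: fun_eq_iff sum_fun_apply \<Theta>_def)
        finally show ?thesis .
      qed
      ultimately show ?thesis unfolding E' by blast
    qed
    show "f = 0" if f: "f \<in> ?E" and z: "\<Theta> f = 0" for f
    proof -
      \<comment> \<open>Evaluating the image at the points of \<open>S\<close> returns the
        coefficients, because the values of \<open>\<phi> p\<close> there are \<open>0\<close> or
        \<open>1\<close> and hence real.\<close>
      have q: "f (q, d) = 0" if "q \<in> S" for q d
      proof -
        have "\<Theta> f (q, d) = (\<Sum>p\<in>S. if p = q then f (p, d) else 0)"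
          unfolding \<Theta>_def using S(3) that by (intro sum.cong) auto
        then show ?thesis using z S(1) that by simp
      qed
      have "f (s, d) = 0" for s d
      proof -
        have "(\<lambda>s. f (s, d)) \<in> mag_eig (cross_form b) (slice_conds b \<xi> n) (of_real \<mu>)" using f
            unfolding E by blast
        from S(4)[OF this, of s] show ?thesis using q by simp
      qed
      then show ?thesis by (auto simp: fun_eq_iff)
    qed
  qed
qed

lemma dir_deriv_mode:
  assumes f: "smooth_fun f" and mode: "\<And>t. f (x + t *\<^sub>R w) = cis (2 * pi * of_int n * t) * f x"
  shows "dir_deriv w f x = 2 * pi * \<i> * of_int n * f x"
proof -
  have "dir_deriv 1 (\<lambda>t::real. f (t *\<^sub>R w + x)) 0 = dir_deriv (1 *\<^sub>R w) f (0 *\<^sub>R w + x)"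
    by (rule dir_deriv_affine[OF bounded_linear_scaleR_left smooth_fun_differentiable[OF f]])
  moreover have "dir_deriv 1 (\<lambda>t. f x * cis ((2 * pi * of_int n) * t)) 0 = f x * dir_deriv 1
      (\<lambda>t. cis ((2 * pi * of_int n) * t)) 0"
    by (rule dir_deriv_cmult[OF smooth_fun_cis[OF bounded_linear_mult_right]])
  moreover have "dir_deriv 1 (\<lambda>t. cis ((2 * pi * of_int n) * t)) 0
      = \<i> * of_real (2 * pi * of_int n * 1) * cis (2 * pi * of_int n * 0)"
    by (rule dir_deriv_cis[OF bounded_linear_mult_right])
  moreover have "(\<lambda>t. f (t *\<^sub>R w + x)) = (\<lambda>t. f x * cis ((2 * pi * of_int n) * t))"
    using mode by (simp add: fun_eq_iff add.commute mult.commute)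
  ultimately show ?thesis by (simp add: mult_ac)
qed

lemma cross_form2_null: "cross_form2 b c (r *\<^sub>R b, 0) x = 0" "cross_form2 b c x (r *\<^sub>R b, 0) = 0"
  by (simp_all add: cross_form2_def cross_form_scale_self cross_form.form_simps)

lemma mag_transl_null: "mag_transl (cross_form2 b c) (t *\<^sub>R (2 *\<^sub>R b), 0) f x
    = f (x + t *\<^sub>R (2 *\<^sub>R b, 0))"
  using cross_form2_null(1)[of b c "t * 2" x] by (simp add: mag_transl_def)

lemma mag_transl_null': "mag_transl (cross_form2 b c) (t *\<^sub>R b, 0) f x = f (x + (t *\<^sub>R b, 0))"
  using cross_form2_null(1)[of b c t x] by (simp add: mag_transl_def)

lemma product_bas:
  assumes "signs \<xi>" "conds_s Basis \<xi> \<union> conds_d \<xi> \<subseteq> \<M>" "e \<in> Basis"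
  shows "\<exists>\<theta>. norm \<theta> = 1 \<and> (e, \<theta>) \<in> \<M>"
proof -
  from assms(3) consider u where "u \<in> Basis" "e = (u, 0)" | u where "u \<in> Basis" "e = (0, u)"
    by (auto simp: Basis_prod_def)
  then obtain u where "(e, of_real (\<xi> u)) \<in> conds_s Basis \<xi> \<union> conds_d \<xi>"
    by cases (auto simp: conds_s_def conds_d_def)
  then show ?thesis using assms(2) norm_signs[OF assms(1), of u] by blast
qed

text \<open>The ladder gives eigenfunctions of the part of the Laplacian in the plane orthogonal to
  \<open>b\<close>. Along \<open>b\<close> the Fourier mode acts as a scalar, so these are
  eigenfunctions of \<open>fst_lap\<close>, and the eigenvalues are real, as conjugation
  requires.\<close>

lemma mode_space_spanned_by_levels:
  assumes b: "b \<noteq> 0" and \<xi>: "signs \<xi>"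
    and f: "f \<in> mag_eig (cross_form2 b c) (conds_s Basis \<xi> \<union> conds_d \<xi> \<union> conds_n b n) \<kappa>"
  shows "f \<in> cfun.span (\<Union>\<mu>::real. {h \<in> mag_eig (cross_form2 b c) (conds_s Basis \<xi> \<union> conds_d \<xi>
      \<union> conds_n b n) \<kappa>.
    fst_lap b c h = (\<lambda>x. of_real \<mu> * h x)})"
proof -
  let ?X = "mag_eig (cross_form2 b c) (conds_s Basis \<xi> \<union> conds_d \<xi> \<union> conds_n b n) \<kappa>"
  obtain u1 u2 where fr: "magnetic_plane (cross_form b) u1 u2 (pi * norm b)" "u1 \<bullet> b = 0" "u2 \<bullet> b = 0"
    "\<And>x. x = (x \<bullet> u1) *\<^sub>R u1 + (x \<bullet> u2) *\<^sub>R u2 + (x \<bullet> sgn b) *\<^sub>R sgn b"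
    using frame_exists[OF b] by blast
  interpret Q: magnetic_plane "cross_form b" u1 u2 "pi * norm b" by (rule fr(1))
  interpret P: magnetic_plane "cross_form2 b c" "(u1, 0)" "(u2, 0)" "pi * norm b"
    by unfold_locales (use Q.form_u1 Q.form_u2 Q.unit Q.pos in
        \<open>simp_all add: cross_form2_def cross_form.form_simps inner_prod_def\<close>)
  have orth: "u1 \<bullet> sgn b = 0" "u2 \<bullet> sgn b = 0" "sgn b \<bullet> sgn b = 1"
    using fr(2,3) b by (simp_all add: sgn_div_norm[of b] dot_square_norm power2_eq_square)
  have ne: "u1 \<noteq> u2" "u1 \<noteq> sgn b" "u2 \<noteq> sgn b"
    using Q.unit orth by auto
  \<comment> \<open>Mode \<open>n\<close> over the period \<open>2 *\<^sub>R b\<close>, of length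
    \<open>2 * norm b\<close>, has the frequency \<open>2 * pi * n / (2 * norm b)\<close>.\<close>
  define q where "q = pi * of_int n / norm b"
  have level: "fst_lap b c h
      = (\<lambda>x. of_real (of_nat j * (4 * (pi * norm b)) + 2 * (pi * norm b) + q\<^sup>2) * h x)"
    if h: "h \<in> ?X" and N: "P.raise (P.lower h)
        = (\<lambda>x. (of_nat j * (4 * of_real (pi * norm b))) * h x)" for h j
  proof
    fix x
    have smh: "smooth_fun h" by (rule twsD(1)[OF h])
    have mode: "h (x + t *\<^sub>R (2 *\<^sub>R b, 0)) = cis (2 * pi * of_int n * t) * h x" for t x
    proof -
      have "((t *\<^sub>R (2 *\<^sub>R b), 0), cis (2 * pi * of_int n * t)) \<in> conds_s Basis \<xi> \<union> conds_d \<xi>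
          \<union> conds_n b n"
        by (auto simp: conds_n_def)
      from fun_cong[OF twsD(2)[OF h this], of x] show ?thesis by (simp only: mag_transl_null)
    qed
    have ns: "cov_deriv (cross_form2 b c) (sgn b, 0) h = (\<lambda>x. (\<i> * of_real q) * h x)"
    proof
      fix x
      have "(sgn b, 0) = (1 / (2 * norm b)) *\<^sub>R (2 *\<^sub>R b, 0 :: real ^ 3)"
        by (simp add: sgn_div_norm inverse_eq_divide)
      then have "cov_deriv (cross_form2 b c) (sgn b, 0) h x = of_real (1 / (2 * norm b)) * cov_deriv
          (cross_form2 b c) (2 *\<^sub>R b, 0) h x"
        by (simp only: cross_form2.cov_deriv_vec_scale[OF smh])
      also have "cov_deriv (cross_form2 b c) (2 *\<^sub>R b, 0) h x = 2 * pi * \<i> * of_int n * h x"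
        unfolding cov_deriv_def cross_form2_null dir_deriv_mode[OF smh mode] by simp
      finally show "cov_deriv (cross_form2 b c) (sgn b, 0) h x = (\<i> * of_real q) * h x"
        using b by (simp add: q_def)
    qed
    have nn: "cov_deriv (cross_form2 b c) (sgn b, 0) (cov_deriv (cross_form2 b c) (sgn b, 0) h) x =
        - of_real (q\<^sup>2) * h x"
    proof -
      have "cov_deriv (cross_form2 b c) (sgn b, 0) (cov_deriv (cross_form2 b c) (sgn b, 0) h) x
          = \<i> * of_real q * (\<i> * of_real q * h x)"
        unfolding ns by (simp only: cross_form2.cov_deriv_cmult[OF smh] ns)
      moreover have "\<i> * \<i> = (- 1 :: complex)" by simp
      ultimately show ?thesis unfolding of_real_power by algebra
    qed
    have "(\<Sum>e\<in>Basis. cov_deriv (cross_form2 b c) (e, 0) (cov_deriv (cross_form2 b c) (e, 0) h) x) =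
        (\<Sum>u\<in>{u1, u2, sgn b}. cov_deriv (cross_form2 b c) (u, 0)
            (cov_deriv (cross_form2 b c) (u, 0) h) x)"
    proof (rule cross_form2.cov_deriv_frame_sum[OF smh])
      show "linear (\<lambda>e::real ^ 3. (e, 0 :: real ^ 3))" by (rule linearI) auto
      show "x = (\<Sum>u\<in>{u1, u2, sgn b}. (x \<bullet> u) *\<^sub>R u)" for x
        using ne fr(4)[of x] by (simp add: add.assoc)
      show "u \<bullet> v = (if u = v then 1 else 0)" if "u \<in> {u1, u2, sgn b}" "v \<in> {u1, u2, sgn b}" for u v
        using that ne orth Q.unit by (auto simp: inner_commute)
    qed simp
    also have "\<dots> = cov_deriv (cross_form2 b c) (u1, 0) (cov_deriv (cross_form2 b c) (u1, 0) h) x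
        + cov_deriv (cross_form2 b c) (u2, 0) (cov_deriv (cross_form2 b c) (u2, 0) h) x
        - of_real (q\<^sup>2) * h x"
      using ne by (simp add: nn)
    finally have 1: "fst_lap b c h x = - cov_deriv (cross_form2 b c) (u1, 0)
        (cov_deriv (cross_form2 b c) (u1, 0) h) x - cov_deriv (cross_form2 b c) (u2, 0)
        (cov_deriv (cross_form2 b c) (u2, 0) h) x
        + of_real (q\<^sup>2) * h x"
      by (simp add: fst_lap_def)
    have 2: "of_nat j * (4 * of_real (pi * norm b)) * h x = - cov_deriv (cross_form2 b c) (u1, 0)
        (cov_deriv (cross_form2 b c) (u1, 0) h) x
        - cov_deriv (cross_form2 b c) (u2, 0) (cov_deriv (cross_form2 b c) (u2, 0) h) x
            - 2 * of_real (pi * norm b) * h x"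
      using fun_cong[OF N, of x] P.raise_lower[OF smh, of x] by simp
    show "fst_lap b c h x = of_real (of_nat j * (4 * (pi * norm b)) + 2 * (pi * norm b) + q\<^sup>2) * h x"
      unfolding 1 using 2 by (simp add: algebra_simps)
  qed
  have "f \<in> cfun.span {h \<in> ?X. \<exists>j::nat. P.raise (P.lower h)
      = (\<lambda>x. (of_nat j * (4 * of_real (pi * norm b))) * h x)}"
    by (rule P.mag_eig_ladder[OF f product_bas[OF \<xi>]]) auto
  also have "\<dots> \<subseteq> cfun.span (\<Union>\<mu>::real. {h \<in> ?X. fst_lap b c h = (\<lambda>x. of_real \<mu> * h x)})"
    by (rule cfun.span_mono) (use level in blast)
  finally show ?thesis .
qed

lemma linear_on_fst_lap: "linear_on (mag_eig (cross_form2 b c) \<M> \<kappa>) (fst_lap b c)"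
  by (intro linear_on_mag_eig linear_on_smooth_fun)
    (simp_all add: fst_lap_def cross_form2.cov_deriv_add cross_form2.cov_deriv_cmult
        cross_form2.smooth_fun_cov_deriv sum.distrib sum_distrib_left)

lemma mode_space_le:
  assumes b: "b \<noteq> 0" and \<xi>: "signs \<xi>"
  shows "mdim (mag_eig (cross_form2 b c) (conds_s Basis \<xi> \<union> conds_d \<xi> \<union> conds_n b n) \<kappa>)
    \<le> mdim (mag_eig (cross_form2 (- b) c) (conds_s Basis \<xi> \<union> conds_d \<xi> \<union> conds_n (- b) n) \<kappa>)"
proof -
  define \<theta> where "\<theta> \<mu> t = complex_of_real \<mu>" for \<mu> :: real and t :: unit
  let ?X = "\<lambda>b. mag_eig (cross_form2 b c) (conds_s Basis \<xi> \<union> conds_d \<xi> \<union> conds_n b n) \<kappa>"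
  have eig: "joint_eigenspace (\<lambda>_. fst_lap b c) (?X b) (\<theta> \<mu>)
      = {h \<in> ?X b. fst_lap b c h = (\<lambda>x. of_real \<mu> * h x)}" for b \<mu>
    by (simp add: joint_eigenspace_def \<theta>_def)
  show ?thesis
  proof (rule mdim_le_decomposition[where Q = "\<lambda>_. fst_lap b c" and Q' = "\<lambda>_. fst_lap (- b) c"
      and I = UNIV and \<theta> = \<theta>])
    show "mdim (joint_eigenspace (\<lambda>_. fst_lap b c) (?X b) (\<theta> \<mu>))
        \<le> mdim (joint_eigenspace (\<lambda>_. fst_lap (- b) c) (?X (- b)) (\<theta> \<mu>))" for \<mu>
      unfolding eig by (rule level_space_le[OF b \<xi>])
    show "?X b \<subseteq> cfun.span (\<Union>\<mu>\<in>F. joint_eigenspace (\<lambda>_. fst_lap b c) (?X b) (\<theta> \<mu>))"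
      if "\<And>\<mu>. \<mu> \<in> UNIV - F \<Longrightarrow> joint_eigenspace (\<lambda>_. fst_lap b c) (?X b) (\<theta> \<mu>) \<subseteq> {0}" for F
      by (rule full_if_spanned[where I = UNIV, OF _ that]) (use mode_space_spanned_by_levels[OF b \<xi>]
          in \<open>auto simp: eig\<close>)
  qed (use cross_form2.subspace_mag_eig linear_on_fst_lap in \<open>auto simp: \<theta>_def\<close>)
qed

text \<open>The signs give the period \<open>2 *\<^sub>R b\<close> in \<open>s\<close>. As
  \<open>(2 *\<^sub>R b, 0)\<close> is null for the form, the Fourier projections along it respect
  all conditions.\<close>

lemma sign_space_le:
  assumes b: "b \<noteq> 0" "int_vec b" and \<xi>: "signs \<xi>"
  shows "mdim (mag_eig (cross_form2 b c) (conds_s Basis \<xi> \<union> conds_d \<xi>) \<kappa>)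
    \<le> mdim (mag_eig (cross_form2 (- b) c) (conds_s Basis \<xi> \<union> conds_d \<xi>) \<kappa>)"
proof -
  let ?X = "\<lambda>b. mag_eig (cross_form2 b c) (conds_s Basis \<xi> \<union> conds_d \<xi>) \<kappa>"
  have modes: "{f \<in> ?X b. \<forall>x t. f (x + t *\<^sub>R (2 *\<^sub>R b, 0)) = cis (2 * pi * of_int n * t) * f x} =
      mag_eig (cross_form2 b c) (conds_s Basis \<xi> \<union> conds_d \<xi> \<union> conds_n b n) \<kappa>" for b n
    unfolding set_eq_iff mag_eig_Un[of _ _ _ "conds_n b n"]
        by (auto simp: conds_n_def fun_eq_iff mag_transl_null')
  show ?thesis
  proof (rule mdim_le_fourier[where w = "(2 *\<^sub>R b, 0)" and w' = "(2 *\<^sub>R (- b), 0)"])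
    fix f assume f: "f \<in> ?X b"
    show "continuous_on UNIV f" by (rule smooth_fun_continuous[OF twsD(1)[OF f]])
    show "f (x + (2 *\<^sub>R b, 0)) = f x" for x
    proof -
      have "mag_transl (cross_form b) e (\<lambda>s. f (s, snd x)) = (\<lambda>s. of_real (\<xi> e) * f (s, snd x))"
          if "e \<in> Basis" for e
      proof -
        have "((e, 0), of_real (\<xi> e)) \<in> conds_s Basis \<xi> \<union> conds_d \<xi>" using that
            by (simp add: conds_s_def)
        from twsD(2)[OF f this] show ?thesis by (simp add: fun_eq_iff mag_transl_slice)
      qed
      from quasi_periodic_2b[OF b(2) _ this, of "fst x"] \<xi> show ?thesis
        by (cases x) (simp add: signs_def)
    qed
    show "fourier_proj (2 *\<^sub>R b, 0) n f \<in> ?X b" for n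
      by (rule cross_form2.mag_eig_fourier_proj[OF f cross_form2_null(1)])
  next
    show "mdim {f \<in> ?X b. \<forall>x t. f (x + t *\<^sub>R (2 *\<^sub>R b, 0)) = cis (2 * pi * of_int n * t) * f x}
      \<le> mdim {f \<in> ?X (- b). \<forall>x t. f (x + t *\<^sub>R (2 *\<^sub>R (- b), 0)) = cis (2 * pi * of_int n * t) * f
          x}" for n
      unfolding modes by (rule mode_space_le[OF b(1) \<xi>])
  qed (rule cross_form2.subspace_mag_eig)+
qed

section \<open>Signs of the translations by \<open>(e, 0)\<close>\<close>

lemma mag_transl_single:
  assumes f: "f \<in> mag_eig (cross_form2 b c) (conds_pm \<union> \<M>) \<kappa>" and e: "e \<in> Basis"
  shows "mag_transl (cross_form2 b c) (0, e) (mag_transl (cross_form2 b c) (e, 0) f) = f"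
    and "mag_transl (cross_form2 b c) (e, 0) (mag_transl (cross_form2 b c) (e, 0) f) = f"
proof -
  \<comment> \<open>The translations by \<open>(e, e)\<close> and \<open>(e, - e)\<close> compose to
    the square of the one by \<open>(e, 0)\<close>, without a phase since
    \<open>cross3 e e = 0\<close>. So the latter is an involution, and the translation by
    \<open>(0, e)\<close> is its inverse.\<close>
  have 1: "mag_transl (cross_form2 b c) (e, e) f = f"
      and 2: "mag_transl (cross_form2 b c) (e, - e) f = f"
    using twsD(2)[OF f, of "(e, e)" 1] twsD(2)[OF f, of "(e, - e)" 1] e by (auto simp: conds_pm_def)
  show "mag_transl (cross_form2 b c) (0, e) (mag_transl (cross_form2 b c) (e, 0) f) = f"
    by (rule ext) (simp add: cross_form2.mag_transl_mag_transl cross_form2_def cross_form.form_simps 1)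
  have "mag_transl (cross_form2 b c) (e, 0) (mag_transl (cross_form2 b c) (e, 0) f) x
      = mag_transl (cross_form2 b c) (e, e) (mag_transl (cross_form2 b c) (e, - e) f) x" for x
    by (simp add: cross_form2.mag_transl_mag_transl cross_form2_def cross_form.form_simps)
  then show "mag_transl (cross_form2 b c) (e, 0) (mag_transl (cross_form2 b c) (e, 0) f) = f"
    by (simp add: 1 2 fun_eq_iff)
qed

text \<open>On invariant functions the translation by \<open>(0, e)\<close> inverts the one by
  \<open>(e, 0)\<close>, so both have the same sign. Conversely, equal signs multiply to
  \<open>1\<close> on \<open>(e, e)\<close> and \<open>(e, - e)\<close>.\<close>

lemma pm_space_full_signs:
  assumes \<xi>: "signs \<xi>"
  shows "mag_eig (cross_form2 b c) (conds_pm \<union> conds_s Basis \<xi>) \<kappa> = mag_eig (cross_form2 b c)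
      (conds_s Basis \<xi> \<union> conds_d \<xi>) \<kappa>"
proof -
  have sq: "complex_of_real (\<xi> e) * of_real (\<xi> e) = 1" for e
  proof -
    have "\<xi> e * \<xi> e = 1" using \<xi> by (metis minus_mult_minus mult_1 signs_def)
    then show ?thesis by (simp flip: of_real_mult)
  qed
  show ?thesis
  proof (intro equalityI subsetI)
    fix f assume f: "f \<in> mag_eig (cross_form2 b c) (conds_pm \<union> conds_s Basis \<xi>) \<kappa>"
    show "f \<in> mag_eig (cross_form2 b c) (conds_s Basis \<xi> \<union> conds_d \<xi>) \<kappa>"
    proof (rule twsI[OF twsD(1)[OF f] _ twsD(3)[OF f]])
      fix m \<theta> assume m: "(m, \<theta>) \<in> conds_s Basis \<xi> \<union> conds_d \<xi>"
      show "mag_transl (cross_form2 b c) m f = (\<lambda>x. \<theta> * f x)"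
      proof (cases "(m, \<theta>) \<in> conds_s Basis \<xi>")
        case True
        then show ?thesis using twsD(2)[OF f] by blast
      next
        case False
        then obtain e where e: "e \<in> Basis" "m = (0, e)" "\<theta> = of_real (\<xi> e)" using m
            by (auto simp: conds_d_def)
        have s: "mag_transl (cross_form2 b c) (e, 0) f = (\<lambda>x. of_real (\<xi> e) * f x)"
          by (rule twsD(2)[OF f]) (use e(1) in \<open>simp add: conds_s_def\<close>)
        have "of_real (\<xi> e) * mag_transl (cross_form2 b c) (0, e) f x = f x" for x
          using fun_cong[OF mag_transl_single(1)[OF f e(1)], of x]
              unfolding s cross_form2.mag_transl_cmult .
        then have "of_real (\<xi> e) * (of_real (\<xi> e) * mag_transl (cross_form2 b c) (0, e) f x)
            = of_real (\<xi> e) * f x" for x by simp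
        then show ?thesis by (simp add: e(2,3) fun_eq_iff sq flip: mult.assoc)
      qed
    qed
  next
    fix f assume f: "f \<in> mag_eig (cross_form2 b c) (conds_s Basis \<xi> \<union> conds_d \<xi>) \<kappa>"
    have s: "mag_transl (cross_form2 b c) (e, 0) f = (\<lambda>x. of_real (\<xi> e) * f x)"
        "mag_transl (cross_form2 b c) (0, e) f = (\<lambda>x. of_real (\<xi> e) * f x)"
      if "e \<in> Basis" for e
      by (rule twsD(2)[OF f]; use that in \<open>simp add: conds_s_def conds_d_def\<close>)+
    have me: "mag_transl (cross_form2 b c) (0, - e) f = (\<lambda>x. of_real (\<xi> e) * f x)" if "e \<in> Basis" for e
    proof -
      have "mag_transl (cross_form2 b c) (0, - e) (mag_transl (cross_form2 b c) (0, e) f) x = f x" for x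
        by (simp add: cross_form2.mag_transl_mag_transl cross_form2_def cross_form.form_simps)
            (simp add: mag_transl_def cross_form2_def cross_form.form_simps flip: zero_prod_def)
      then have "of_real (\<xi> e) * mag_transl (cross_form2 b c) (0, - e) f x = f x" for x
        unfolding s(2)[OF that] cross_form2.mag_transl_cmult .
      then have "of_real (\<xi> e) * (of_real (\<xi> e) * mag_transl (cross_form2 b c) (0, - e) f x)
          = of_real (\<xi> e) * f x" for x by simp
      then show ?thesis by (simp add: fun_eq_iff sq flip: mult.assoc)
    qed
    show "f \<in> mag_eig (cross_form2 b c) (conds_pm \<union> conds_s Basis \<xi>) \<kappa>"
    proof (rule twsI[OF twsD(1)[OF f] _ twsD(3)[OF f]])
      fix m \<theta> assume "(m, \<theta>) \<in> conds_pm \<union> conds_s Basis \<xi>"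
      then consider "(m, \<theta>) \<in> conds_s Basis \<xi>" | e where "e \<in> Basis" "m = (e, e)" "\<theta> = 1"
        | e where "e \<in> Basis" "m = (e, - e)" "\<theta> = 1"
        by (auto simp: conds_pm_def)
      then show "mag_transl (cross_form2 b c) m f = (\<lambda>x. \<theta> * f x)"
      proof cases
        case 1
        then show ?thesis using twsD(2)[OF f] by blast
      next
        case (2 e)
        have "mag_transl (cross_form2 b c) (e, 0) (mag_transl (cross_form2 b c) (0, e) f) x
            = mag_transl (cross_form2 b c) (e, e) f x" for x
          by (simp add: cross_form2.mag_transl_mag_transl cross_form2_def cross_form.form_simps)
        then show ?thesis unfolding s[OF 2(1)] cross_form2.mag_transl_cmult 2
            by (simp add: fun_eq_iff sq flip: mult.assoc)
      next
        case (3 e)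
        have "mag_transl (cross_form2 b c) (e, 0) (mag_transl (cross_form2 b c) (0, - e) f) x
            = mag_transl (cross_form2 b c) (e, - e) f x" for x
          by (simp add: cross_form2.mag_transl_mag_transl cross_form2_def cross_form.form_simps)
        then show ?thesis unfolding me[OF 3(1)] s[OF 3(1)] cross_form2.mag_transl_cmult 3
            by (simp add: fun_eq_iff sq flip: mult.assoc)
      qed
    qed
  qed
qed

text \<open>The form takes values in the integer multiples of \<open>pi\<close> on the vectors
  concerned, so the factor by which the translations could fail to commute is \<open>1\<close>,
  although \<open>(a, 0)\<close> is not in the lattice.\<close>

lemma mag_transl_single_preserves:
  assumes b: "int_vec b" and A: "A \<subseteq> Basis" and a: "a \<in> Basis"
    and f: "f \<in> mag_eig (cross_form2 b c) (conds_pm \<union> conds_s A \<xi>) \<kappa>"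
  shows "mag_transl (cross_form2 b c) (a, 0) f \<in> mag_eig (cross_form2 b c) (conds_pm \<union> conds_s A \<xi>) \<kappa>"
proof (rule twsI)
  show "smooth_fun (mag_transl (cross_form2 b c) (a, 0) f)"
      by (rule cross_form2.smooth_fun_mag_transl[OF twsD(1)[OF f]])
  show "mag_lap (cross_form2 b c) (mag_transl (cross_form2 b c) (a, 0) f)
      = (\<lambda>x. \<kappa> * mag_transl (cross_form2 b c) (a, 0) f x)"
    by (simp only: cross_form2.mag_lap_mag_transl[OF twsD(1)[OF f]] twsD(3)[OF f]
        cross_form2.mag_transl_cmult)
  fix m \<theta> assume m: "(m, \<theta>) \<in> conds_pm \<union> conds_s A \<xi>"
  then have "int_vec (fst m)" using A by (auto simp: conds_pm_def conds_s_def intro!: int_vec_Basis)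
  then have "cis (2 * cross_form2 b c (a, 0) m) = 1"
    using cis_int_vec_cross_form(2)[OF b int_vec_Basis[OF a]]
        by (simp add: cross_form2_def cross_form.form_simps)
  from cross_form2.mag_transl_commute[OF this, of f]
  show "mag_transl (cross_form2 b c) m (mag_transl (cross_form2 b c) (a, 0) f)
      = (\<lambda>x. \<theta> * mag_transl (cross_form2 b c) (a, 0) f x)"
    by (simp only: twsD(2)[OF f m] cross_form2.mag_transl_cmult)
qed

text \<open>\<open>S\<close> holds the directions whose sign is still free. The involution by
  \<open>(a, 0)\<close> splits the space into parts of sign \<open>1\<close> and \<open>- 1\<close>,
  in each of which one more sign is fixed; when none is free, \<open>sign_space_le\<close>
  applies.\<close>

lemma partial_sign_space_le:
  assumes b: "b \<noteq> 0" "int_vec b" and S: "finite S" "S \<subseteq> Basis" and \<xi>: "signs \<xi>"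
  shows "mdim (mag_eig (cross_form2 b c) (conds_pm \<union> conds_s (Basis - S) \<xi>) \<kappa>)
    \<le> mdim (mag_eig (cross_form2 (- b) c) (conds_pm \<union> conds_s (Basis - S) \<xi>) \<kappa>)"
  using S \<xi>
proof (induction S arbitrary: \<xi> rule: finite_induct)
  case empty
  then show ?case using sign_space_le[OF b] by (simp add: pm_space_full_signs)
next
  case (insert a S)
  let ?A = "Basis - insert a S"
  let ?X = "\<lambda>b. mag_eig (cross_form2 b c) (conds_pm \<union> conds_s ?A \<xi>) \<kappa>"
  have a: "a \<in> Basis" using insert.prems by simp
  define \<theta> where "\<theta> r t = complex_of_real r" for r :: real and t :: unit
  define Q where "Q b t = mag_transl (cross_form2 b c) (a, 0)" for b and t :: unit
  have eig: "joint_eigenspace (Q b) (?X b) (\<theta> r) = mag_eig (cross_form2 b c)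
      (conds_pm \<union> conds_s (Basis - S) (\<xi>(a := r))) \<kappa>" for b r
  proof -
    have "conds_pm \<union> conds_s (Basis - S) (\<xi>(a := r)) = (conds_pm \<union> conds_s ?A \<xi>)
        \<union> {((a, 0), of_real r)}"
      using a insert.hyps by (auto simp: conds_s_def)
    note conds = this
    have "joint_eigenspace (Q b) (?X b) (\<theta> r) =
        {f. f \<in> ?X b \<and> (\<forall>(m, \<theta>)\<in>{((a, 0), complex_of_real r)}. mag_transl (cross_form2 b c) m f
            = (\<lambda>x. \<theta> * f x))}"
      by (simp add: joint_eigenspace_def Q_def \<theta>_def)
    also have "\<dots> = mag_eig (cross_form2 b c) ((conds_pm \<union> conds_s ?A \<xi>) \<union> {((a, 0), of_real r)}) \<kappa>"
      unfolding mag_eig_Un[of _ _ "conds_pm \<union> conds_s ?A \<xi>" "{((a, 0), of_real r)}", symmetric]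
          by (rule Collect_mem_eq)
    finally show ?thesis unfolding conds .
  qed
  show ?case
  proof (rule mdim_le_decomposition[where Q = "Q b" and Q' = "Q (- b)" and I = "{1, - 1}" and \<theta> = \<theta>])
    show "linear_on (?X (- b)) (Q (- b) t)" for t
      unfolding Q_def by (simp add: linear_on_def plus_fun_def cross_form2.mag_transl_add
          cross_form2.mag_transl_cmult)
    show "mdim (joint_eigenspace (Q b) (?X b) (\<theta> r))
        \<le> mdim (joint_eigenspace (Q (- b)) (?X (- b)) (\<theta> r))"
      if "r \<in> {1, - 1}" for r
      unfolding eig by (rule insert.IH) (use insert.prems that in \<open>auto simp: signs_def\<close>)
    show "?X b \<subseteq> cfun.span (\<Union>r\<in>F. joint_eigenspace (Q b) (?X b) (\<theta> r))"
      if "\<And>r. r \<in> {1, - 1} - F \<Longrightarrow> joint_eigenspace (Q b) (?X b) (\<theta> r) \<subseteq> {0}" for F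
    proof (rule full_if_spanned[where I = "{1, - 1}", OF _ that], rule subsetI)
      fix f assume f: "f \<in> ?X b"
      define Tf where "Tf = mag_transl (cross_form2 b c) (a, 0) f"
      have Tf: "Tf \<in> ?X b"
        unfolding Tf_def by (rule mag_transl_single_preserves[OF b(2) _ a f]) auto
      have TT: "mag_transl (cross_form2 b c) (a, 0) Tf = f" unfolding Tf_def
          by (rule mag_transl_single(2)[OF f a])
      \<comment> \<open>Twice the projections onto the two eigenspaces of an involution.\<close>
      have part: "(\<lambda>x. f x + of_real r * Tf x) \<in> joint_eigenspace (Q b) (?X b) (\<theta> r)"
          if r: "r \<in> {1, - 1}" for r
      proof -
        have "(\<lambda>x. f x + of_real r * Tf x) \<in> ?X b"
          using cfun.subspace_add[OF cross_form2.subspace_mag_eig f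
              cfun.subspace_scale[OF cross_form2.subspace_mag_eig Tf]] by (simp only: plus_fun_def)
        moreover have "mag_transl (cross_form2 b c) (a, 0) (\<lambda>x. f x + of_real r * Tf x)
            = (\<lambda>x. of_real r * (f x + of_real r * Tf x))"
          unfolding cross_form2.mag_transl_add cross_form2.mag_transl_cmult TT Tf_def[symmetric]
              using r by (auto simp: fun_eq_iff)
        ultimately show ?thesis by (simp add: joint_eigenspace_def Q_def \<theta>_def)
      qed
      have "(\<lambda>x. (1 / 2) * (f x + of_real 1 * Tf x)) + (\<lambda>x. (1 / 2) * (f x + of_real (- 1) * Tf x))
          \<in> cfun.span (\<Union>r\<in>{1, - 1}. joint_eigenspace (Q b) (?X b) (\<theta> r))"
        using part[of 1] part[of "- 1"] by (intro cfun.span_add cfun.span_scale cfun.span_base) blast+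
      also have "(\<lambda>x. (1 / 2) * (f x + of_real 1 * Tf x))
          + (\<lambda>x. (1 / 2) * (f x + of_real (- 1) * Tf x)) = f"
        by (simp add: fun_eq_iff field_simps)
      finally show "f \<in> cfun.span (\<Union>r\<in>{1, - 1}. joint_eigenspace (Q b) (?X b) (\<theta> r))" .
    qed
  qed (use cross_form2.subspace_mag_eig in \<open>auto simp: \<theta>_def\<close>)
qed

lemma pm_space_le:
  assumes "b \<noteq> 0" "int_vec b"
  shows "mdim (mag_eig (cross_form2 b c) conds_pm \<kappa>) \<le> mdim (mag_eig (cross_form2 (- b) c) conds_pm \<kappa>)"
  using partial_sign_space_le[OF assms finite_Basis order_refl, of "\<lambda>_. 1" c \<kappa>]
  by (simp add: conds_s_def signs_def)

section \<open>The Laplacian of a two-step nilpotent group\<close>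

definition left_deriv ::
  "(real ^ 'k \<Rightarrow> real ^ 'm \<Rightarrow> real ^ 'm) \<Rightarrow> real ^ ('m::finite + 'k::finite) \<Rightarrow>
    (real ^ ('m + 'k) \<Rightarrow> complex) \<Rightarrow> real ^ ('m + 'k) \<Rightarrow> complex" where
  "left_deriv j U f = (\<lambda>x. dir_deriv (left_field j U x) f x)"

lemma dir_deriv_coordinates:
  fixes f :: "real ^ 'n::finite \<Rightarrow> complex"
  assumes "smooth_fun f"
  shows "dir_deriv v f x = (\<Sum>i\<in>UNIV. v $ i *\<^sub>R dir_deriv (axis i 1) f x)"
proof -
  have lin: "linear (\<lambda>v. dir_deriv v f x)"
      by (rule has_derivative_linear[OF smooth_fun_has_derivative[OF assms]])
  have "dir_deriv v f x = dir_deriv (\<Sum>i\<in>UNIV. v $ i *\<^sub>R axis i 1) f x"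
    by (simp add: basis_expansion flip: scalar_mult_eq_scaleR)
  also have "\<dots> = (\<Sum>i\<in>UNIV. v $ i *\<^sub>R dir_deriv (axis i 1) f x)"
    by (simp add: linear_sum[OF lin] linear_cmul[OF lin])
  finally show ?thesis .
qed

context
  fixes j :: "real ^ 'k::finite \<Rightarrow> real ^ 'm::finite \<Rightarrow> real ^ 'm"
  assumes j: "so_map j"
begin

lemmas bracket_simps =
  bilinear_ladd[OF bilinear_nil_bracket[OF j]] bilinear_radd[OF bilinear_nil_bracket[OF j]]
  bilinear_lmul[OF bilinear_nil_bracket[OF j]] bilinear_rmul[OF bilinear_nil_bracket[OF j]]
  bilinear_lneg[OF bilinear_nil_bracket[OF j]] bilinear_rneg[OF bilinear_nil_bracket[OF j]]
  bilinear_lsub[OF bilinear_nil_bracket[OF j]] bilinear_rsub[OF bilinear_nil_bracket[OF j]]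
  bilinear_lzero[OF bilinear_nil_bracket[OF j]] bilinear_rzero[OF bilinear_nil_bracket[OF j]]

lemma bounded_linear_bracket: "bounded_linear (nil_bracket j p)"
    "bounded_linear (\<lambda>x. nil_bracket j x U)"
  using bilinear_nil_bracket[OF j] by (auto simp: bilinear_def linear_conv_bounded_linear)

lemma linear_shear: "linear (\<lambda>u. u + t *\<^sub>R nil_bracket j p u)"
  by (rule linearI) (simp_all add: bracket_simps algebra_simps)

lemma matrix_shear_mult:
  "matrix (\<lambda>u. u + s *\<^sub>R nil_bracket j p u) ** matrix (\<lambda>u. u + t *\<^sub>R nil_bracket j p u) =
    matrix (\<lambda>u. u + (s + t) *\<^sub>R nil_bracket j p u)"
proof -
  have "(\<lambda>u. u + s *\<^sub>R nil_bracket j p u) \<circ> (\<lambda>u. u + t *\<^sub>R nil_bracket j p u)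
      = (\<lambda>u. u + (s + t) *\<^sub>R nil_bracket j p u)"
    by (rule ext) (simp add: bracket_simps nil_bracket_center[OF j] algebra_simps)
  then show ?thesis
    using matrix_compose[OF linear_shear[of t p] linear_shear[of s p]] by simp
qed

lemma matrix_shear_0: "matrix (\<lambda>u. u + 0 *\<^sub>R nil_bracket j p u) = mat 1"
  by (simp add: matrix_id_mat_1[unfolded id_def])

text \<open>
  Scaling the centre by \<open>2\<close> conjugates the shear with parameter \<open>t\<close> to the one with parameter \<open>2t\<close>,
  which is its square; so its determinant is idempotent.
\<close>

lemma det_matrix_shear: "det (matrix (\<lambda>u. u + t *\<^sub>R nil_bracket j p u)) = 1"
proof -
  define A where "A t = matrix (\<lambda>u. u + t *\<^sub>R nil_bracket j p u)" for t
  define \<delta> where "\<delta> r x = dsum (lpart x) (r *\<^sub>R rpart x)" for r and x :: "real ^ ('m + 'k)"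
  have lin: "linear (\<delta> r)" for r
    unfolding \<delta>_def by (rule linearI; rule dsum_eqI) (simp_all add: algebra_simps)
  have "\<delta> (1 / 2) \<circ> \<delta> 2 = id" by (rule ext) (auto simp: \<delta>_def intro: dsum_eqI)
  then have "matrix (\<delta> (1 / 2)) ** matrix (\<delta> 2) = mat 1"
    using matrix_compose[OF lin[of 2] lin[of "1 / 2"]] by (simp add: matrix_id_mat_1)
  from arg_cong[OF this, of det] have \<delta>: "det (matrix (\<delta> 2)) \<noteq> 0"
    by (auto simp: det_mul)
  have "\<delta> 2 \<circ> (\<lambda>u. u + t *\<^sub>R nil_bracket j p u) = (\<lambda>u. u + (t + t) *\<^sub>R nil_bracket j p u) \<circ> \<delta> 2"
    by (rule ext, rule dsum_eqI) (simp_all add: \<delta>_def algebra_simps vec_eq_iff)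
  then have "matrix (\<delta> 2) ** A t = A (t + t) ** matrix (\<delta> 2)"
    using matrix_compose[OF linear_shear[of t p] lin[of 2]]
        matrix_compose[OF lin[of 2] linear_shear[of "t + t" p]]
    by (simp add: A_def)
  from arg_cong[OF this, of det] have "det (A t) = det (A (t + t))"
    using \<delta> by (simp add: det_mul mult.commute)
  also have "\<dots> = det (A t) * det (A t)"
    unfolding A_def by (simp only: matrix_shear_mult[symmetric] det_mul)
  finally have idem: "det (A t) * (det (A t) - 1) = 0" by (simp add: algebra_simps)
  have "A t ** A (- t) = mat 1"
    using matrix_shear_mult[of t p "- t"] matrix_shear_0[of p] by (simp add: A_def)
  from arg_cong[OF this, of det] have "det (A t) \<noteq> 0" by (auto simp: det_mul)
  then show ?thesis using idem by (simp add: A_def)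
qed

text \<open>The metric is the pullback of the inner product under the differential of left
  translation by \<open>- p\<close>, and this differential is a shear.\<close>

lemma metric_matrix_eq:
  "metric_matrix j p = transpose (matrix (\<lambda>u. u + (- 1 / 2) *\<^sub>R nil_bracket j p u)) ** matrix
      (\<lambda>u. u + (- 1 / 2) *\<^sub>R nil_bracket j p u)"
proof -
  have "frechet_derivative (nil_mult j (- p)) (at p) = (\<lambda>u. u + (1 / 2) *\<^sub>R nil_bracket j (- p) u)"
    by (rule frechet_derivative_at[OF has_derivative_nil_mult[OF j], symmetric])
  then have "frechet_derivative (nil_mult j (- p)) (at p) = (\<lambda>u. u + (- 1 / 2) *\<^sub>R nil_bracket j p u)"
    by (simp add: bracket_simps)
  then show ?thesis
    by (simp add: metric_matrix_def left_metric_def vec_eq_iff matrix_matrix_mult_def transpose_def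
        matrix_def inner_vec_def)
qed

lemma sqrt_det_metric_matrix: "sqrt (det (metric_matrix j p)) = 1"
  unfolding metric_matrix_eq det_mul det_transpose det_matrix_shear by simp

text \<open>The inverse shear has the left-invariant fields at \<open>p\<close> as its columns, so
  the inverse metric is the sum of their tensor squares.\<close>

lemma matrix_inv_metric_matrix:
  "matrix_inv (metric_matrix j p) $ i $ k
      = (\<Sum>a\<in>UNIV. left_field j (axis a 1) p $ i * left_field j (axis a 1) p $ k)"
proof -
  define A where "A = matrix (\<lambda>u. u + (- 1 / 2) *\<^sub>R nil_bracket j p u)"
  define B where "B = matrix (\<lambda>u. u + (1 / 2) *\<^sub>R nil_bracket j p u)"
  have AB: "A ** B = mat 1" "B ** A = mat 1"
    unfolding A_def B_def matrix_shear_mult using matrix_shear_0[of p] by simp_all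
  have ABt: "transpose A ** transpose B = mat 1" "transpose B ** transpose A = mat 1"
    using arg_cong[OF AB(2), of transpose] arg_cong[OF AB(1), of transpose]
        by (simp_all add: matrix_transpose_mul transpose_mat)
  have G: "metric_matrix j p = transpose A ** A" by (simp add: metric_matrix_eq A_def)
  have "metric_matrix j p ** (B ** transpose B) = transpose A ** (A ** B) ** transpose B"
    by (simp add: G matrix_mul_assoc)
  then have 1: "metric_matrix j p ** (B ** transpose B) = mat 1" by (simp add: AB ABt)
  then have 2: "(B ** transpose B) ** metric_matrix j p = mat 1" by (rule matrix_left_right_inverse1)
  have "metric_matrix j p ** matrix_inv (metric_matrix j p) = mat 1"
    unfolding matrix_inv_def using
        someI_ex[of "\<lambda>C. metric_matrix j p ** C = mat 1 \<and> C ** metric_matrix j p = mat 1"] 1 2 by blast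
  then have "(B ** transpose B) ** (metric_matrix j p ** matrix_inv (metric_matrix j p))
      = B ** transpose B" by simp
  then have "matrix_inv (metric_matrix j p) = B ** transpose B"
    by (simp add: matrix_mul_assoc 2)
  then show ?thesis
    by (simp add: B_def matrix_matrix_mult_def transpose_def matrix_def left_field_eq[OF j])
qed

text \<open>In coordinates a left-invariant field has coefficients affine in
  \<open>x\<close>.\<close>

lemma smooth_fun_left_deriv:
  assumes f: "smooth_fun f"
  shows "smooth_fun (left_deriv j U f)"
proof -
  have "left_deriv j U f = (\<lambda>x. dir_deriv U f x
      + (\<Sum>i\<in>UNIV. complex_of_real ((1 / 2) * (nil_bracket j x U $ i)) * dir_deriv (axis i 1) f x))"
  proof
    fix x
    have "dir_deriv (U + (1 / 2) *\<^sub>R nil_bracket j x U) f x = dir_deriv U f x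
        + (1 / 2) *\<^sub>R dir_deriv (nil_bracket j x U) f x"
      by (simp only: dir_deriv_add_vec dir_deriv_scale_vec smooth_fun_differentiable[OF f])
    also have "dir_deriv (nil_bracket j x U) f x
        = (\<Sum>i\<in>UNIV. nil_bracket j x U $ i *\<^sub>R dir_deriv (axis i 1) f x)"
      by (rule dir_deriv_coordinates[OF f])
    also have "dir_deriv U f x + (1 / 2) *\<^sub>R (\<Sum>i\<in>UNIV. nil_bracket j x U $ i *\<^sub>R dir_deriv
        (axis i 1) f x) =
        dir_deriv U f x + (\<Sum>i\<in>UNIV. complex_of_real ((1 / 2) * (nil_bracket j x U $ i)) * dir_deriv
            (axis i 1) f x)"
      by (simp add: scaleR_sum_right scaleR_conv_of_real sum_divide_distrib)
    finally show "left_deriv j U f x = dir_deriv U f x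
        + (\<Sum>i\<in>UNIV. complex_of_real ((1 / 2) * (nil_bracket j x U $ i)) * dir_deriv (axis i 1) f x)"
      unfolding left_deriv_def left_field_eq[OF j] .
  qed
  moreover have "bounded_linear (\<lambda>x. (1 / 2) * (nil_bracket j x U $ i))" for i
    by (intro bounded_linear_compose[OF bounded_linear_mult_right]
        bounded_linear_compose[OF bounded_linear_vec_nth]
        bounded_linear_bracket)
  ultimately show ?thesis by (simp only:) (intro smooth_fun_add smooth_fun_dir_deriv f
      smooth_fun_sum smooth_fun_mult smooth_fun_of_real)
qed

text \<open>The volume density is \<open>1\<close>, so the operator is minus the divergence of the
  sum of \<open>left_deriv j (axis a 1) f\<close> times the fields. The fields are divergence-free:
  only their central coefficients vary, and these depend on non-central coordinates only.\<close>

lemma laplace_beltrami_eq: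
  assumes f: "smooth_fun f"
  shows "laplace_beltrami (metric_matrix j) f p =
      - (\<Sum>a\<in>UNIV. left_deriv j (axis a 1) (left_deriv j (axis a 1) f) p)"
proof -
  let ?L = "\<lambda>a. left_field j (axis a 1)"
  have inner: "(\<Sum>k\<in>UNIV. (sqrt (det (metric_matrix j q)) * matrix_inv (metric_matrix j q) $ i $ k)
      *\<^sub>R pderiv_at k f q)
      = (\<Sum>a\<in>UNIV. complex_of_real (?L a q $ i) * left_deriv j (axis a 1) f q)" for i q
  proof -
    have "(\<Sum>k\<in>UNIV. (sqrt (det (metric_matrix j q)) * matrix_inv (metric_matrix j q) $ i $ k) *\<^sub>R
        pderiv_at k f q)
        = (\<Sum>k\<in>UNIV. \<Sum>a\<in>UNIV. ?L a q $ i *\<^sub>R (?L a q $ k *\<^sub>R dir_deriv (axis k 1) f q))"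
      by (simp add: sqrt_det_metric_matrix matrix_inv_metric_matrix pderiv_at_eq_dir_deriv
          scaleR_sum_left)
    also have "\<dots> = (\<Sum>a\<in>UNIV. ?L a q $ i *\<^sub>R (\<Sum>k\<in>UNIV. ?L a q $ k *\<^sub>R dir_deriv (axis k 1) f q))"
      by (subst sum.swap) (simp add: scaleR_sum_right)
    also have "\<dots> = (\<Sum>a\<in>UNIV. complex_of_real (?L a q $ i) * left_deriv j (axis a 1) f q)"
      unfolding dir_deriv_coordinates[OF f, symmetric] by (simp add: left_deriv_def scaleR_conv_of_real)
    finally show ?thesis .
  qed
  have Lc: "(\<lambda>q. complex_of_real (?L a q $ i))
      = (\<lambda>q. of_real (axis a 1 $ i) + of_real ((1 / 2) * (nil_bracket j q (axis a 1) $ i)))" for a i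
    by (simp add: fun_eq_iff left_field_eq[OF j])
  have bl: "bounded_linear (\<lambda>x. (1 / 2) * (nil_bracket j x U $ i))" for U i
    by (intro bounded_linear_compose[OF bounded_linear_mult_right]
        bounded_linear_compose[OF bounded_linear_vec_nth]
        bounded_linear_bracket)
  have smL: "smooth_fun (\<lambda>q. complex_of_real (?L a q $ i))" for a i
    unfolding Lc by (intro smooth_fun_add smooth_fun_const smooth_fun_of_real bl)
  have divL: "dir_deriv (axis i 1) (\<lambda>q. complex_of_real (?L a q $ i)) p = 0" for a i
  proof -
    have "dir_deriv (axis i 1) (\<lambda>q. complex_of_real (?L a q $ i)) p
        = of_real ((1 / 2) * (nil_bracket j (axis i 1) (axis a 1) $ i))"
      unfolding Lc
      by (subst dir_deriv_add; (intro smooth_fun_differentiable smooth_fun_const smooth_fun_of_real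
          bl)?)
        (simp only: dir_deriv_const
            smooth_fun_bounded_linear(2)[OF bounded_linear_compose[OF bounded_linear_of_real bl]]
            add_0_left)
    also have "nil_bracket j (axis i 1) (axis a 1) $ i = 0"
    proof (cases i)
      case (Inl i')
      then show ?thesis by (simp add: nil_bracket_def)
    next
      case (Inr i')
      then have "lpart (axis i 1 :: real ^ ('m + 'k)) = 0" by (simp add: vec_eq_iff axis_def)
      then show ?thesis
        using bilinear_rzero[of j] j by (simp add: nil_bracket_def Inr so_map_def)
    qed
    finally show ?thesis by simp
  qed
  have "pderiv_at i (\<lambda>q. \<Sum>a\<in>UNIV. complex_of_real (?L a q $ i) * left_deriv j (axis a 1) f q) p
      = (\<Sum>a\<in>UNIV. ?L a p $ i *\<^sub>R dir_deriv (axis i 1) (left_deriv j (axis a 1) f) p)" for i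
    unfolding pderiv_at_eq_dir_deriv
    by (subst dir_deriv_sum) (auto intro!: smooth_fun_mult smL smooth_fun_left_deriv f simp:
        dir_deriv_mult smL smooth_fun_left_deriv f divL scaleR_conv_of_real)
  then have "laplace_beltrami (metric_matrix j) f p =
      - (\<Sum>i\<in>UNIV. \<Sum>a\<in>UNIV. ?L a p $ i *\<^sub>R dir_deriv (axis i 1) (left_deriv j (axis a 1) f) p)"
    unfolding laplace_beltrami_def inner unfolding sqrt_det_metric_matrix by simp
  also have "\<dots> = - (\<Sum>a\<in>UNIV. left_deriv j (axis a 1) (left_deriv j (axis a 1) f) p)"
    by (subst sum.swap) (simp only: left_deriv_def[of j _ "left_deriv j _ f"]
        dir_deriv_coordinates[OF smooth_fun_left_deriv[OF f], symmetric])
  finally show ?thesis .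
qed

end

section \<open>Functions with a fixed central character\<close>

text \<open>Forgets the centre and passes to \<open>(L + R, L - R)\<close>, where both brackets
  split into cross products. Leaving it unnormalised keeps lattice vectors integral and doubles the
  Laplacian.\<close>

definition qmap :: "real ^ ((3 + 3) + 3) \<Rightarrow> (real ^ 3) \<times> (real ^ 3)" where
  "qmap x = (lpart (lpart x) + rpart (lpart x), lpart (lpart x) - rpart (lpart x))"

text \<open>
  The central character is \<open>z \<mapsto> exp (2 \<pi> \<i> (2 c \<bullet> z))\<close>: the dual of the lattice \<open>\<L>\<close> consists of the
  vectors \<open>2 c\<close> with \<open>c\<close> integral.
\<close>

definition lift :: "real ^ 3 \<Rightarrow> ((real ^ 3) \<times> (real ^ 3) \<Rightarrow> complex) \<Rightarrow> real ^ ((3 + 3) + 3) \<Rightarrow> complex"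
    where
  "lift c h x = cis (4 * pi * (c \<bullet> rpart x)) * h (qmap x)"

lemma linear_qmap: "linear qmap"
  by (rule linearI) (simp_all add: qmap_def algebra_simps)

lemma bounded_linear_qmap: "bounded_linear qmap"
  using linear_qmap by (simp add: linear_conv_bounded_linear)

lemma bounded_linear_phase: "bounded_linear (\<lambda>x::real ^ ((3 + 3) + 3). 4 * pi * (c \<bullet> rpart x))"
proof -
  have "linear (\<lambda>x::real ^ ((3 + 3) + 3). 4 * pi * (c \<bullet> rpart x))"
    by (rule linearI) (simp_all add: inner_add_right algebra_simps)
  then show ?thesis by (simp add: linear_conv_bounded_linear)
qed

lemma smooth_fun_lift: "smooth_fun h \<Longrightarrow> smooth_fun (lift c h)"
  unfolding lift_def[abs_def]
  using smooth_fun_affine[OF bounded_linear_qmap, of h 0]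
      by (intro smooth_fun_mult smooth_fun_cis bounded_linear_phase) simp

lemma dir_deriv_lift:
  assumes "smooth_fun h"
  shows "dir_deriv v (lift c h) x = 4 * pi * \<i> * of_real (c \<bullet> rpart v) * lift c h x
    + cis (4 * pi * (c \<bullet> rpart x)) * dir_deriv (qmap v) h (qmap x)"
proof -
  have smq: "smooth_fun (\<lambda>x. h (qmap x))"
      using smooth_fun_affine[OF bounded_linear_qmap assms, of 0] by simp
  have "dir_deriv v (\<lambda>x. h (qmap x)) x = dir_deriv (qmap v) h (qmap x)"
    using dir_deriv_affine[OF bounded_linear_qmap smooth_fun_differentiable[OF assms], of v 0 x] by simp
  then show ?thesis
    unfolding lift_def[abs_def]
    by (subst dir_deriv_mult[OF smooth_fun_cis[OF bounded_linear_phase] smq], subst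
        dir_deriv_cis[OF bounded_linear_phase]) (simp add: mult_ac)
qed

lemma lift_cmult: "lift c (\<lambda>y. r * h y) x = r * lift c h x"
  by (simp add: lift_def mult.left_commute)

lemma lift_inject: "lift c g = lift c h \<longleftrightarrow> g = h"
proof
  assume e: "lift c g = lift c h"
  show "g = h"
  proof
    fix y
    have "qmap (dsum (dsum ((1 / 2) *\<^sub>R (fst y + snd y)) ((1 / 2) *\<^sub>R (fst y - snd y))) 0) = y"
      by (simp add: qmap_def prod_eq_iff vec_eq_iff field_simps)
    then show "g y = h y"
      using fun_cong[OF e, of "dsum
          (dsum ((1 / 2) *\<^sub>R (fst y + snd y)) ((1 / 2) *\<^sub>R (fst y - snd y))) 0"]
      by (simp add: lift_def)
  qed
qed simp

lemma sum_UNIV_Plus: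
  fixes g :: "'a::finite + 'b::finite \<Rightarrow> 'c::comm_monoid_add"
  shows "sum g UNIV = (\<Sum>a\<in>UNIV. g (Inl a)) + (\<Sum>b\<in>UNIV. g (Inr b))"
  by (simp add: sum.Plus flip: UNIV_Plus_UNIV)

lemma sum_Basis_axis: "(\<Sum>e\<in>(Basis :: (real ^ 'n::finite) set). g e) = (\<Sum>i\<in>UNIV. g (axis i 1))"
proof -
  have "(Basis :: (real ^ 'n) set) = range (\<lambda>i. axis i 1)" by (auto simp: Basis_vec_def)
  moreover have "inj (\<lambda>i::'n. axis i (1::real))" by (rule injI) (simp add: axis_eq_axis)
  ultimately show ?thesis using sum.reindex[of "\<lambda>i::'n. axis i (1::real)" UNIV g] by (simp only: o_def)
qed

lemma axis_parts:
  "lpart (axis (Inl a) r) = axis a r" "rpart (axis (Inl a) r) = 0"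
  "lpart (axis (Inr b) r) = 0" "rpart (axis (Inr b) r) = axis b r"
  by (simp_all add: vec_eq_iff axis_def)

lemma qmap_axis:
  "qmap (axis (Inl (Inl i)) 1) = (axis i 1, axis i 1)"
      "qmap (axis (Inl (Inr i)) 1) = (axis i 1, - axis i 1)"
  "qmap (axis (Inr k) r) = 0"
proof -
  have "lpart (0 :: real ^ (3 + 3)) = 0" "rpart (0 :: real ^ (3 + 3)) = 0" by (simp_all add: vec_eq_iff)
  then show "qmap (axis (Inl (Inl i)) 1) = (axis i 1, axis i 1)"
    "qmap (axis (Inl (Inr i)) 1) = (axis i 1, - axis i 1)" "qmap (axis (Inr k) r) = 0"
    by (simp_all add: qmap_def axis_parts zero_prod_def)
qed

text \<open>The difference between \<open>j_one\<close> and \<open>j_two\<close> is reduced to the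
  sign of the first field, here and in the next identity.\<close>

lemma cross_form_one: "cross_form2 c c (qmap x) (qmap y) = 2 * pi * (c \<bullet> rpart (nil_bracket j_one x y))"
  by (simp add: cross_form2_def cross_form_def qmap_def j_one_def quat_Im_def pure_quat_def
      inner_parts cross3_def
      inner_vec_def sum_3 axis_def algebra_simps)

lemma cross_form_two: "cross_form2 (- c) c (qmap x) (qmap y)
    = 2 * pi * (c \<bullet> rpart (nil_bracket j_two x y))"
  by (simp add: cross_form2_def cross_form_def qmap_def j_two_def quat_Im_def pure_quat_def
      inner_parts cross3_def
      inner_vec_def sum_3 axis_def algebra_simps)

context
  fixes j :: "real ^ 3 \<Rightarrow> real ^ (3 + 3) \<Rightarrow> real ^ (3 + 3)" and b c :: "real ^ 3"
  assumes j: "so_map j"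
    and form: "\<And>x y. cross_form2 b c (qmap x) (qmap y) = 2 * pi * (c \<bullet> rpart (nil_bracket j x y))"
begin

lemma qmap_bracket: "qmap (nil_bracket j x y) = 0"
proof -
  have "lpart (0 :: real ^ (3 + 3)) = 0" "rpart (0 :: real ^ (3 + 3)) = 0" by (simp_all add: vec_eq_iff)
  then show ?thesis by (simp add: qmap_def zero_prod_def)
qed

text \<open>At \<open>x\<close> the field of \<open>U\<close> has the extra central component
  \<open>1 / 2\<close> times the bracket of \<open>x\<close> and \<open>U\<close>. Paired with the
  phase it becomes the magnetic potential; \<open>rpart U\<close> contributes a constant.\<close>

lemma left_deriv_lift:
  assumes h: "smooth_fun h"
  shows "left_deriv j U (lift c h) = lift c (\<lambda>y. cov_deriv (cross_form2 b c) (qmap U) h y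
      + (4 * pi * \<i> * of_real (c \<bullet> rpart U)) * h y)"
proof
  fix x
  have q: "qmap (U + (1 / 2) *\<^sub>R nil_bracket j x U) = qmap U"
    using linear_qmap by (simp add: linear_add linear_cmul qmap_bracket)
  have r: "4 * pi * (c \<bullet> rpart (U + (1 / 2) *\<^sub>R nil_bracket j x U)) = 4 * pi * (c \<bullet> rpart U)
      + cross_form2 b c (qmap x) (qmap U)"
    by (simp add: inner_add_right form algebra_simps)
  have "left_deriv j U (lift c h) x
      = \<i> * of_real (4 * pi * (c \<bullet> rpart (U + (1 / 2) *\<^sub>R nil_bracket j x U))) * lift c h x
      + cis (4 * pi * (c \<bullet> rpart x)) * dir_deriv (qmap U) h (qmap x)"
    unfolding left_deriv_def left_field_eq[OF j] dir_deriv_lift[OF h] q by simp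
  then show "left_deriv j U (lift c h) x = lift c (\<lambda>y. cov_deriv (cross_form2 b c) (qmap U) h y
      + (4 * pi * \<i> * of_real (c \<bullet> rpart U)) * h y) x"
    unfolding r by (simp add: lift_def cov_deriv_def algebra_simps)
qed

lemma cov_deriv_zero: "cov_deriv \<omega> 0 h = (\<lambda>x. 0)" if "magnetic \<omega>" "smooth_fun h"
    for \<omega> :: "'a::euclidean_space \<Rightarrow> 'a \<Rightarrow> real"
  using magnetic.cov_deriv_vec_scale[OF that, of 0 0] by (simp add: fun_eq_iff)

text \<open>The squares of the derivatives along \<open>(e, e)\<close> and \<open>(e, - e)\<close>
  add up to twice those along \<open>(e, 0)\<close> and \<open>(0, e)\<close>. The central
  directions contribute \<open>(4 * pi)\<^sup>2\<close> times the squares of the coordinates of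
  \<open>c\<close>.\<close>

lemma laplace_lift:
  assumes h: "smooth_fun h"
  shows "laplace_beltrami (metric_matrix j) (lift c h) x
    = lift c (\<lambda>y. 2 * mag_lap (cross_form2 b c) h y + of_real (16 * pi\<^sup>2 * (c \<bullet> c)) * h y) x"
proof -
  have v: "left_deriv j (axis (Inl a) 1) (left_deriv j (axis (Inl a) 1) (lift c h)) x =
      lift c (cov_deriv (cross_form2 b c) (qmap (axis (Inl a) 1))
          (cov_deriv (cross_form2 b c) (qmap (axis (Inl a) 1)) h)) x" for a
    by (simp add: left_deriv_lift h cross_form2.smooth_fun_cov_deriv axis_parts)
  have z: "left_deriv j (axis (Inr k) 1) (left_deriv j (axis (Inr k) 1) (lift c h)) x
      = lift c (\<lambda>y. - of_real (16 * pi\<^sup>2 * (c $ k)\<^sup>2) * h y) x" for k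
  proof -
    have z1: "left_deriv j (axis (Inr k) 1) (lift c g)
        = lift c (\<lambda>y. (4 * pi * \<i> * of_real (c $ k)) * g y)" if "smooth_fun g" for g
      using that by (simp add: left_deriv_lift qmap_axis axis_parts
          cov_deriv_zero[OF cross_form2.magnetic_axioms] inner_axis)
    have "left_deriv j (axis (Inr k) 1) (left_deriv j (axis (Inr k) 1) (lift c h)) =
        lift c (\<lambda>y. (4 * pi * \<i> * of_real (c $ k)) * ((4 * pi * \<i> * of_real (c $ k)) * h y))"
      by (simp only: z1 h smooth_fun_mult smooth_fun_const)
    also have "(\<lambda>y. (4 * pi * \<i> * of_real (c $ k)) * ((4 * pi * \<i> * of_real (c $ k)) * h y))
        = (\<lambda>y. - of_real (16 * pi\<^sup>2 * (c $ k)\<^sup>2) * h y)"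
    proof
      fix y
      have "\<i> * \<i> = (- 1 :: complex)" by simp
      then show "(4 * pi * \<i> * of_real (c $ k)) * ((4 * pi * \<i> * of_real (c $ k)) * h y) =
          - of_real (16 * pi\<^sup>2 * (c $ k)\<^sup>2) * h y"
        unfolding of_real_mult of_real_power of_real_numeral by algebra
    qed
    finally show ?thesis by simp
  qed
  have pm: "cov_deriv (cross_form2 b c) (e, e) (cov_deriv (cross_form2 b c) (e, e) h) y
      + cov_deriv (cross_form2 b c) (e, - e) (cov_deriv (cross_form2 b c) (e, - e) h) y
      = 2 * cov_deriv (cross_form2 b c) (e, 0) (cov_deriv (cross_form2 b c) (e, 0) h) y
          + 2 * cov_deriv (cross_form2 b c) (0, e) (cov_deriv (cross_form2 b c) (0, e) h) y" for e y
  proof -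
    have p: "cov_deriv (cross_form2 b c) (e, e) g = (\<lambda>y. cov_deriv (cross_form2 b c) (e, 0) g y
        + cov_deriv (cross_form2 b c) (0, e) g y)" if "smooth_fun g" for g
      using cross_form2.cov_deriv_vec_add[OF that, of b c "(e, 0)" "(0, e)"] by (simp add: fun_eq_iff)
    have m: "cov_deriv (cross_form2 b c) (e, - e) g = (\<lambda>y. cov_deriv (cross_form2 b c) (e, 0) g y
        + (- 1) * cov_deriv (cross_form2 b c) (0, e) g y)" if "smooth_fun g" for g
      using cross_form2.cov_deriv_vec_add[OF that, of b c "(e, 0)" "- 1 *\<^sub>R (0, e)"]
          cross_form2.cov_deriv_vec_scale[OF that, of b c "- 1" "(0, e)"]
      by (simp add: fun_eq_iff)
    have p': "cov_deriv (cross_form2 b c) (e, e) g y = cov_deriv (cross_form2 b c) (e, 0) g y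
        + cov_deriv (cross_form2 b c) (0, e) g y" if "smooth_fun g" for g
      by (rule fun_cong[OF p[OF that]])
    have m': "cov_deriv (cross_form2 b c) (e, - e) g y = cov_deriv (cross_form2 b c) (e, 0) g y
        + (- 1) * cov_deriv (cross_form2 b c) (0, e) g y" if "smooth_fun g" for g
      by (rule fun_cong[OF m[OF that]])
    have "cov_deriv (cross_form2 b c) (e, e) (cov_deriv (cross_form2 b c) (e, e) h) y =
       cov_deriv (cross_form2 b c) (e, 0) (cov_deriv (cross_form2 b c) (e, 0) h) y
           + cov_deriv (cross_form2 b c) (e, 0) (cov_deriv (cross_form2 b c) (0, e) h) y +
       (cov_deriv (cross_form2 b c) (0, e) (cov_deriv (cross_form2 b c) (e, 0) h) y
           + cov_deriv (cross_form2 b c) (0, e) (cov_deriv (cross_form2 b c) (0, e) h) y)"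
      unfolding p'[OF cross_form2.smooth_fun_cov_deriv[OF h]] unfolding p[OF h]
          by (simp only: cross_form2.cov_deriv_add cross_form2.smooth_fun_cov_deriv h)
    moreover have "cov_deriv (cross_form2 b c) (e, - e) (cov_deriv (cross_form2 b c) (e, - e) h) y =
       cov_deriv (cross_form2 b c) (e, 0) (cov_deriv (cross_form2 b c) (e, 0) h) y
           + (- 1) * cov_deriv (cross_form2 b c) (e, 0) (cov_deriv (cross_form2 b c) (0, e) h) y +
       (- 1) * (cov_deriv (cross_form2 b c) (0, e) (cov_deriv (cross_form2 b c) (e, 0) h) y
           + (- 1) * cov_deriv (cross_form2 b c) (0, e) (cov_deriv (cross_form2 b c) (0, e) h) y)"
      unfolding m'[OF cross_form2.smooth_fun_cov_deriv[OF h]] unfolding m[OF h]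
      by (simp only: cross_form2.cov_deriv_add cross_form2.cov_deriv_cmult smooth_fun_mult
          smooth_fun_const cross_form2.smooth_fun_cov_deriv h)
    ultimately show ?thesis by simp
  qed
  have "(\<Sum>a\<in>UNIV. left_deriv j (axis a 1) (left_deriv j (axis a 1) (lift c h)) x)
      = cis (4 * pi * (c \<bullet> rpart x)) *
          ((\<Sum>i\<in>UNIV. cov_deriv (cross_form2 b c) (axis i 1, axis i 1)
          (cov_deriv (cross_form2 b c) (axis i 1, axis i 1) h) (qmap x)
          + cov_deriv (cross_form2 b c) (axis i 1, - axis i 1)
              (cov_deriv (cross_form2 b c) (axis i 1, - axis i 1) h) (qmap x))
        - of_real (16 * pi\<^sup>2 * (c \<bullet> c)) * h (qmap x))"
    unfolding sum_UNIV_Plus v z qmap_axis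
    by (simp add: lift_def sum.distrib sum_distrib_left sum_distrib_right distrib_left
        right_diff_distrib inner_vec_def
        power2_eq_square sum_negf mult_ac)
  also have "(\<Sum>i\<in>UNIV. cov_deriv (cross_form2 b c) (axis i 1, axis i 1)
      (cov_deriv (cross_form2 b c) (axis i 1, axis i 1) h) (qmap x)
          + cov_deriv (cross_form2 b c) (axis i 1, - axis i 1)
              (cov_deriv (cross_form2 b c) (axis i 1, - axis i 1) h) (qmap x)) =
              - 2 * mag_lap (cross_form2 b c) h (qmap x)"
    unfolding pm mag_lap_def sum_Basis_prod sum_Basis_axis by (simp add: sum.distrib sum_distrib_left)
  finally show ?thesis
    unfolding laplace_beltrami_eq[OF j smooth_fun_lift[OF h]]
        by (simp only:) (simp add: lift_def algebra_simps)
qed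

lemma nil_mult_lift:
  "lift c h (nil_mult j \<gamma> x) = cis (4 * pi * (c \<bullet> rpart \<gamma>)) * lift c
      (mag_transl (cross_form2 b c) (qmap \<gamma>) h) x"
proof -
  have q: "qmap (nil_mult j \<gamma> x) = qmap x + qmap \<gamma>"
    using linear_qmap by (simp add: nil_mult_def linear_add linear_cmul qmap_bracket)
  have "4 * pi * (c \<bullet> rpart (nil_mult j \<gamma> x)) = 4 * pi * (c \<bullet> rpart \<gamma>)
      + (4 * pi * (c \<bullet> rpart x) + cross_form2 b c (qmap \<gamma>) (qmap x))"
    by (simp add: nil_mult_def inner_add_right form algebra_simps)
  then show ?thesis
    unfolding lift_def q mag_transl_def by (simp add: mult_ac flip: cis_mult)
qed

end

section \<open>Invariant eigenfunctions and central Fourier modes\<close>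

lemma int_span_range:
  fixes v :: "'i::finite \<Rightarrow> 'a::real_vector"
  assumes "inj v"
  shows "int_span (range v) = {\<Sum>a\<in>UNIV. of_int (n a) *\<^sub>R v a | n. True}"
proof (intro equalityI subsetI)
  fix x assume "x \<in> int_span (range v)"
  then obtain c where "x = (\<Sum>s\<in>range v. of_int (c s) *\<^sub>R s)" by (auto simp: int_span_def)
  then have "x = (\<Sum>a\<in>UNIV. of_int ((c \<circ> v) a) *\<^sub>R v a)" using assms by (simp add: sum.reindex)
  then show "x \<in> {\<Sum>a\<in>UNIV. of_int (n a) *\<^sub>R v a | n. True}" by blast
next
  fix x assume "x \<in> {\<Sum>a\<in>UNIV. of_int (n a) *\<^sub>R v a | n. True}"
  then obtain n where "x = (\<Sum>a\<in>UNIV. of_int (n a) *\<^sub>R v a)" by blast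
  then have "x = (\<Sum>s\<in>range v. of_int ((n \<circ> inv v) s) *\<^sub>R s)" using assms by (simp add: sum.reindex)
  then show "x \<in> int_span (range v)" unfolding int_span_def by blast
qed

lemma lattice_R_iff: "\<gamma> \<in> lattice_R \<longleftrightarrow> int_vec (lpart \<gamma>) \<and> (\<forall>k. 2 * rpart \<gamma> $ k \<in> \<int>)"
proof -
  have "inj (\<lambda>a. axis (Inl a) 1 :: real ^ ((3 + 3) + 3))"
      "inj (\<lambda>b. (1 / 2) *\<^sub>R axis (Inr b) 1 :: real ^ ((3 + 3) + 3))"
    by (auto intro!: injI simp: axis_eq_axis)
  note span = int_span_range[OF this(1)] int_span_range[OF this(2)]
  have comp: "(\<Sum>a\<in>UNIV. of_int (m a) *\<^sub>R axis (Inl a) 1 :: real ^ ((3 + 3) + 3)) $ i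
      = (case i of Inl a \<Rightarrow> of_int (m a) | Inr k \<Rightarrow> 0)"
    "(\<Sum>k\<in>UNIV. of_int (l k) *\<^sub>R (1 / 2) *\<^sub>R axis (Inr k) 1 :: real ^ ((3 + 3) + 3)) $ i
        = (case i of Inl a \<Rightarrow> 0 | Inr k \<Rightarrow> of_int (l k) / 2)"
    for m l i
    by (auto simp: sum_component axis_def if_distrib split: sum.split cong: if_cong)
  show ?thesis
  proof
    assume "\<gamma> \<in> lattice_R"
    then obtain m l where \<gamma>: "\<gamma> = (\<Sum>a\<in>UNIV. of_int (m a) *\<^sub>R axis (Inl a) 1)
        + (\<Sum>k\<in>UNIV. of_int (l k) *\<^sub>R (1 / 2) *\<^sub>R axis (Inr k) 1)"
      unfolding lattice_R_def lattice_M_def lattice_L_def span by blast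
    show "int_vec (lpart \<gamma>) \<and> (\<forall>k. 2 * rpart \<gamma> $ k \<in> \<int>)"
      unfolding \<gamma> int_vec_def part_nth vector_add_component comp by simp
  next
    assume \<gamma>: "int_vec (lpart \<gamma>) \<and> (\<forall>k. 2 * rpart \<gamma> $ k \<in> \<int>)"
    have floor: "of_int \<lfloor>r\<rfloor> = r" if "r \<in> \<int>" for r :: real
      using that by (auto elim: Ints_cases)
    have f1: "of_int \<lfloor>\<gamma> $ Inl a\<rfloor> = \<gamma> $ Inl a" for a
      by (rule floor) (use \<gamma> in \<open>simp add: int_vec_def\<close>)
    have f2: "of_int \<lfloor>2 * \<gamma> $ Inr k\<rfloor> = 2 * \<gamma> $ Inr k" for k
      by (rule floor) (use \<gamma> in simp)
    let ?m = "(\<Sum>a\<in>UNIV. of_int \<lfloor>\<gamma> $ Inl a\<rfloor> *\<^sub>R axis (Inl a) 1) :: real ^ ((3 + 3) + 3)"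
    let ?l = "(\<Sum>k\<in>UNIV. of_int \<lfloor>2 * \<gamma> $ Inr k\<rfloor> *\<^sub>R (1 / 2) *\<^sub>R axis (Inr k) 1) :: real ^ ((3 + 3) + 3)"
    have "\<gamma> = ?m + ?l"
      unfolding vec_eq_iff vector_add_component comp by (auto simp: f1 f2 split: sum.split)
    moreover have "?m \<in> lattice_M"
      unfolding lattice_M_def span by (intro CollectI exI[of _ "\<lambda>a. \<lfloor>\<gamma> $ Inl a\<rfloor>"] conjI refl TrueI)
    moreover have "?l \<in> lattice_L"
      unfolding lattice_L_def span by (intro CollectI exI[of _ "\<lambda>k. \<lfloor>2 * \<gamma> $ Inr k\<rfloor>"] conjI refl TrueI)
    ultimately show "\<gamma> \<in> lattice_R" unfolding lattice_R_def by blast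
  qed
qed

text \<open>Integrality is enough for closure of \<open>lattice_R\<close>: the product contains half
  a bracket, and the central part of the lattice is half-integral.\<close>

definition integral_bracket :: "(real ^ 3 \<Rightarrow> real ^ (3 + 3) \<Rightarrow> real ^ (3 + 3)) \<Rightarrow> bool" where
  "integral_bracket j \<longleftrightarrow> (\<forall>x y. int_vec (lpart x) \<longrightarrow> int_vec (lpart y)
      \<longrightarrow> int_vec (rpart (nil_bracket j x y)))"

lemma integral_bracket_j: "integral_bracket j_one" "integral_bracket j_two"
  unfolding integral_bracket_def
  by (auto simp: int_vec_def j_one_def j_two_def quat_Im_def pure_quat_def inner_parts inner_vec_def
      sum_3 axis_def
      intro!: Ints_add Ints_diff Ints_mult Ints_minus)

definition inv_eig :: "(real ^ 3 \<Rightarrow> real ^ (3 + 3) \<Rightarrow> real ^ (3 + 3)) \<Rightarrow> complex \<Rightarrow>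
    (real ^ ((3 + 3) + 3) \<Rightarrow> complex) set" where
  "inv_eig j \<mu> = {f. smooth_fun f \<and> (\<forall>\<gamma>\<in>lattice_R. \<forall>x. f (nil_mult j \<gamma> x) = f x) \<and>
     (\<forall>x. laplace_beltrami (metric_matrix j) f x = \<mu> * f x)}"

definition central_period :: "3 \<Rightarrow> real ^ ((3 + 3) + 3)" where
  "central_period k = axis (Inr k) (1 / 2)"

text \<open>\<open>K\<close> is the set of central coordinates whose Fourier mode is fixed, so that
  the modes can be fixed one coordinate at a time.\<close>

definition mode_eig :: "(real ^ 3 \<Rightarrow> real ^ (3 + 3) \<Rightarrow> real ^ (3 + 3)) \<Rightarrow> complex \<Rightarrow> 3 set \<Rightarrow> (3 \<Rightarrow> int) \<Rightarrow>
    (real ^ ((3 + 3) + 3) \<Rightarrow> complex) set" where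
  "mode_eig j \<mu> K n = {f \<in> inv_eig j \<mu>. \<forall>k\<in>K. \<forall>x t. f (x + t *\<^sub>R central_period k)
      = cis (2 * pi * of_int (n k) * t) * f x}"

context
  fixes j :: "real ^ 3 \<Rightarrow> real ^ (3 + 3) \<Rightarrow> real ^ (3 + 3)"
  assumes j: "so_map j"
begin

lemma left_deriv_add: "smooth_fun f \<Longrightarrow> smooth_fun g \<Longrightarrow> left_deriv j U (\<lambda>x. f x + g x)
    = (\<lambda>x. left_deriv j U f x + left_deriv j U g x)"
  by (simp add: left_deriv_def fun_eq_iff dir_deriv_add smooth_fun_differentiable)

lemma left_deriv_cmult: "smooth_fun f \<Longrightarrow> left_deriv j U (\<lambda>x. r * f x) = (\<lambda>x. r * left_deriv j U f x)"
  by (simp add: left_deriv_def fun_eq_iff dir_deriv_cmult)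

lemma inv_eig_iff:
  "f \<in> inv_eig j \<mu> \<longleftrightarrow> smooth_fun f \<and> (\<forall>\<gamma>\<in>lattice_R. \<forall>x. f (nil_mult j \<gamma> x) = f x) \<and>
     (\<forall>x. (\<Sum>a\<in>UNIV. left_deriv j (axis a 1) (left_deriv j (axis a 1) f) x) = - \<mu> * f x)"
  unfolding inv_eig_def by (auto simp: laplace_beltrami_eq[OF j] minus_equation_iff
      eq_commute[of "- _" "_ * _"])

lemma subspace_inv_eig: "cfun.subspace (inv_eig j \<mu>)"
proof (rule cfun.subspaceI)
  show "0 \<in> inv_eig j \<mu>"
    unfolding inv_eig_iff zero_fun_def by (simp add: left_deriv_def dir_deriv_const smooth_fun_const)
  show "f + g \<in> inv_eig j \<mu>" if "f \<in> inv_eig j \<mu>" "g \<in> inv_eig j \<mu>" for f g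
    using that unfolding inv_eig_iff plus_fun_def
    by (simp add: left_deriv_add smooth_fun_left_deriv[OF j] smooth_fun_add sum.distrib distrib_left)
  show "(\<lambda>x. c * f x) \<in> inv_eig j \<mu>" if "f \<in> inv_eig j \<mu>" for c f
    using that smooth_fun_mult[OF smooth_fun_const, of f c] unfolding inv_eig_iff
    by (simp add: left_deriv_cmult smooth_fun_left_deriv[OF j] mult.left_commute flip: sum_distrib_left)
qed

lemma bracket_central: "nil_bracket j x (t *\<^sub>R central_period k) = 0"
    "nil_bracket j (t *\<^sub>R central_period k) x = 0"
proof -
  have e: "t *\<^sub>R central_period k = dsum 0 (t *\<^sub>R axis k (1 / 2))"
    by (rule dsum_eqI) (simp_all add: central_period_def axis_parts)
  show "nil_bracket j x (t *\<^sub>R central_period k) = 0" unfolding e by (rule nil_bracket_center[OF j])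
  then show "nil_bracket j (t *\<^sub>R central_period k) x = 0"
      using nil_bracket_skew[OF j, of "t *\<^sub>R central_period k" x] by simp
qed

lemmas bracket_central_1 = bracket_central[where t = 1, unfolded scaleR_one]

lemma nil_mult_central: "nil_mult j x (y + t *\<^sub>R central_period k) = nil_mult j x y
    + t *\<^sub>R central_period k"
  by (simp add: nil_mult_def bracket_simps[OF j] bracket_central_1)

lemma left_field_central: "left_field j U (x + t *\<^sub>R central_period k) = left_field j U x"
  by (simp add: left_field_eq[OF j] bracket_simps[OF j] bracket_central_1)

text \<open>Left-invariant fields do not change under central translations, so averaging over these
  commutes with them.\<close>

lemma left_deriv_fourier_proj:
  assumes "smooth_fun f"
  shows "left_deriv j U (fourier_proj (central_period k) n f) = fourier_proj (central_period k) n
      (left_deriv j U f)"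
  unfolding left_deriv_def dir_deriv_fourier_proj[OF assms]
      by (rule ext) (simp add: fourier_proj_def left_field_central)

lemma inv_eig_fourier_proj:
  assumes f: "f \<in> inv_eig j \<mu>"
  shows "fourier_proj (central_period k) n f \<in> inv_eig j \<mu>"
proof -
  let ?P = "fourier_proj (central_period k) n"
  have smf: "smooth_fun f" and inv: "\<And>\<gamma> x. \<gamma> \<in> lattice_R \<Longrightarrow> f (nil_mult j \<gamma> x) = f x"
    and lap: "\<And>x. laplace_beltrami (metric_matrix j) f x = \<mu> * f x" using f by (auto simp: inv_eig_def)
  have "?P f (nil_mult j \<gamma> x) = 1 * ?P f x" if "\<gamma> \<in> lattice_R" for \<gamma> x
    by (rule fourier_proj_translate) (simp add: inv[OF that] flip: nil_mult_central)
  moreover have "laplace_beltrami (metric_matrix j) (?P f) x = \<mu> * ?P f x" for x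
  proof -
    have "laplace_beltrami (metric_matrix j) (?P f) x =
        - (\<Sum>a\<in>UNIV. ?P (left_deriv j (axis a 1) (left_deriv j (axis a 1) f)) x)"
      by (simp add: laplace_beltrami_eq[OF j] smooth_fun_fourier_proj smf left_deriv_fourier_proj
          smooth_fun_left_deriv[OF j])
    also have "\<dots> = ?P (\<lambda>x. (- 1) * (\<Sum>a\<in>UNIV. left_deriv j (axis a 1) (left_deriv j (axis a 1) f) x)) x"
      unfolding fourier_proj_cmult
      by (subst fourier_proj_sum) (auto intro!: smooth_fun_continuous smooth_fun_left_deriv[OF j] smf)
    also have "(\<lambda>x. (- 1) * (\<Sum>a\<in>UNIV. left_deriv j (axis a 1) (left_deriv j (axis a 1) f) x))
        = (\<lambda>x. \<mu> * f x)"
      using lap by (simp add: fun_eq_iff laplace_beltrami_eq[OF j smf])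
    finally show ?thesis by (simp only: fourier_proj_cmult)
  qed
  ultimately show ?thesis using smooth_fun_fourier_proj[OF smf] by (simp add: inv_eig_def)
qed

lemma central_period_in_lattice: "central_period k \<in> lattice_R"
  by (auto simp: lattice_R_iff central_period_def axis_parts int_vec_def axis_def)

lemma inv_eig_central_periodic:
  assumes f: "f \<in> inv_eig j \<mu>"
  shows "f (x + central_period k) = f x"
proof -
  have "f (nil_mult j (central_period k) x) = f x"
    using f central_period_in_lattice by (auto simp: inv_eig_def)
  then show ?thesis using bracket_central(2)[of 1 k x] by (simp add: nil_mult_def add.commute)
qed

lemma subspace_mode_eig: "cfun.subspace (mode_eig j \<mu> K n)"
  by (rule cfun.subspaceI)
    (use cfun.subspace_0[OF subspace_inv_eig] cfun.subspace_add[OF subspace_inv_eig]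
        cfun.subspace_scale[OF subspace_inv_eig]
     in \<open>auto simp: mode_eig_def distrib_left mult.left_commute\<close>)

lemma mode_eig_fourier_proj:
  assumes f: "f \<in> mode_eig j \<mu> K n"
  shows "fourier_proj (central_period k) m f \<in> mode_eig j \<mu> K n"
proof -
  have "fourier_proj (central_period k) m f (x + t *\<^sub>R central_period k') =
      cis (2 * pi * of_int (n k') * t) * fourier_proj (central_period k) m f x" if "k' \<in> K" for k' x t
  proof (rule fourier_proj_translate)
    show "f (x + t *\<^sub>R central_period k' + s *\<^sub>R central_period k) =
        cis (2 * pi * of_int (n k') * t) * f (x + s *\<^sub>R central_period k)" for s
    proof -
      have "x + t *\<^sub>R central_period k' + s *\<^sub>R central_period k = (x + s *\<^sub>R central_period k)
          + t *\<^sub>R central_period k'"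
        by simp
      then show ?thesis using f that by (simp only:) (simp add: mode_eig_def)
    qed
  qed
  then show ?thesis using f inv_eig_fourier_proj by (simp add: mode_eig_def)
qed

end

text \<open>\<open>S\<close> holds the central coordinates with free mode. A Fourier decomposition
  along the period of one of them reduces to a smaller \<open>S\<close>, and the other coordinates
  keep their modes.\<close>

lemma mode_eig_le:
  assumes j: "so_map j" and j': "so_map j'"
    and le: "\<And>n. mdim (mode_eig j \<mu> UNIV n) \<le> mdim (mode_eig j' \<mu> UNIV n)"
  shows "mdim (mode_eig j \<mu> (UNIV - S) n) \<le> mdim (mode_eig j' \<mu> (UNIV - S) n)"
  using finite[of S]
proof (induction S arbitrary: n rule: finite_induct)
  case empty
  then show ?case using le by simp
next
  case (insert a S)
  have modes: "{f \<in> mode_eig j \<mu> (UNIV - insert a S) n. \<forall>x t. f (x + t *\<^sub>R central_period a)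
      = cis (2 * pi * of_int m * t) * f x} =
      mode_eig j \<mu> (UNIV - S) (n(a := m))" for j m
    using insert.hyps by (auto simp: mode_eig_def)
  show ?case
  proof (rule mdim_le_fourier[where w = "central_period a" and w' = "central_period a"])
    fix f assume f: "f \<in> mode_eig j \<mu> (UNIV - insert a S) n"
    then have f': "f \<in> inv_eig j \<mu>" by (simp add: mode_eig_def)
    then show "continuous_on UNIV f" by (simp add: inv_eig_def smooth_fun_continuous)
    show "f (x + central_period a) = f x" for x by (rule inv_eig_central_periodic[OF j f'])
    show "fourier_proj (central_period a) m f \<in> mode_eig j \<mu> (UNIV - insert a S) n" for m
      by (rule mode_eig_fourier_proj[OF j f])
  qed (simp_all only: modes insert.IH subspace_mode_eig[OF j] subspace_mode_eig[OF j'])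
qed

lemma inv_eig_le:
  assumes "so_map j" "so_map j'" "\<And>n. mdim (mode_eig j \<mu> UNIV n) \<le> mdim (mode_eig j' \<mu> UNIV n)"
  shows "mdim (inv_eig j \<mu>) \<le> mdim (inv_eig j' \<mu>)"
  using mode_eig_le[OF assms, of UNIV "\<lambda>_. 0"] by (simp add: mode_eig_def)

definition mode_vec :: "(3 \<Rightarrow> int) \<Rightarrow> real ^ 3" where
  "mode_vec n = (\<chi> k. of_int (n k))"

lemma int_vec_mode_vec: "int_vec (mode_vec n)"
  by (simp add: int_vec_def mode_vec_def)

lemma mode_eig_central:
  assumes f: "f \<in> mode_eig j \<mu> UNIV n"
  shows "f (x + dsum 0 z) = cis (4 * pi * (mode_vec n \<bullet> z)) * f x"
proof -
  have m: "f (x + t *\<^sub>R central_period k) = cis (2 * pi * of_int (n k) * t) * f x" for x t k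
    using f by (auto simp: mode_eig_def)
  have "dsum 0 z = (2 * z $ 1) *\<^sub>R central_period 1 + (2 * z $ 2) *\<^sub>R central_period 2
      + (2 * z $ 3) *\<^sub>R central_period 3"
    by (rule dsum_eqI) (simp_all add: central_period_def axis_parts vec_eq_iff forall_3 axis_def)
  then have "f (x + dsum 0 z) = f (x + (2 * z $ 1) *\<^sub>R central_period 1
      + (2 * z $ 2) *\<^sub>R central_period 2 + (2 * z $ 3) *\<^sub>R central_period 3)"
    by (simp add: add.assoc)
  also have "\<dots> = cis (2 * pi * of_int (n 3) * (2 * z $ 3)
      + (2 * pi * of_int (n 2) * (2 * z $ 2) + 2 * pi * of_int (n 1) * (2 * z $ 1))) * f x"
    unfolding m by (simp add: mult.assoc flip: cis_mult)
  also have "2 * pi * of_int (n 3) * (2 * z $ 3)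
      + (2 * pi * of_int (n 2) * (2 * z $ 2) + 2 * pi * of_int (n 1) * (2 * z $ 1))
      = 4 * pi * (mode_vec n \<bullet> z)"
    by (simp add: mode_vec_def inner_vec_def sum_3 algebra_simps)
  finally show ?thesis .
qed

text \<open>On functions invariant under the centre the bracket drops out of the left-invariant
  fields and of the group product. The right-hand side does not mention \<open>j\<close>, so both
  structures share this space.\<close>

lemma mode_eig_zero:
  assumes j: "so_map j" and n: "mode_vec n = 0"
  shows "f \<in> mode_eig j \<mu> UNIV n \<longleftrightarrow> smooth_fun f \<and> (\<forall>x z. f (x + dsum 0 z) = f x)
      \<and> (\<forall>\<gamma>\<in>lattice_R. \<forall>x. f (\<gamma> + x) = f x) \<and>
    (\<forall>x. (\<Sum>a\<in>UNIV. dir_deriv (axis a 1) (dir_deriv (axis a 1) f) x) = - \<mu> * f x)"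
proof -
  have br: "nil_bracket j x y = dsum 0 (rpart (nil_bracket j x y))" for x y by (rule dsum_eqI) simp_all
  have dd0: "left_deriv j U g = dir_deriv U g" if g: "smooth_fun g" "\<And>x z. g (x + dsum 0 z) = g x"
      for g U
  proof
    fix x
    \<comment> \<open>Constancy along the centre is read as Fourier mode \<open>0\<close>.\<close>
    have "dir_deriv (nil_bracket j x U) g x = 2 * pi * \<i> * of_int 0 * g x"
    proof (rule dir_deriv_mode[OF g(1)])
      fix t
      have "t *\<^sub>R nil_bracket j x U = dsum 0 (t *\<^sub>R rpart (nil_bracket j x U))"
          by (rule dsum_eqI) simp_all
      then show "g (x + t *\<^sub>R nil_bracket j x U) = cis (2 * pi * of_int 0 * t) * g x"
          by (simp only: g(2)) simp
    qed
    then show "left_deriv j U g x = dir_deriv U g x"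
      by (simp only: left_deriv_def left_field_eq[OF j] dir_deriv_add_vec dir_deriv_scale_vec
          smooth_fun_differentiable[OF g(1)]) simp
  qed
  have dper: "dir_deriv U g (x + dsum 0 z) = dir_deriv U g x"
      if g: "smooth_fun g" "\<And>x z. g (x + dsum 0 z) = g x" for g U x z
    using dir_deriv_affine[OF bounded_linear_ident smooth_fun_differentiable[OF g(1)], of U
        "dsum 0 z" x] by (simp add: g(2))
  have mult: "g (nil_mult j \<gamma> x) = g (\<gamma> + x)" if g: "\<And>x z. g (x + dsum 0 z) = g x"
      for g :: "_ \<Rightarrow> complex" and \<gamma> x
  proof -
    have "(1 / 2) *\<^sub>R nil_bracket j \<gamma> x = dsum 0 ((1 / 2) *\<^sub>R rpart (nil_bracket j \<gamma> x))"
        by (rule dsum_eqI) simp_all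
    then show ?thesis unfolding nil_mult_def by (simp only: g)
  qed
  have per: "f (x + dsum 0 z) = f x" if "f \<in> mode_eig j \<mu> UNIV n" for x z
    using mode_eig_central[OF that, of x z] by (simp add: n)
  have n0: "n k = 0" for k using n by (simp add: mode_vec_def vec_eq_iff)
  have cp: "t *\<^sub>R central_period k = dsum 0 (t *\<^sub>R axis k (1 / 2))" for t k
    by (rule dsum_eqI) (simp_all add: central_period_def axis_parts)
  have "f \<in> mode_eig j \<mu> UNIV n \<longleftrightarrow> f \<in> inv_eig j \<mu> \<and> (\<forall>x z. f (x + dsum 0 z) = f x)"
    using per by (auto simp: mode_eig_def cp n0)
  also have "\<dots> \<longleftrightarrow> smooth_fun f \<and> (\<forall>x z. f (x + dsum 0 z) = f x) \<and> (\<forall>\<gamma>\<in>lattice_R. \<forall>x. f (\<gamma> + x) = f x) \<and>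
    (\<forall>x. (\<Sum>a\<in>UNIV. dir_deriv (axis a 1) (dir_deriv (axis a 1) f) x) = - \<mu> * f x)"
    unfolding inv_eig_iff[OF j] by (auto simp: dd0 smooth_fun_dir_deriv dper mult)
  finally show ?thesis .
qed

section \<open>Lattice invariance and eigenvalues of lifted functions\<close>

lemma int_vec_axis: "int_vec (axis i 1)"
  by (auto simp: int_vec_def axis_def)

lemma int_vec_inner: "int_vec x \<Longrightarrow> int_vec y \<Longrightarrow> x \<bullet> y \<in> \<int>"
  by (auto simp: int_vec_def inner_vec_def intro!: Ints_sum Ints_mult)

lemma cis_Ints: "r \<in> \<int> \<Longrightarrow> cis (2 * pi * r) = 1"
  by (rule cis_multiple_2pi)

context
  fixes j :: "real ^ 3 \<Rightarrow> real ^ (3 + 3) \<Rightarrow> real ^ (3 + 3)" and b :: "real ^ 3" and n :: "3 \<Rightarrow> int"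
  assumes j: "so_map j" and integral: "integral_bracket j"
    and form: "\<And>x y. cross_form2 b (mode_vec n) (qmap x) (qmap y)
        = 2 * pi * (mode_vec n \<bullet> rpart (nil_bracket j x y))"
begin

abbreviation (input) cc where "cc \<equiv> mode_vec n"

text \<open>On images of lattice vectors the form is \<open>2 * pi\<close> times an integer, so
  composing their translations produces no phase and invariance spreads from the generators to the
  whole lattice. The central part of a lattice vector has trivial character.\<close>

lemma lift_invariant_iff:
  "(\<forall>\<gamma>\<in>lattice_R. \<forall>x. lift cc h (nil_mult j \<gamma> x) = lift cc h x) \<longleftrightarrow>
   (\<forall>(m, \<theta>)\<in>conds_pm. mag_transl (cross_form2 b cc) m h = (\<lambda>x. \<theta> * h x))" (is "?L \<longleftrightarrow> ?R")
proof
  assume L: ?L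
  have gen: "mag_transl (cross_form2 b cc) (qmap (axis (Inl i) 1)) h = h" for i
  proof -
    have "(axis (Inl i) 1 :: real ^ ((3 + 3) + 3)) \<in> lattice_R"
      by (simp add: lattice_R_iff axis_parts int_vec_axis)
    then have "lift cc h (nil_mult j (axis (Inl i) 1) x) = lift cc h x" for x using L by blast
    then have "lift cc (mag_transl (cross_form2 b cc) (qmap (axis (Inl i) 1)) h) = lift cc h"
      by (simp add: fun_eq_iff nil_mult_lift[OF j form] axis_parts)
    then show ?thesis by (simp only: lift_inject)
  qed
  show ?R
  proof (clarify, unfold conds_pm_def, elim UnE imageE)
    fix m1 m2 e :: "real ^ 3" and \<theta> :: complex
    assume "e \<in> Basis" "((m1, m2), \<theta>) = ((e, e), 1)"
    then obtain i where "(m1, m2) = qmap (axis (Inl (Inl i)) 1)" "\<theta> = 1"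
      by (auto simp: Basis_vec_def qmap_axis)
    then show "mag_transl (cross_form2 b cc) (m1, m2) h = (\<lambda>x. \<theta> * h x)" using gen[of "Inl i"] by simp
  next
    fix m1 m2 e :: "real ^ 3" and \<theta> :: complex
    assume "e \<in> Basis" "((m1, m2), \<theta>) = ((e, - e), 1)"
    then obtain i where "(m1, m2) = qmap (axis (Inl (Inr i)) 1)" "\<theta> = 1"
      by (auto simp: Basis_vec_def qmap_axis)
    then show "mag_transl (cross_form2 b cc) (m1, m2) h = (\<lambda>x. \<theta> * h x)" using gen[of "Inr i"] by simp
  qed
next
  assume R: ?R
  have gen: "mag_transl (cross_form2 b cc) (qmap (axis (Inl i) 1)) h = h" for i
  proof -
    have "axis k 1 \<in> (Basis :: (real ^ 3) set)" for k by (auto simp: Basis_vec_def)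
    then have "(qmap (axis (Inl i) 1), 1) \<in> conds_pm" by (cases i) (auto simp: conds_pm_def qmap_axis)
    then show ?thesis using R by fastforce
  qed
  have q_dsum: "qmap (dsum v z) = qmap (dsum v 0)" for v z by (simp add: qmap_def)
  define P where "P v \<longleftrightarrow> int_vec v \<and> mag_transl (cross_form2 b cc) (qmap (dsum v 0)) h = h" for v
  have comp: "mag_transl (cross_form2 b cc) (qmap (dsum v 0))
      (mag_transl (cross_form2 b cc) (qmap (dsum w 0)) g) = mag_transl (cross_form2 b cc)
      (qmap (dsum (v + w) 0)) g"
    if "int_vec v" "int_vec w" for v w g
  proof
    fix x
    have "dsum (v + w) 0 = dsum v 0 + (dsum w 0 :: real ^ ((3 + 3) + 3))" by (rule dsum_eqI) simp_all
    then have q: "qmap (dsum (v + w) 0) = qmap (dsum v 0) + qmap (dsum w 0)"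
      using linear_qmap by (simp add: linear_add)
    have "int_vec (rpart (nil_bracket j (dsum w 0) (dsum v 0)))"
      using integral[unfolded integral_bracket_def, rule_format, of "dsum w 0" "dsum v 0"] that by simp
    then have "cis (cross_form2 b cc (qmap (dsum w 0)) (qmap (dsum v 0))) = 1"
      unfolding form using cis_Ints[OF int_vec_inner[OF int_vec_mode_vec]] by blast
    then show "mag_transl (cross_form2 b cc) (qmap (dsum v 0))
        (mag_transl (cross_form2 b cc) (qmap (dsum w 0)) g) x = mag_transl (cross_form2 b cc)
        (qmap (dsum (v + w) 0)) g x"
      by (simp add: cross_form2.mag_transl_mag_transl q)
  qed
  have zero: "mag_transl (cross_form2 b cc) (qmap (dsum 0 0)) g = g" for g
  proof -
    have "qmap (dsum 0 0) = 0" by (simp add: qmap_def vec_eq_iff zero_prod_def)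
    then show ?thesis by (simp add: mag_transl_def cross_form2.form_simps)
  qed
  have axis_dsum: "dsum (axis i 1) 0 = (axis (Inl i) 1 :: real ^ ((3 + 3) + 3))" for i
    by (rule dsum_eqI) (simp_all add: axis_parts)
  have all: "P v" if "int_vec v" for v
  proof (rule int_vec_induct[OF that])
    show "P 0" unfolding P_def zero by (simp add: int_vec_def)
    fix x e :: "real ^ (3 + 3)" assume e: "e \<in> Basis" and x: "P x"
    obtain i where i: "e = axis i 1" using e by (auto simp: Basis_vec_def)
    have ie: "int_vec e" "int_vec (- e)" "int_vec x" using x int_vec_Basis[OF e]
        by (auto simp: P_def int_vec_def)
    have Te: "mag_transl (cross_form2 b cc) (qmap (dsum e 0)) h = h" unfolding i axis_dsum by (rule gen)
    have Tx: "mag_transl (cross_form2 b cc) (qmap (dsum x 0)) h = h" using x by (simp add: P_def)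
    have "mag_transl (cross_form2 b cc) (qmap (dsum (- e) 0)) h = mag_transl (cross_form2 b cc)
        (qmap (dsum (- e) 0)) (mag_transl (cross_form2 b cc) (qmap (dsum e 0)) h)"
      by (simp only: Te)
    also have "\<dots> = h" unfolding comp[OF ie(2,1)] by (simp add: zero)
    finally have Tme: "mag_transl (cross_form2 b cc) (qmap (dsum (- e) 0)) h = h" .
    show "P (x + e)" using ie Tx Te comp[OF ie(3,1), of h] by (auto simp: P_def int_vec_def)
    show "P (x - e)" using ie Tx Tme comp[OF ie(3,2), of h] by (auto simp: P_def int_vec_def)
  qed
  show ?L
  proof (intro ballI allI)
    fix \<gamma> x assume \<gamma>: "\<gamma> \<in> lattice_R"
    then have "P (lpart \<gamma>)" by (intro all) (simp add: lattice_R_iff)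
    then have T: "mag_transl (cross_form2 b cc) (qmap \<gamma>) h = h" by (simp add: P_def qmap_def)
    have "int_vec (2 *\<^sub>R rpart \<gamma>)" using \<gamma> by (simp add: lattice_R_iff int_vec_def)
    from cis_Ints[OF int_vec_inner[OF int_vec_mode_vec this]]
    have "cis (4 * pi * (cc \<bullet> rpart \<gamma>)) = 1" by (simp add: mult_ac)
    then show "lift cc h (nil_mult j \<gamma> x) = lift cc h x"
      by (simp add: nil_mult_lift[OF j form] T)
  qed
qed

text \<open>By \<open>laplace_lift\<close> a magnetic eigenvalue \<open>\<kappa>\<close> corresponds
  to \<open>\<mu> = 2 * \<kappa> + 16 * pi\<^sup>2 * (cc \<bullet> cc)\<close>; the formula solves
  this for \<open>\<kappa>\<close>.\<close>

lemma lift_in_mode_eig_iff: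
  assumes h: "smooth_fun h"
  shows "lift cc h \<in> mode_eig j \<mu> UNIV n \<longleftrightarrow>
    h \<in> mag_eig (cross_form2 b cc) conds_pm ((\<mu> - of_real (16 * pi\<^sup>2 * (cc \<bullet> cc))) / 2)"
proof -
  have mode: "lift cc h (x + t *\<^sub>R central_period k) = cis (2 * pi * of_int (n k) * t) * lift cc h
      x" for k x t
  proof -
    have "qmap (x + t *\<^sub>R central_period k) = qmap x"
      using linear_qmap by (simp add: linear_add linear_cmul central_period_def qmap_axis)
    moreover have "4 * pi * (cc \<bullet> rpart (x + t *\<^sub>R central_period k)) = 2 * pi * of_int (n k) * t
        + 4 * pi * (cc \<bullet> rpart x)"
      by (simp add: central_period_def axis_parts inner_add_right inner_axis mode_vec_def algebra_simps)
    ultimately show ?thesis by (simp add: lift_def flip: cis_mult)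
  qed
  have "(\<forall>x. laplace_beltrami (metric_matrix j) (lift cc h) x = \<mu> * lift cc h x) \<longleftrightarrow>
      lift cc (\<lambda>y. 2 * mag_lap (cross_form2 b cc) h y + of_real (16 * pi\<^sup>2 * (cc \<bullet> cc)) * h y)
          = lift cc (\<lambda>y. \<mu> * h y)"
    by (simp only: fun_eq_iff laplace_lift[OF j form h] lift_cmult)
  also have "\<dots> \<longleftrightarrow> mag_lap (cross_form2 b cc) h = (\<lambda>y. (\<mu> - of_real (16 * pi\<^sup>2 * (cc \<bullet> cc))) / 2 * h y)"
    unfolding lift_inject unfolding fun_eq_iff by (rule all_cong1) (auto simp: field_simps)
  finally show ?thesis
    using mode h smooth_fun_lift[OF h] lift_invariant_iff[of h]
    by (simp only: mode_eig_def inv_eig_def mag_eig_def mem_Collect_eq) blast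
qed

text \<open>\<open>A\<close> is a linear section of \<open>qmap\<close> without central part; the
  central coordinate is restored by the character.\<close>

lemma mode_eig_is_lift:
  assumes f: "f \<in> mode_eig j \<mu> UNIV n"
  shows "\<exists>h. smooth_fun h \<and> f = lift cc h"
proof -
  define A where "A y = (dsum (dsum ((1 / 2) *\<^sub>R (fst y + snd y)) ((1 / 2) *\<^sub>R (fst y - snd y))) 0
      :: real ^ ((3 + 3) + 3))"
    for y :: "(real ^ 3) \<times> (real ^ 3)"
  have "linear A"
    unfolding A_def by (rule linearI; rule dsum_eqI) (auto intro!: dsum_eqI simp: algebra_simps)
  then have A: "bounded_linear A" by (simp add: linear_conv_bounded_linear)
  have smf: "smooth_fun f" using f by (simp add: mode_eig_def inv_eig_def)
  have "smooth_fun (\<lambda>y. f (A y))" using smooth_fun_affine[OF A smf, of 0] by simp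
  moreover have "f x = lift cc (\<lambda>y. f (A y)) x" for x
  proof -
    have "x = A (qmap x) + dsum 0 (rpart x)"
      unfolding A_def qmap_def by (rule dsum_eqI; (rule dsum_eqI)?) (simp_all add: vec_eq_iff)
    then have "f x = f (A (qmap x) + dsum 0 (rpart x))" by (rule arg_cong)
    also have "\<dots> = cis (4 * pi * (cc \<bullet> rpart x)) * f (A (qmap x))" by (rule mode_eig_central[OF f])
    finally show ?thesis by (simp add: lift_def)
  qed
  ultimately show ?thesis by blast
qed

lemma mdim_mode_eig:
  "mdim (mode_eig j \<mu> UNIV n)
      = mdim (mag_eig (cross_form2 b cc) conds_pm ((\<mu> - of_real (16 * pi\<^sup>2 * (cc \<bullet> cc))) / 2))"
proof (rule antisym)
  let ?T = "mag_eig (cross_form2 b cc) conds_pm ((\<mu> - of_real (16 * pi\<^sup>2 * (cc \<bullet> cc))) / 2)"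
  have lift_lin: "lift cc (g + h) = lift cc g + lift cc h"
      "lift cc (\<lambda>x. r * h x) = (\<lambda>x. r * lift cc h x)" for g h r
    by (auto simp: fun_eq_iff lift_def algebra_simps)
  have lift_0: "lift cc 0 = 0" by (simp add: fun_eq_iff lift_def)
  show "mdim ?T \<le> mdim (mode_eig j \<mu> UNIV n)"
  proof (rule mdim_le_inj[OF cross_form2.subspace_mag_eig, where \<Theta> = "lift cc"])
    show "linear_on ?T (lift cc)" unfolding linear_on_def
        by (intro conjI ballI allI) (simp_all only: lift_lin)
    show "h = 0" if "lift cc h = 0" for h
        by (rule iffD1[OF lift_inject[of cc]], rule trans[OF that lift_0[symmetric]])
    show "lift cc h \<in> mode_eig j \<mu> UNIV n" if "h \<in> ?T" for h
      using that lift_in_mode_eig_iff[OF twsD(1)[OF that]] by blast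
  qed
  define \<Theta> where "\<Theta> f = (THE h. lift cc h = f)" for f
  have \<Theta>: "\<Theta> (lift cc h) = h" for h
    unfolding \<Theta>_def by (rule the_equality) (simp_all only: lift_inject)
  have ex: "\<exists>h. h \<in> ?T \<and> f = lift cc h" if f: "f \<in> mode_eig j \<mu> UNIV n" for f
  proof -
    obtain h where h: "smooth_fun h" "f = lift cc h" using mode_eig_is_lift[OF f] by blast
    then show ?thesis using f lift_in_mode_eig_iff[OF h(1)] by blast
  qed
  show "mdim (mode_eig j \<mu> UNIV n) \<le> mdim ?T"
  proof (rule mdim_le_inj[OF subspace_mode_eig[OF j], where \<Theta> = \<Theta>])
    show "linear_on (mode_eig j \<mu> UNIV n) \<Theta>"
      unfolding linear_on_def
    proof (intro conjI ballI allI)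
      fix f g assume "f \<in> mode_eig j \<mu> UNIV n" "g \<in> mode_eig j \<mu> UNIV n"
      then obtain h k where "f = lift cc h" "g = lift cc k" using ex by meson
      then show "\<Theta> (f + g) = \<Theta> f + \<Theta> g" by (simp only: lift_lin(1)[symmetric] \<Theta>)
    next
      fix r f assume "f \<in> mode_eig j \<mu> UNIV n"
      then obtain h where "f = lift cc h" using ex by meson
      then show "\<Theta> (\<lambda>x. r * f x) = (\<lambda>x. r * \<Theta> f x)" by (simp only: lift_lin(2)[symmetric] \<Theta>)
    qed
    fix f assume "f \<in> mode_eig j \<mu> UNIV n"
    then obtain h where h: "h \<in> ?T" "f = lift cc h" using ex by meson
    then show "\<Theta> f \<in> ?T" by (simp only: \<Theta>)
    show "f = 0" if "\<Theta> f = 0" using that h(2) by (simp only: \<Theta> lift_0)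
  qed
qed

end

text \<open>Mode \<open>0\<close> is the flat torus. Otherwise \<open>pm_space_le\<close> is applied
  to the field \<open>c\<close> and to the field \<open>- c\<close>, which gives both
  inequalities.\<close>

lemma mdim_mode_eig_eq: "mdim (mode_eig j_one \<mu> UNIV n) = mdim (mode_eig j_two \<mu> UNIV n)"
proof (cases "mode_vec n = 0")
  case True
  then have "mode_eig j_one \<mu> UNIV n = mode_eig j_two \<mu> UNIV n"
    using mode_eig_zero[OF so_map_j(1)] mode_eig_zero[OF so_map_j(2)] by blast
  then show ?thesis by simp
next
  case False
  let ?c = "mode_vec n"
  have neg: "- ?c \<noteq> 0" "int_vec (- ?c)" using False int_vec_mode_vec[of n] by (auto simp: int_vec_def)
  have "mdim (mag_eig (cross_form2 ?c ?c) conds_pm \<kappa>)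
      = mdim (mag_eig (cross_form2 (- ?c) ?c) conds_pm \<kappa>)" for \<kappa>
    using pm_space_le[OF False int_vec_mode_vec, of ?c \<kappa>] pm_space_le[OF neg, of ?c \<kappa>]
    by (intro antisym) simp_all
  then show ?thesis
    by (simp only: mdim_mode_eig[OF so_map_j(1) integral_bracket_j(1) cross_form_one]
        mdim_mode_eig[OF so_map_j(2) integral_bracket_j(2) cross_form_two])
qed

text \<open>Pulling back along the projection identifies functions on the quotient with invariant
  functions; it is injective because eigenfunctions are required to vanish off the quotient.\<close>

lemma laplace_multiplicity_eq:
  assumes j: "so_map j" and integral: "integral_bracket j"
  shows "laplace_multiplicity j (lattice_group j) \<mu> = mdim (inv_eig j \<mu>)"
proof -
  have L: "lattice_group j = lattice_R" by (simp add: lattice_group_def nil_exp_eq[OF j])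
  let ?\<pi> = "nil_proj j lattice_R"
  have closed: "nil_mult j \<gamma> \<delta> \<in> lattice_R" if "\<gamma> \<in> lattice_R" "\<delta> \<in> lattice_R" for \<gamma> \<delta>
  proof -
    have "int_vec (rpart (nil_bracket j \<gamma> \<delta>))" using that integral
        by (simp add: lattice_R_iff integral_bracket_def)
    then have "2 * rpart (nil_mult j \<gamma> \<delta>) $ k \<in> \<int>" for k
      using that unfolding lattice_R_iff int_vec_def nil_mult_def
      by (auto simp: distrib_left simp del: nil_bracket_parts part_nth intro!: Ints_add)
    then show ?thesis using that by (auto simp: lattice_R_iff nil_mult_def int_vec_def)
  qed
  have uminus: "- \<gamma> \<in> lattice_R" if "\<gamma> \<in> lattice_R" for \<gamma>
    using that by (auto simp: lattice_R_iff int_vec_def)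
  have zero: "0 \<in> lattice_R" by (simp add: lattice_R_iff int_vec_def)
  have proj: "?\<pi> (nil_mult j \<gamma> p) = ?\<pi> p" if \<gamma>: "\<gamma> \<in> lattice_R" for \<gamma> p
  proof (intro equalityI subsetI)
    fix q assume "q \<in> ?\<pi> (nil_mult j \<gamma> p)"
    then obtain \<delta> where "\<delta> \<in> lattice_R" "q = nil_mult j (nil_mult j \<delta> \<gamma>) p"
      by (auto simp: nil_proj_def nil_mult_group[OF j])
    then show "q \<in> ?\<pi> p" using closed[OF _ \<gamma>] by (auto simp: nil_proj_def)
  next
    fix q assume "q \<in> ?\<pi> p"
    then obtain \<delta> where \<delta>: "\<delta> \<in> lattice_R" "q = nil_mult j \<delta> p" by (auto simp: nil_proj_def)
    then have "q = nil_mult j (nil_mult j \<delta> (- \<gamma>)) (nil_mult j \<gamma> p)"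
      by (simp add: nil_mult_group[OF j]) (simp add: nil_mult_group[OF j] flip: nil_mult_group(1)[OF j])
    then show "q \<in> ?\<pi> (nil_mult j \<gamma> p)" using closed[OF \<delta>(1) uminus[OF \<gamma>]] by (auto simp: nil_proj_def)
  qed
  have eigen: "u \<in> laplace_eigenspace j lattice_R \<mu> \<longleftrightarrow>
      (\<forall>c. c \<notin> nil_quotient j lattice_R \<longrightarrow> u c = 0) \<and> u \<circ> ?\<pi> \<in> inv_eig j \<mu>" for u
    unfolding laplace_eigenspace_def inv_eig_def smooth_iff_smooth_fun by (simp add: proj)
  have "mdim (laplace_eigenspace j lattice_R \<mu>) = mdim (inv_eig j \<mu>)"
  proof (rule antisym)
    have o_lin: "(u + v) \<circ> ?\<pi> = (u \<circ> ?\<pi>) + (v \<circ> ?\<pi>)" "(\<lambda>x. r * u x) \<circ> ?\<pi> = (\<lambda>x. r * (u \<circ> ?\<pi>) x)"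
        "0 \<circ> ?\<pi> = 0"
      for u v :: "_ \<Rightarrow> complex" and r
      by (simp_all add: fun_eq_iff)
    show "mdim (laplace_eigenspace j lattice_R \<mu>) \<le> mdim (inv_eig j \<mu>)"
    proof (rule mdim_le_inj[where \<Theta> = "\<lambda>u. u \<circ> ?\<pi>"])
      show "cfun.subspace (laplace_eigenspace j lattice_R \<mu>)"
      proof (rule cfun.subspaceI)
        show "0 \<in> laplace_eigenspace j lattice_R \<mu>"
          unfolding eigen o_lin using cfun.subspace_0[OF subspace_inv_eig[OF j]] by simp
        show "u + v \<in> laplace_eigenspace j lattice_R \<mu>"
          if "u \<in> laplace_eigenspace j lattice_R \<mu>" "v \<in> laplace_eigenspace j lattice_R \<mu>" for u v
          using that cfun.subspace_add[OF subspace_inv_eig[OF j]] unfolding eigen o_lin by simp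
        show "(\<lambda>x. r * u x) \<in> laplace_eigenspace j lattice_R \<mu>"
            if "u \<in> laplace_eigenspace j lattice_R \<mu>" for r u
        proof -
          have u: "u \<circ> ?\<pi> \<in> inv_eig j \<mu>" "\<forall>c. c \<notin> nil_quotient j lattice_R \<longrightarrow> u c = 0"
            using that unfolding eigen by blast+
          show ?thesis
            unfolding eigen o_lin using u(2)
            by (intro conjI cfun.subspace_scale[OF subspace_inv_eig[OF j] u(1)]) simp
        qed
      qed
      show "linear_on (laplace_eigenspace j lattice_R \<mu>) (\<lambda>u. u \<circ> ?\<pi>)"
        unfolding linear_on_def by (intro conjI ballI allI) (simp_all only: o_lin)
      show "u \<circ> ?\<pi> \<in> inv_eig j \<mu>" if "u \<in> laplace_eigenspace j lattice_R \<mu>" for u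
        using that unfolding eigen by blast
      show "u = 0" if "u \<in> laplace_eigenspace j lattice_R \<mu>" "u \<circ> ?\<pi> = 0" for u
      proof
        fix C
        show "u C = 0 C"
        proof (cases "C \<in> nil_quotient j lattice_R")
          case True
          then obtain p where "C = ?\<pi> p" by (auto simp: nil_quotient_def)
          then show ?thesis using fun_cong[OF that(2), of p] by simp
        next
          case False
          then show ?thesis using that(1) unfolding eigen by simp
        qed
      qed
    qed
    \<comment> \<open>The inverse of the pullback: an invariant function is evaluated at an
      arbitrary representative of the coset.\<close>
    define \<Theta> where "\<Theta> f C = (if C \<in> nil_quotient j lattice_R then f (SOME p. ?\<pi> p = C) else
        (0::complex))" for f C
    have \<Theta>\<pi>: "\<Theta> f \<circ> ?\<pi> = f" if f: "f \<in> inv_eig j \<mu>" for f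
    proof
      fix p
      define q where "q = (SOME q. ?\<pi> q = ?\<pi> p)"
      have "?\<pi> q = ?\<pi> p" unfolding q_def by (rule someI[of _ p]) simp
      moreover have "q \<in> ?\<pi> q"
        unfolding nil_proj_def by (rule image_eqI[OF _ zero]) (simp add: nil_mult_group[OF j])
      ultimately obtain \<gamma> where "\<gamma> \<in> lattice_R" "q = nil_mult j \<gamma> p" by (auto simp: nil_proj_def)
      then have "f q = f p" using f by (auto simp: inv_eig_def)
      moreover have "?\<pi> p \<in> nil_quotient j lattice_R" by (simp add: nil_quotient_def)
      ultimately show "(\<Theta> f \<circ> ?\<pi>) p = f p" by (simp add: \<Theta>_def q_def)
    qed
    show "mdim (inv_eig j \<mu>) \<le> mdim (laplace_eigenspace j lattice_R \<mu>)"
    proof (rule mdim_le_inj[OF subspace_inv_eig[OF j], where \<Theta> = \<Theta>])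
      show "linear_on (inv_eig j \<mu>) \<Theta>" by (simp add: linear_on_def \<Theta>_def fun_eq_iff)
      show "\<Theta> f \<in> laplace_eigenspace j lattice_R \<mu>" if "f \<in> inv_eig j \<mu>" for f
        unfolding eigen \<Theta>\<pi>[OF that] using that by (simp add: \<Theta>_def)
      show "f = 0" if f: "f \<in> inv_eig j \<mu>" "\<Theta> f = 0" for f
        using \<Theta>\<pi>[OF f(1)] unfolding f(2) o_lin by (rule sym)
    qed
  qed
  then show ?thesis unfolding L laplace_multiplicity_def mdim_def .
qed

theorem proposition2p3:
  shows "isospectral_nilmanifolds j_one (lattice_group j_one) j_two (lattice_group j_two)"
  unfolding isospectral_nilmanifolds_def
proof
  fix \<mu>
  have "mdim (inv_eig j_one \<mu>) = mdim (inv_eig j_two \<mu>)"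
    by (intro antisym inv_eig_le so_map_j) (simp_all add: mdim_mode_eig_eq)
  then show "laplace_multiplicity j_one (lattice_group j_one) \<mu> = laplace_multiplicity j_two
      (lattice_group j_two) \<mu>"
    by (simp only: laplace_multiplicity_eq[OF so_map_j(1) integral_bracket_j(1)]
        laplace_multiplicity_eq[OF so_map_j(2) integral_bracket_j(2)])
qed

end
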